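(* Suppose the finite-range defining potential $\Phi$ is translation-invariant and the disorder distribution $\mathbb P$ is asymptotically decoupled. Let $K^{\bar\sigma}$ be a translation-invariant joint measure constructed with spin boundary condition $\bar\sigma$, let $K$ be a translation-invariant probability measure on the joint configuration space, and let $K_d$ be its marginal on the disorder variables $\eta$. Then $$h(K|K^{\bar\sigma})=h(K_d|\mathbb P)-h(K)+h(K_d)+\sum_{A\ni0}\frac1{|A|}K\big(\Phi_A\big)+K\Big(\lim_{n\to\infty}\frac1{|\Lambda_n|}\log Z^{\bar\sigma}_{\Lambda_n}[\eta]\Big),$$ where the limit inside the last expectation exists for $K$-a.e. configuration.
   Context: Let $E,E'$ be finite sets; spin configurations $\sigma\in E^{\mathbb Z^d}$, disorder configurations $\eta\in(E')^{\mathbb Z^d}$, joint configurations $\xi=(\sigma,\eta)$. A defining potential $\Phi=(\Phi_A)_{A\text{ finite}}$ consists of real functions with $\Phi_A(\sigma,\eta)$ depending only on $(\sigma_A,\eta_A)$; finite range $r$: $\Phi_A=0$ if $\operatorname{diam}A>r$; translation-invariant: $\Phi_{A+x}(\xi)=\Phi_A(\tau_x\xi)$ with $(\tau_x\xi)(y)=\xi(x+y)$. Quenched finite-volume Gibbs measures: $\mu^{\bar\sigma}_\Lambda[\eta](B)=Z^{\bar\sigma}_\Lambda[\eta]^{-1}\sum_{\sigma_\Lambda}1_B(\sigma_\Lambda\bar\sigma_{\mathbb Z^d\setminus\Lambda})\exp(-\sum_{A\cap\Lambda\neq\emptyset}\Phi_A(\sigma_\Lambda\bar\sigma_{\mathbb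 Z^d\setminus\Lambda},\eta))$, with partition function $Z^{\bar\sigma}_\Lambda[\eta]$. A joint measure $K^{\bar\sigma}$ is a weak limit of $\mathbb P(d\eta)\mu^{\bar\sigma}_{\Lambda_N}[\eta](d\sigma)$ along some $\Lambda_N\uparrow\mathbb Z^d$, $\mathbb P$ a probability measure on $(E')^{\mathbb Z^d}$. $\Lambda_n=[-n,n]^d\cap\mathbb Z^d$. $\mathbb P$ is asymptotically decoupled if it is translation-invariant and there are $g_n,c_n$ with $c_n/|\Lambda_n|\to0$, $g_n/n\to0$, and $e^{-c_n}\le\mathbb P(A\cap B)/(\mathbb P(A)\mathbb P(B))\le e^{c_n}$ for all $A$ measurable w.r.t. coordinates in $\Lambda_n$, $B$ measurable w.r.t. coordinates outside $\Lambda_{n+g_n}$, with $\mathbb P(A)\mathbb P(B)\neq0$. For translation-invariant measures: $h(Q|Q')=\lim_n|\Lambda_n|^{-1}\sum_{\zeta_{\Lambda_n}}Q(\zeta_{\Lambda_n})\log\frac{Q(\zeta_{\Lambda_n})}{Q'(\zeta_{\Lambda_n})}$ (relative entropy density) and $h(Q)=-\lim_n|\Lambda_n|^{-1}\sum_{\zeta_{\Lambda_n}}Q(\zeta_{\Lambda_n})\log Q(\zeta_{\Lambda_n})$ (Kolmogorov–Sinai entropy). $K(f)$ denotes $\int f\,dK$. *)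

theory Defs
  imports "HOL-Probability.Probability"
begin

text \<open>Lattice sites: \<open>int ^ 'n\<close> with \<open>'n\<close> a finite type, so d = CARD('n).
  A configuration with single-site space \<open>'a\<close> is a function \<open>int ^ 'n \<Rightarrow> 'a\<close>.
  Joint configurations \<open>\<xi> = (\<sigma>,\<eta>)\<close> are represented as functions
  \<open>int ^ 'n \<Rightarrow> 'e \<times> 'd\<close>, i.e. \<open>\<xi> x = (\<sigma> x, \<eta> x)\<close>.\<close>

type_synonym 'n site = "int ^ 'n"

definition cfg_space :: "('n::finite site \<Rightarrow> 'a) measure" where
  "cfg_space = PiM UNIV (\<lambda>_. count_space UNIV)"

definition cfg_top :: "('n::finite site \<Rightarrow> 'a) topology" where
  "cfg_top = product_topology (\<lambda>_. discrete_topology UNIV) UNIV"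

definition shift :: "'n::finite site \<Rightarrow> ('n site \<Rightarrow> 'a) \<Rightarrow> ('n site \<Rightarrow> 'a)" where
  "shift x \<xi> = (\<lambda>y. \<xi> (x + y))"

definition box :: "nat \<Rightarrow> 'n::finite site set" where
  "box n = {x. \<forall>i. \<bar>x $ i\<bar> \<le> int n}"

definition site_diam :: "'n::finite site set \<Rightarrow> real" where
  "site_diam A = (if A = {} then 0 else
     Max {real_of_int \<bar>x $ i - y $ i\<bar> | x y i. x \<in> A \<and> y \<in> A})"

definition is_local_potential :: "('n::finite site set \<Rightarrow> ('n site \<Rightarrow> 'e \<times> 'd) \<Rightarrow> real) \<Rightarrow> bool" where
  "is_local_potential \<Phi> \<longleftrightarrow>
     (\<forall>A \<xi> \<xi>'. finite A \<longrightarrow> (\<forall>x\<in>A. \<xi> x = \<xi>' x) \<longrightarrow> \<Phi> A \<xi> = \<Phi> A \<xi>')"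

definition finite_range_potential :: "('n::finite site set \<Rightarrow> ('n site \<Rightarrow> 'e \<times> 'd) \<Rightarrow> real) \<Rightarrow> bool" where
  "finite_range_potential \<Phi> \<longleftrightarrow>
     (\<exists>r::real. \<forall>A. finite A \<longrightarrow> site_diam A > r \<longrightarrow> (\<forall>\<xi>. \<Phi> A \<xi> = 0))"

definition transl_inv_potential :: "('n::finite site set \<Rightarrow> ('n site \<Rightarrow> 'e \<times> 'd) \<Rightarrow> real) \<Rightarrow> bool" where
  "transl_inv_potential \<Phi> \<longleftrightarrow>
     (\<forall>A x \<xi>. finite A \<longrightarrow> \<Phi> ((\<lambda>a. a + x) ` A) \<xi> = \<Phi> A (shift x \<xi>))"

definition join_cfg :: "'n::finite site set \<Rightarrow> ('n site \<Rightarrow> 'e) \<Rightarrow> ('n site \<Rightarrow> 'e) \<Rightarrow> ('n site \<Rightarrow> 'd)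
    \<Rightarrow> ('n site \<Rightarrow> 'e \<times> 'd)" where
  "join_cfg \<Lambda> s \<sigma>b \<eta> = (\<lambda>x. (if x \<in> \<Lambda> then s x else \<sigma>b x, \<eta> x))"

definition hamiltonian :: "('n::finite site set \<Rightarrow> ('n site \<Rightarrow> 'e \<times> 'd) \<Rightarrow> real) \<Rightarrow> 'n site set
    \<Rightarrow> ('n site \<Rightarrow> 'e \<times> 'd) \<Rightarrow> real" where
  "hamiltonian \<Phi> \<Lambda> \<xi> = infsum (\<lambda>A. \<Phi> A \<xi>) {A. finite A \<and> A \<inter> \<Lambda> \<noteq> {}}"

definition partition_fn :: "('n::finite site set \<Rightarrow> ('n site \<Rightarrow> 'e::finite \<times> 'd) \<Rightarrow> real) \<Rightarrow> 'n site set
    \<Rightarrow> ('n site \<Rightarrow> 'e) \<Rightarrow> ('n site \<Rightarrow> 'd) \<Rightarrow> real" where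
  "partition_fn \<Phi> \<Lambda> \<sigma>b \<eta> =
     (\<Sum>s \<in> PiE \<Lambda> (\<lambda>_. UNIV). exp (- hamiltonian \<Phi> \<Lambda> (join_cfg \<Lambda> s \<sigma>b \<eta>)))"

definition gibbs_expect :: "('n::finite site set \<Rightarrow> ('n site \<Rightarrow> 'e::finite \<times> 'd) \<Rightarrow> real) \<Rightarrow> 'n site set
    \<Rightarrow> ('n site \<Rightarrow> 'e) \<Rightarrow> ('n site \<Rightarrow> 'd) \<Rightarrow> (('n site \<Rightarrow> 'e \<times> 'd) \<Rightarrow> real) \<Rightarrow> real" where
  "gibbs_expect \<Phi> \<Lambda> \<sigma>b \<eta> g =
     (\<Sum>s \<in> PiE \<Lambda> (\<lambda>_. UNIV). exp (- hamiltonian \<Phi> \<Lambda> (join_cfg \<Lambda> s \<sigma>b \<eta>))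
          * g (join_cfg \<Lambda> s \<sigma>b \<eta>)) / partition_fn \<Phi> \<Lambda> \<sigma>b \<eta>"

definition joint_fv_integral :: "('n::finite site set \<Rightarrow> ('n site \<Rightarrow> 'e::finite \<times> 'd) \<Rightarrow> real) \<Rightarrow>
    ('n site \<Rightarrow> 'd) measure \<Rightarrow> 'n site set \<Rightarrow> ('n site \<Rightarrow> 'e)
    \<Rightarrow> (('n site \<Rightarrow> 'e \<times> 'd) \<Rightarrow> real) \<Rightarrow> real" where
  "joint_fv_integral \<Phi> P \<Lambda> \<sigma>b f = (\<integral>\<eta>. gibbs_expect \<Phi> \<Lambda> \<sigma>b \<eta> f \<partial>P)"

definition transl_inv_measure :: "('n::finite site \<Rightarrow> 'a) measure \<Rightarrow> bool" where
  "transl_inv_measure Q \<longleftrightarrow> sets Q = sets cfg_space \<and>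
     (\<forall>x. distr Q cfg_space (shift x) = Q)"

definition is_joint_measure :: "('n::finite site set \<Rightarrow> ('n site \<Rightarrow> 'e::finite \<times> 'd::finite) \<Rightarrow> real) \<Rightarrow>
    ('n site \<Rightarrow> 'd) measure \<Rightarrow> ('n site \<Rightarrow> 'e) \<Rightarrow> ('n site \<Rightarrow> 'e \<times> 'd) measure \<Rightarrow> bool" where
  "is_joint_measure \<Phi> P \<sigma>b K \<longleftrightarrow>
     prob_space K \<and> sets K = sets cfg_space \<and>
     (\<exists>\<Lambda>s :: nat \<Rightarrow> 'n site set. (\<forall>N. finite (\<Lambda>s N)) \<and> incseq \<Lambda>s \<and> (\<Union>N. \<Lambda>s N) = UNIV \<and>
        (\<forall>f. continuous_map cfg_top euclideanreal f \<longrightarrow>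
             (\<lambda>N. joint_fv_integral \<Phi> P (\<Lambda>s N) \<sigma>b f) \<longlonglongrightarrow> (\<integral>\<xi>. f \<xi> \<partial>K)))"

definition coord_sigma :: "'n::finite site set \<Rightarrow> ('n site \<Rightarrow> 'a) set set" where
  "coord_sigma S = sigma_sets UNIV {{\<eta>. \<eta> x = a} | x a. x \<in> S}"

definition asymptotically_decoupled :: "('n::finite site \<Rightarrow> 'd) measure \<Rightarrow> bool" where
  "asymptotically_decoupled P \<longleftrightarrow> transl_inv_measure P \<and>
     (\<exists>(g::nat \<Rightarrow> nat) (c::nat \<Rightarrow> real).
        (\<lambda>n. c n / real (card (box n :: 'n site set))) \<longlonglongrightarrow> 0 \<and>
        (\<lambda>n. real (g n) / real n) \<longlonglongrightarrow> 0 \<and>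
        (\<forall>n A B. A \<in> coord_sigma (box n) \<longrightarrow> B \<in> coord_sigma (- box (n + g n)) \<longrightarrow>
           measure P A * measure P B \<noteq> 0 \<longrightarrow>
             exp (- c n) \<le> measure P (A \<inter> B) / (measure P A * measure P B) \<and>
             measure P (A \<inter> B) / (measure P A * measure P B) \<le> exp (c n)))"

definition cyl_prob :: "('n::finite site \<Rightarrow> 'a) measure \<Rightarrow> 'n site set \<Rightarrow> ('n site \<Rightarrow> 'a) \<Rightarrow> real" where
  "cyl_prob Q \<Lambda> \<zeta> = measure Q {\<xi> \<in> space Q. \<forall>x\<in>\<Lambda>. \<xi> x = \<zeta> x}"

definition rel_term :: "real \<Rightarrow> real \<Rightarrow> ereal" where
  "rel_term q q' = (if q = 0 then 0 else if q' = 0 then \<infinity> else ereal (q * ln (q / q')))"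

definition rel_entropy_box :: "('n::finite site \<Rightarrow> 'a::finite) measure \<Rightarrow> ('n site \<Rightarrow> 'a) measure
    \<Rightarrow> nat \<Rightarrow> ereal" where
  "rel_entropy_box Q Q' n = ereal (1 / real (card (box n :: 'n site set))) *
     (\<Sum>\<zeta> \<in> PiE (box n) (\<lambda>_. UNIV). rel_term (cyl_prob Q (box n) \<zeta>) (cyl_prob Q' (box n) \<zeta>))"

definition rel_entropy_density :: "('n::finite site \<Rightarrow> 'a::finite) measure \<Rightarrow> ('n site \<Rightarrow> 'a) measure
    \<Rightarrow> ereal" where
  "rel_entropy_density Q Q' = lim (rel_entropy_box Q Q')"

definition ks_entropy :: "('n::finite site \<Rightarrow> 'a::finite) measure \<Rightarrow> real" where
  "ks_entropy Q = lim (\<lambda>n. - (\<Sum>\<zeta> \<in> PiE (box n) (\<lambda>_. UNIV).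
       cyl_prob Q (box n) \<zeta> * ln (cyl_prob Q (box n) \<zeta>)) / real (card (box n :: 'n site set)))"

definition disorder_marginal :: "('n::finite site \<Rightarrow> 'e \<times> 'd) measure \<Rightarrow> ('n site \<Rightarrow> 'd) measure" where
  "disorder_marginal K = distr K cfg_space (\<lambda>\<xi>. snd \<circ> \<xi>)"

end

theory Submission
  imports Defs
begin

text \<open>Compare the Gibbs weight on a finite set \<open>T\<close> with the weight that keeps only the interaction terms
  inside \<open>T\<close>: up to a factor whose logarithm is bounded by the interactions across the boundary of
  \<open>T\<close>, every joint measure gives the cylinder of \<open>(\<sigma>\<^sub>T, \<eta>\<^sub>T)\<close> the probability
  \<open>P(\<eta>\<^sub>T) exp (- U\<^sub>T) / Z\<^sub>T[\<eta>]\<close>. Taking logarithms and integrating against \<open>K\<close> splits the relative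
  entropy in a box into the five terms of the formula, with an error of the order of the boundary.
  The entropy densities exist by superadditivity along boxes; for the one relative to \<open>P\<close>, decoupling
  costs a small corridor around each box. The pressure converges almost everywhere because
  \<open>ln Z\<close> is additive over tilings up to boundary terms, which reduces the claim to
  Birkhoff's theorem for the \<open>\<int>\<^sup>d\<close>-action of the shifts by multiples of the tile size.\<close>

subsection \<open>Pointwise ergodic theorem over boxes\<close>

text \<open>Superadditivity is available relative to \<open>P\<close>, but nothing is assumed about
  decoupling of \<open>K\<sigma>\<close>. The relative entropy with respect to
  \<open>K\<sigma>\<close> therefore inherits its convergence: box by box it differs from the
  relative entropy of the disorder marginal against \<open>P\<close> by a real sequence with a
  finite limit per site, so that at most one term of the formula can be infinite. Keeping only the
  interactions inside \<open>T\<close> removes both the boundary condition and the approximating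
  volume. Finite range leaves an error that depends on \<open>T\<close> alone, hence survives the
  weak limit that defines \<open>K\<sigma>\<close>, and is of smaller order than the volume when
  \<open>T\<close> is a box. For the pressure the additivity error is two-sided. For every tile size
  the sequence is thus confined to a narrow band around Birkhoff averages of one bounded local
  function, and letting the tile size grow turns this into the Cauchy property.\<close>

definition measure_preserving_map :: "'a measure \<Rightarrow> ('a \<Rightarrow> 'a) \<Rightarrow> bool" where
  "measure_preserving_map M T \<longleftrightarrow> T \<in> measurable M M \<and> distr M M T = M"

lemma mp_measurable: "measure_preserving_map M T \<Longrightarrow> T \<in> measurable M M"
  by (simp add: measure_preserving_map_def)

lemma mp_integral:
  fixes f :: "'a \<Rightarrow> real"
  assumes "measure_preserving_map M T" "f \<in> borel_measurable M"
  shows "(\<integral>x. f (T x) \<partial>M) = (\<integral>x. f x \<partial>M)"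
proof -
  have "(\<integral>x. f x \<partial>distr M M T) = (\<integral>x. f (T x) \<partial>M)"
    using assms by (intro integral_distr) (auto simp: measure_preserving_map_def)
  thus ?thesis using assms by (simp add: measure_preserving_map_def)
qed

lemma mp_id: "measure_preserving_map M (\<lambda>x. x)"
  by (simp add: measure_preserving_map_def distr_id2)

lemma mp_compose:
  assumes "measure_preserving_map M S" "measure_preserving_map M T"
  shows "measure_preserving_map M (S \<circ> T)"
  using assms distr_distr[of S M M T M] by (auto simp: measure_preserving_map_def)

lemma mp_funpow:
  assumes "measure_preserving_map M T"
  shows "measure_preserving_map M (T ^^ k)"
proof (induction k)
  case 0
  show ?case using mp_id[of M] by (simp add: id_def)
next
  case (Suc k)
  show ?case using mp_compose[OF assms Suc] by (simp add: comp_def)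
qed

text \<open>The index \<open>n\<close> stands for the \<open>n + 1\<close> times from 0 to
  \<open>n\<close>, so the denominator never vanishes and bounds on \<open>f\<close> carry over for
  every \<open>n\<close>.\<close>

definition birkhoff_avg :: "('a \<Rightarrow> 'a) \<Rightarrow> ('a \<Rightarrow> real) \<Rightarrow> nat \<Rightarrow> 'a \<Rightarrow> real" where
  "birkhoff_avg T f n x = (\<Sum>k\<le>n. f ((T ^^ k) x)) / real (Suc n)"

lemma birkhoff_avg_bounds:
  assumes "\<And>x. a \<le> f x" "\<And>x. f x \<le> b"
  shows "a \<le> birkhoff_avg T f n x" "birkhoff_avg T f n x \<le> b"
proof -
  have "(\<Sum>k\<le>n. a) \<le> (\<Sum>k\<le>n. f ((T ^^ k) x))" "(\<Sum>k\<le>n. f ((T ^^ k) x)) \<le> (\<Sum>k\<le>n. b)"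
    using assms by (intro sum_mono; simp)+
  thus "a \<le> birkhoff_avg T f n x" "birkhoff_avg T f n x \<le> b"
    by (simp_all add: birkhoff_avg_def field_simps)
qed

lemma birkhoff_avg_measurable:
  assumes T: "measure_preserving_map M T" and f[measurable]: "f \<in> borel_measurable M"
  shows "birkhoff_avg T f n \<in> borel_measurable M"
proof -
  have [measurable]: "T ^^ k \<in> measurable M M" for k
    using mp_measurable[OF mp_funpow[OF T]] .
  show ?thesis unfolding birkhoff_avg_def[abs_def] by measurable
qed

text \<open>The two sums differ only in their first and last term. This makes the limsup of the
  averages invariant under \<open>T\<close>.\<close>

lemma birkhoff_avg_shift_diff:
  assumes b: "\<And>x. \<bar>f x\<bar> \<le> b"
  shows "(\<lambda>n. birkhoff_avg T f n (T x) - birkhoff_avg T f n x) \<longlonglongrightarrow> 0"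
proof (rule tendsto_rabs_zero_cancel, rule tendsto_sandwich[OF _ _ tendsto_const])
  show "\<forall>\<^sub>F n in sequentially. \<bar>birkhoff_avg T f n (T x) - birkhoff_avg T f n x\<bar> \<le> 2 * b / real (Suc n)"
  proof (intro always_eventually allI)
    fix n
    have "(\<Sum>k\<le>n. f ((T ^^ k) (T x))) - (\<Sum>k\<le>n. f ((T ^^ k) x)) = f ((T ^^ Suc n) x) - f x"
      by (induction n) (auto simp: funpow_swap1)
    hence "birkhoff_avg T f n (T x) - birkhoff_avg T f n x = (f ((T ^^ Suc n) x) - f x) / real (Suc n)"
      by (simp add: birkhoff_avg_def diff_divide_distrib[symmetric])
    moreover have "\<bar>f ((T ^^ Suc n) x) - f x\<bar> \<le> 2 * b"
      using b[of x] b[of "(T ^^ Suc n) x"] by linarith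
    ultimately show "\<bar>birkhoff_avg T f n (T x) - birkhoff_avg T f n x\<bar> \<le> 2 * b / real (Suc n)"
      by (simp add: abs_divide divide_right_mono)
  qed
  show "(\<lambda>n. 2 * b / real (Suc n)) \<longlonglongrightarrow> 0"
    using tendsto_mult_right_zero[OF LIMSEQ_inverse_real_of_nat, of "2*b"] by (simp add: field_simps)
qed auto

text \<open>Computed in \<open>ereal\<close>, where a limsup always exists and measurability is at
  hand, then cast back; this is faithful for bounded sequences.\<close>

definition real_limsup :: "(nat \<Rightarrow> real) \<Rightarrow> real" where
  "real_limsup u = real_of_ereal (limsup (\<lambda>n. ereal (u n)))"

lemma real_limsup_bounded:
  assumes "\<And>n. a \<le> u n" "\<And>n. u n \<le> b"
  shows "ereal (real_limsup u) = limsup (\<lambda>n. ereal (u n))" "a \<le> real_limsup u" "real_limsup u \<le> b"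
proof -
  have 1: "limsup (\<lambda>n. ereal (u n)) \<le> ereal b"
    by (intro Limsup_bounded) (auto simp: assms)
  have 2: "ereal a \<le> limsup (\<lambda>n. ereal (u n))"
    by (intro le_Limsup) (auto simp: assms)
  have "\<bar>limsup (\<lambda>n. ereal (u n))\<bar> \<noteq> \<infinity>" using 1 2 by auto
  thus 3: "ereal (real_limsup u) = limsup (\<lambda>n. ereal (u n))"
    by (simp add: real_limsup_def ereal_real)
  show "a \<le> real_limsup u" "real_limsup u \<le> b" using 1 2 unfolding 3[symmetric] by auto
qed

lemma real_limsup_frequently:
  assumes "\<And>n. a \<le> u n" "\<And>n. u n \<le> b" "e > 0"
  shows "\<exists>n. real_limsup u - e \<le> u n"
proof (rule ccontr)
  assume "\<not> ?thesis"
  hence "\<forall>n. u n \<le> real_limsup u - e" by (auto simp: not_le intro: less_imp_le)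
  hence "limsup (\<lambda>n. ereal (u n)) \<le> ereal (real_limsup u - e)"
    by (intro Limsup_bounded) auto
  hence "ereal (real_limsup u) \<le> ereal (real_limsup u - e)"
    using real_limsup_bounded(1)[of a u b] assms by auto
  thus False using assms by simp
qed

lemma real_limsup_cong_diff:
  assumes "\<And>n. a \<le> u n" "\<And>n. u n \<le> b" "(\<lambda>n. v n - u n) \<longlonglongrightarrow> 0"
  shows "real_limsup v = real_limsup u"
proof -
  have "(\<lambda>n. ereal (v n - u n)) \<longlonglongrightarrow> ereal 0" using assms(3) by simp
  hence "limsup (\<lambda>n. ereal (v n - u n) + ereal (u n)) = ereal 0 + limsup (\<lambda>n. ereal (u n))"
    by (rule ereal_limsup_lim_add) auto
  thus ?thesis by (simp add: real_limsup_def zero_ereal_def[symmetric])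
qed

text \<open>Keane and Petersen: from each point, the first time at which the average comes within
  \<open>e\<close> of its limsup cuts the orbit into blocks; points where this time is too long are repaired
  by raising \<open>f\<close> to its upper bound there.\<close>

lemma (in prob_space) integral_limsup_birkhoff_le:
  assumes T: "measure_preserving_map M T" and f[measurable]: "f \<in> borel_measurable M"
    and f0: "\<And>x. 0 \<le> f x" and fb: "\<And>x. f x \<le> b"
  shows "(\<integral>x. real_limsup (\<lambda>n. birkhoff_avg T f n x) \<partial>M) \<le> (\<integral>x. f x \<partial>M)"
proof -
  define F where "F x = real_limsup (\<lambda>n. birkhoff_avg T f n x)" for x
  note bounds = birkhoff_avg_bounds[of 0 f b T, OF f0 fb]
  have b0: "0 \<le> b" using f0 fb order_trans by blast
  have [measurable]: "birkhoff_avg T f n \<in> borel_measurable M" for n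
    by (rule birkhoff_avg_measurable[OF T f])
  have [measurable]: "T ^^ k \<in> measurable M M" for k
    using mp_measurable[OF mp_funpow[OF T]] .
  have Fm[measurable]: "F \<in> borel_measurable M"
    unfolding F_def[abs_def] real_limsup_def by measurable
  have F0: "0 \<le> F x" and Fb: "F x \<le> b" for x
    unfolding F_def using real_limsup_bounded[of 0 "\<lambda>n. birkhoff_avg T f n x" b] bounds by auto
  have Finv1: "F (T x) = F x" for x unfolding F_def
    by (rule real_limsup_cong_diff[of 0 _ b]) (use bounds birkhoff_avg_shift_diff[of f b] f0 fb in auto)
  have Finv: "F ((T ^^ k) x) = F x" for k x by (induction k) (auto simp: Finv1)
  have main: "(\<integral>x. F x \<partial>M) \<le> (\<integral>x. f x \<partial>M) + (1 + b) * e" if e: "e > 0" for e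
  proof -
    \<comment> \<open>The cut at 0 keeps the level nonnegative, so that a last stretch of the orbit
      shorter than \<open>N\<close> does no harm; averages of the nonnegative \<open>f\<close> still
      reach the level.\<close>
    define c where "c x = max 0 (F x - e)" for x
    have c0: "0 \<le> c x" for x by (simp add: c_def)
    have cinv: "c ((T ^^ k) x) = c x" for k x by (simp add: c_def Finv)
    have ex: "\<exists>n. c x \<le> birkhoff_avg T f n x" for x
      using real_limsup_frequently[of 0 "\<lambda>n. birkhoff_avg T f n x" b e] bounds[where x=x] e
      unfolding c_def F_def by (auto simp: max_def)
    define B where "B N = {x \<in> space M. \<forall>n\<le>N. birkhoff_avg T f n x < c x}" for N
    have [measurable]: "B N \<in> sets M" for N unfolding B_def c_def by measurable
    have "(\<lambda>N. prob (B N)) \<longlonglongrightarrow> prob (\<Inter>N. B N)"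
    proof (rule finite_Lim_measure_decseq)
      show "range B \<subseteq> sets M" by auto
      show "decseq B" unfolding decseq_def by (auto simp: B_def)
    qed
    moreover have "(\<Inter>N. B N) = {}"
    proof -
      have "x \<notin> (\<Inter>N. B N)" for x
      proof -
        obtain n where "c x \<le> birkhoff_avg T f n x" using ex by blast
        hence "x \<notin> B n" by (auto simp: B_def)
        thus ?thesis by blast
      qed
      thus ?thesis by blast
    qed
    ultimately have "(\<lambda>N. prob (B N)) \<longlonglongrightarrow> 0" by simp
    hence "\<forall>\<^sub>F N in sequentially. prob (B N) < e" using e by (rule order_tendstoD)
    then obtain N0 where N0: "prob (B N0) < e" by (auto simp: eventually_sequentially)
    \<comment> \<open>The average with index \<open>n\<close> runs over \<open>n + 1\<close> points,
      so blocks have length up to \<open>N0 + 1\<close>.\<close>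
    define N where "N = Suc N0"
    define g where "g x = (if x \<in> B N0 then b else f x)" for x
    have gm[measurable]: "g \<in> borel_measurable M" unfolding g_def by measurable
    have g0: "0 \<le> g x" and gb: "g x \<le> b" and gf: "f x \<le> g x" for x
      using f0 fb b0 by (auto simp: g_def)
    have step: "\<exists>n\<ge>1. n \<le> N \<and> real n * c x \<le> (\<Sum>k<n. g ((T ^^ k) x))" if x: "x \<in> space M" for x
    proof (cases "x \<in> B N0")
      case True
      thus ?thesis using Fb[of x] e b0 by (intro exI[of _ 1]) (auto simp: g_def c_def N_def)
    next
      case False
      then obtain n where n: "n \<le> N0" "c x \<le> birkhoff_avg T f n x" using x by (auto simp: B_def not_less)
      hence "real (Suc n) * c x \<le> (\<Sum>k<Suc n. f ((T ^^ k) x))"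
        by (simp add: birkhoff_avg_def lessThan_Suc_atMost field_simps)
      also have "\<dots> \<le> (\<Sum>k<Suc n. g ((T ^^ k) x))" by (intro sum_mono gf)
      finally show ?thesis using n by (intro exI[of _ "Suc n"]) (auto simp: N_def)
    qed
    \<comment> \<open>Blocks are laid end to end. All of them aim at the same level because
      \<open>c\<close> is constant along the orbit, and the unfinished last block costs at most
      \<open>N * c x\<close>.\<close>
    have cover: "(real L - real N) * c x \<le> (\<Sum>k<L. g ((T ^^ k) x))" if "x \<in> space M" for L x
      using that
    proof (induction L arbitrary: x rule: less_induct)
      case (less L)
      show ?case
      proof (cases "L < N")
        case True
        hence "(real L - real N) * c x \<le> 0" using c0[of x] by (intro mult_nonpos_nonneg) auto
        also have "0 \<le> (\<Sum>k<L. g ((T ^^ k) x))" by (intro sum_nonneg g0)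
        finally show ?thesis .
      next
        case False
        obtain n where n: "n \<ge> 1" "n \<le> N" "real n * c x \<le> (\<Sum>k<n. g ((T ^^ k) x))"
          using step[OF less.prems] by auto
        have sp: "(T ^^ n) x \<in> space M"
          by (rule measurable_space[OF mp_measurable[OF mp_funpow[OF T]] less.prems])
        have "(real (L - n) - real N) * c ((T ^^ n) x) \<le> (\<Sum>k<L-n. g ((T ^^ k) ((T ^^ n) x)))"
          using n False by (intro less.IH sp) auto
        also have "\<dots> = (\<Sum>k<L-n. g ((T ^^ (k + n)) x))" by (simp add: funpow_add)
        also have "\<dots> = (\<Sum>k\<in>{n..<L}. g ((T ^^ k) x))"
          using n False sum.shift_bounds_nat_ivl[of "\<lambda>k. g ((T ^^ k) x)" 0 n "L-n"]
          by (simp add: atLeast0LessThan)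
        finally have "(real (L - n) - real N) * c x + real n * c x \<le>
           (\<Sum>k<n. g ((T ^^ k) x)) + (\<Sum>k\<in>{n..<L}. g ((T ^^ k) x))" using n cinv by simp
        also have "\<dots> = (\<Sum>k<L. g ((T ^^ k) x))"
          using n False sum.atLeastLessThan_concat[of 0 n L "\<lambda>k. g ((T ^^ k) x)"]
          by (simp add: atLeast0LessThan)
        finally show ?thesis using n False by (simp add: of_nat_diff algebra_simps)
      qed
    qed
    have intg: "integrable M g" using g0 gb by (intro integrable_const_bound[where B=b]) auto
    have intgT: "integrable M (\<lambda>x. g ((T ^^ k) x))" for k
      using g0 gb by (intro integrable_const_bound[where B=b]) auto
    have intf: "integrable M f" using f0 fb by (intro integrable_const_bound[where B=b]) auto
    have intF: "integrable M F" using F0 Fb by (intro integrable_const_bound[where B=b]) auto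
    have [measurable]: "c \<in> borel_measurable M" unfolding c_def[abs_def] by measurable
    have cb: "c x \<le> b" for x using Fb[of x] b0 e by (simp add: c_def)
    have intc: "integrable M c" using c0 cb
      by (intro integrable_const_bound[where B=b] AE_I2) auto
    have ineq: "(real L - real N) * (\<integral>x. c x \<partial>M) \<le> real L * (\<integral>x. g x \<partial>M)" for L
    proof -
      have "(\<integral>x. (real L - real N) * c x \<partial>M) \<le> (\<integral>x. (\<Sum>k<L. g ((T ^^ k) x)) \<partial>M)"
        using cover by (intro integral_mono) (auto intro!: intc intgT)
      also have "\<dots> = (\<Sum>k<L. (\<integral>x. g ((T ^^ k) x) \<partial>M))"
        by (intro Bochner_Integration.integral_sum intgT)
      also have "\<dots> = real L * (\<integral>x. g x \<partial>M)"
        by (simp add: mp_integral[OF mp_funpow[OF T] gm])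
      finally show ?thesis by simp
    qed
    let ?I = "\<integral>x. c x \<partial>M"
    have "?I \<le> (\<integral>x. g x \<partial>M)"
    proof (rule LIMSEQ_le_const2)
      have "(\<lambda>L. ?I - real N * ?I * inverse (real (Suc L))) \<longlonglongrightarrow>
          ?I - real N * ?I * 0"
        by (intro tendsto_intros LIMSEQ_inverse_real_of_nat)
      thus "(\<lambda>L. ?I - real N * ?I * inverse (real (Suc L))) \<longlonglongrightarrow> ?I" by simp
      have "?I - real N * ?I * inverse (real (Suc L)) \<le> (\<integral>x. g x \<partial>M)" for L
        using ineq[of "Suc L"] by (simp add: field_simps)
      thus "\<exists>N'. \<forall>n\<ge>N'. ?I - real N * ?I * inverse (real (Suc n)) \<le> (\<integral>x. g x \<partial>M)" by blast
    qed
    moreover have "(\<integral>x. F x \<partial>M) - e \<le> (\<integral>x. c x \<partial>M)"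
    proof -
      have "(\<integral>x. F x - e \<partial>M) \<le> (\<integral>x. c x \<partial>M)"
        by (intro integral_mono intc Bochner_Integration.integrable_diff intF) (auto simp: c_def)
      thus ?thesis using intF by (simp add: prob_space)
    qed
    moreover have "(\<integral>x. g x \<partial>M) \<le> (\<integral>x. f x \<partial>M) + b * e"
    proof -
      have intB: "integrable M (indicator (B N0) :: _ \<Rightarrow> real)"
        by (intro integrable_real_indicator) (auto simp: less_top[symmetric])
      have "(\<integral>x. g x \<partial>M) \<le> (\<integral>x. f x + b * indicator (B N0) x \<partial>M)"
        by (intro integral_mono intg Bochner_Integration.integrable_add intf integrable_mult_right intB)
           (use f0 b0 in \<open>auto simp: g_def indicator_def\<close>)
      also have "\<dots> = (\<integral>x. f x \<partial>M) + b * prob (B N0)"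
        by (subst Bochner_Integration.integral_add[OF intf integrable_mult_right[OF intB]]) simp
      also have "b * prob (B N0) \<le> b * e" using N0 b0 by (intro mult_left_mono) auto
      finally show ?thesis by simp
    qed
    ultimately show ?thesis by (simp add: algebra_simps)
  qed
  show ?thesis unfolding F_def[symmetric]
  proof (rule field_le_epsilon)
    fix e :: real assume "e > 0"
    thus "(\<integral>x. F x \<partial>M) \<le> (\<integral>x. f x \<partial>M) + e"
      using main[of "e / (1 + b)"] b0 by simp
  qed
qed

text \<open>The integral inequality for the nonnegative functions \<open>f + b\<close> and
  \<open>b - f\<close> places the integral of \<open>f\<close> above that of the upper limit and
  below that of the lower limit. Since \<open>lo \<le> hi\<close> pointwise, \<open>hi - lo\<close>
  has integral 0 and vanishes almost everywhere; \<open>hi\<close> serves as the limit.\<close>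

lemma (in prob_space) birkhoff_pointwise:
  assumes T: "measure_preserving_map M T" and f[measurable]: "f \<in> borel_measurable M"
    and b: "\<And>x. \<bar>f x\<bar> \<le> b"
  shows "\<exists>F \<in> borel_measurable M. (\<forall>x. \<bar>F x\<bar> \<le> b) \<and> (\<integral>x. F x \<partial>M) = (\<integral>x. f x \<partial>M) \<and>
     (AE x in M. (\<lambda>n. birkhoff_avg T f n x) \<longlonglongrightarrow> F x)"
proof -
  have b': "f x \<le> b" "- b \<le> f x" "0 \<le> b + f x" for x using b[of x] by auto
  define u where "u n x = birkhoff_avg T f n x" for n x
  define hi where "hi x = real_limsup (\<lambda>n. u n x)" for x
  define lo where "lo x = - real_limsup (\<lambda>n. - u n x)" for x
  have ub: "- b \<le> u n x" "u n x \<le> b" for n x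
    unfolding u_def using birkhoff_avg_bounds[of "-b" f b] b' by auto
  have [measurable]: "u n \<in> borel_measurable M" for n
    using birkhoff_avg_measurable[OF T f] by (simp add: u_def[abs_def])
  have [measurable]: "hi \<in> borel_measurable M" "lo \<in> borel_measurable M"
    unfolding hi_def[abs_def] lo_def[abs_def] real_limsup_def by measurable
  have hib: "ereal (hi x) = limsup (\<lambda>n. ereal (u n x))" "-b \<le> hi x" "hi x \<le> b" for x
    unfolding hi_def by (intro real_limsup_bounded[of "-b" "\<lambda>n. u n x" b] ub)+
  have lob: "ereal (- lo x) = limsup (\<lambda>n. ereal (- u n x))" "-b \<le> - lo x" "- lo x \<le> b" for x
    unfolding lo_def using real_limsup_bounded[of "-b" "\<lambda>n. -u n x" b] ub
    by (auto simp: minus_le_iff)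
  have lo_lim: "ereal (lo x) = liminf (\<lambda>n. ereal (u n x))" for x
    using lob(1)[of x] ereal_Limsup_uminus[of sequentially "\<lambda>n. ereal (u n x)"]
    by (simp add: uminus_ereal.simps(1)[symmetric] del: uminus_ereal.simps(1))
  have shift: "real_limsup (\<lambda>n. w n + b) = real_limsup w + b" if "\<And>n. -b \<le> w n" "\<And>n. w n \<le> b" for w :: "nat \<Rightarrow> real"
  proof -
    have "limsup (\<lambda>n. ereal b + ereal (w n)) = ereal b + limsup (\<lambda>n. ereal (w n))"
      by (rule ereal_limsup_lim_add) auto
    thus ?thesis using real_limsup_bounded(1)[of "-b" w b] that
      by (simp add: real_limsup_def add.commute) (metis add.commute plus_ereal.simps(1) real_of_ereal.simps(1))
  qed
  have intf: "integrable M f" using b by (intro integrable_const_bound[where B=b]) auto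
  have inth: "integrable M hi" "integrable M lo"
    using hib(2,3) lob(2,3) by (auto intro!: integrable_const_bound[where B=b] AE_I2 simp: abs_le_iff minus_le_iff)
  have "(\<integral>x. real_limsup (\<lambda>n. birkhoff_avg T (\<lambda>x. f x + b) n x) \<partial>M) \<le> (\<integral>x. f x + b \<partial>M)"
    using b' by (intro integral_limsup_birkhoff_le[OF T, where b="2*b"]) (auto simp: algebra_simps minus_le_iff)
  moreover have "birkhoff_avg T (\<lambda>x. f x + b) n x = u n x + b" for n x
    by (simp add: u_def birkhoff_avg_def sum.distrib field_simps)
  ultimately have i1: "(\<integral>x. hi x \<partial>M) \<le> (\<integral>x. f x \<partial>M)"
    using shift[of "\<lambda>n. u n _"] ub inth intf by (simp add: hi_def[symmetric] prob_space)
  have "(\<integral>x. real_limsup (\<lambda>n. birkhoff_avg T (\<lambda>x. - f x + b) n x) \<partial>M) \<le> (\<integral>x. - f x + b \<partial>M)"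
    using b' by (intro integral_limsup_birkhoff_le[OF T, where b="2*b"]) (auto simp: algebra_simps minus_le_iff)
  moreover have "birkhoff_avg T (\<lambda>x. - f x + b) n x = - u n x + b" for n x
    by (simp add: u_def birkhoff_avg_def sum.distrib field_simps sum_negf sum_subtractf)
  moreover have "real_limsup (\<lambda>n. - u n x + b) = - lo x + b" for x
    using shift[of "\<lambda>n. - u n x"] ub[of _ x] by (simp add: lo_def minus_le_iff)
  ultimately have i2: "(\<integral>x. f x \<partial>M) \<le> (\<integral>x. lo x \<partial>M)"
    using inth intf by (simp add: prob_space)
  have le: "lo x \<le> hi x" for x
    using Liminf_le_Limsup[of sequentially "\<lambda>n. ereal (u n x)"] by (simp add: hib(1)[symmetric] lo_lim[symmetric])
  have z: "(\<integral>x. hi x - lo x \<partial>M) = 0"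
    using i1 i2 inth integral_mono[OF inth(2,1)] le by simp
  have "AE x in M. hi x - lo x = 0"
    using integral_nonneg_eq_0_iff_AE[of M "\<lambda>x. hi x - lo x"] z inth le by simp
  hence conv: "AE x in M. (\<lambda>n. u n x) \<longlonglongrightarrow> hi x"
  proof eventually_elim
    case (elim x)
    hence "(\<lambda>n. ereal (u n x)) \<longlonglongrightarrow> ereal (hi x)"
      unfolding tendsto_iff_Liminf_eq_Limsup[OF sequentially_bot]
      using hib(1)[of x] lo_lim[of x] by simp
    thus ?case by simp
  qed
  have "(\<integral>x. hi x \<partial>M) = (\<integral>x. f x \<partial>M)" using i1 i2 z inth by simp
  moreover have "\<bar>hi x\<bar> \<le> b" for x using hib(2,3)[of x] by (auto simp: abs_le_iff minus_le_iff)
  ultimately show ?thesis using conv unfolding u_def by (intro bexI[of _ hi]) auto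
qed

section \<open>Two-sided averages and their iteration over several directions\<close>

definition int_action :: "'a measure \<Rightarrow> (int \<Rightarrow> 'a \<Rightarrow> 'a) \<Rightarrow> bool" where
  "int_action M \<theta> \<longleftrightarrow> (\<forall>j. measure_preserving_map M (\<theta> j)) \<and> (\<forall>x. \<theta> 0 x = x) \<and>
     (\<forall>i j x. \<theta> (i + j) x = \<theta> i (\<theta> j x))"

lemma int_action_funpow:
  assumes "int_action M \<theta>"
  shows "((\<theta> 1) ^^ k) x = \<theta> (int k) x" "((\<theta> (-1)) ^^ k) x = \<theta> (- int k) x"
proof -
  have add: "\<theta> (i + j) x = \<theta> i (\<theta> j x)" for i j x using assms by (simp add: int_action_def)
  have z: "\<theta> 0 x = x" for x using assms by (simp add: int_action_def)
  show "((\<theta> 1) ^^ k) x = \<theta> (int k) x"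
    by (induction k) (simp_all add: z add[symmetric])
  show "((\<theta> (-1)) ^^ k) x = \<theta> (- int k) x"
    by (induction k) (simp_all add: z add[symmetric])
qed

text \<open>The window is centred at 0 because it is to become one coordinate of
  \<open>box n\<close>.\<close>

definition sym_avg :: "(int \<Rightarrow> 'a \<Rightarrow> 'a) \<Rightarrow> ('a \<Rightarrow> real) \<Rightarrow> nat \<Rightarrow> 'a \<Rightarrow> real" where
  "sym_avg \<theta> f n x = (\<Sum>j\<in>{- int n..int n}. f (\<theta> j x)) / (2 * real n + 1)"

text \<open>The forward and the backward average share time 0, hence the correction by
  \<open>f x\<close>; each has \<open>n + 1\<close> terms in place of \<open>2 * n + 1\<close>,
  hence the factor.\<close>

lemma sym_avg_birkhoff_avg:
  assumes "int_action M \<theta>"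
  shows "sym_avg \<theta> f n x = (real n + 1) / (2 * real n + 1) *
    (birkhoff_avg (\<theta> 1) f n x + birkhoff_avg (\<theta> (-1)) f n x) - f x / (2 * real n + 1)"
proof -
  have z: "\<theta> 0 x = x" for x using assms by (simp add: int_action_def)
  have s: "(\<Sum>j\<in>{- int n..int n}. f (\<theta> j x)) =
     (\<Sum>k\<le>n. f (\<theta> (int k) x)) + (\<Sum>k\<le>n. f (\<theta> (- int k) x)) - f x"
  proof (induction n)
    case (Suc n)
    have "{- int (Suc n)..int (Suc n)} = insert (int (Suc n)) (insert (- int (Suc n)) {- int n..int n})"
      by auto
    thus ?case using Suc by simp
  qed (simp add: z)
  show ?thesis unfolding sym_avg_def s birkhoff_avg_def int_action_funpow[OF assms]
    by (simp add: divide_simps) (simp add: algebra_simps)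
qed

lemma sym_avg_measurable:
  assumes "int_action M \<theta>" "f \<in> borel_measurable M"
  shows "sym_avg \<theta> f n \<in> borel_measurable M"
proof -
  have [measurable]: "\<theta> j \<in> measurable M M" for j
    using assms(1) by (auto simp: int_action_def intro: mp_measurable)
  show ?thesis unfolding sym_avg_def[abs_def] using assms(2) by measurable
qed

lemma sym_avg_mono: "(\<And>x. f x \<le> g x) \<Longrightarrow> sym_avg \<theta> f n x \<le> sym_avg \<theta> g n x"
  unfolding sym_avg_def by (intro divide_right_mono sum_mono) auto

lemma sym_avg_const: "sym_avg \<theta> (\<lambda>_. c) n x = c"
proof -
  have "real (nat (1 + 2 * int n)) = 1 + 2 * real n" by simp
  thus ?thesis by (simp add: sym_avg_def add.commute)
qed

lemma sym_avg_abs_le: "\<bar>sym_avg \<theta> f n x\<bar> \<le> sym_avg \<theta> (\<lambda>x. \<bar>f x\<bar>) n x"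
  unfolding sym_avg_def by (simp add: abs_divide divide_right_mono)

lemma sym_avg_diff: "sym_avg \<theta> f n x - sym_avg \<theta> g n x = sym_avg \<theta> (\<lambda>x. f x - g x) n x"
  unfolding sym_avg_def by (simp add: sum_subtractf diff_divide_distrib)

text \<open>The limit is the mean of the forward and backward limits. The clause on integrals is
  what the iteration over directions lives on: averages of a function with small integral have a
  limit with small integral.\<close>

lemma (in prob_space) sym_birkhoff_pointwise:
  assumes T: "int_action M \<theta>" and f[measurable]: "f \<in> borel_measurable M"
    and b: "\<And>x. \<bar>f x\<bar> \<le> b"
  shows "\<exists>F \<in> borel_measurable M. (\<forall>x. \<bar>F x\<bar> \<le> b) \<and> (\<integral>x. F x \<partial>M) = (\<integral>x. f x \<partial>M) \<and>
     (AE x in M. (\<lambda>n. sym_avg \<theta> f n x) \<longlonglongrightarrow> F x)"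
proof -
  have mp: "measure_preserving_map M (\<theta> j)" for j using T by (simp add: int_action_def)
  obtain F where F[measurable]: "F \<in> borel_measurable M" and Fb: "\<And>x. \<bar>F x\<bar> \<le> b"
    and Fi: "(\<integral>x. F x \<partial>M) = (\<integral>x. f x \<partial>M)"
    and Fc: "AE x in M. (\<lambda>n. birkhoff_avg (\<theta> 1) f n x) \<longlonglongrightarrow> F x"
    using birkhoff_pointwise[OF mp f b] by blast
  obtain G where G[measurable]: "G \<in> borel_measurable M" and Gb: "\<And>x. \<bar>G x\<bar> \<le> b"
    and Gi: "(\<integral>x. G x \<partial>M) = (\<integral>x. f x \<partial>M)"
    and Gc: "AE x in M. (\<lambda>n. birkhoff_avg (\<theta> (-1)) f n x) \<longlonglongrightarrow> G x"
    using birkhoff_pointwise[OF mp f b] by blast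
  have int: "integrable M F" "integrable M G"
    using Fb Gb by (auto intro!: integrable_const_bound[where B=b])
  have l1: "(\<lambda>n. (real n + 1) / (2 * real n + 1)) \<longlonglongrightarrow> 1 / 2"
  proof -
    \<comment> \<open>The rewriting \<open>(n + 1) / (2 * n + 1) = 1/2 + 1/4 / (n + 1/2)\<close>
      isolates the vanishing part.\<close>
    have "(\<lambda>n. 1/2 + 1/4 * inverse (real n + 1/2)) \<longlonglongrightarrow> 1/2 + 1/4 * 0"
      by (intro tendsto_intros tendsto_inverse_0_at_top filterlim_tendsto_add_at_top[OF tendsto_const filterlim_real_sequentially, of "1/2", unfolded add.commute[of "1/2"]])
    moreover have "1/2 + 1/4 * inverse (real n + 1/2) = (real n + 1) / (2 * real n + 1)" for n
      by (simp add: divide_simps) (simp add: algebra_simps)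
    ultimately show ?thesis by simp
  qed
  have l2: "(\<lambda>n. c / (2 * real n + 1)) \<longlonglongrightarrow> 0" for c :: real
  proof -
    have "(\<lambda>n. c/2 * inverse (real n + 1/2)) \<longlonglongrightarrow> c/2 * 0"
      by (intro tendsto_intros tendsto_inverse_0_at_top filterlim_tendsto_add_at_top[OF tendsto_const filterlim_real_sequentially, of "1/2", unfolded add.commute[of "1/2"]])
    moreover have "(\<lambda>n. c/2 * inverse (real n + 1/2)) = (\<lambda>n. c / (2 * real n + 1))"
      by (rule ext) (simp add: divide_simps)
    ultimately show ?thesis by (simp only: mult_zero_right)
  qed
  have "AE x in M. (\<lambda>n. sym_avg \<theta> f n x) \<longlonglongrightarrow> (F x + G x) / 2"
    using Fc Gc
  proof eventually_elim
    case (elim x)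
    have "(\<lambda>n. (real n + 1) / (2 * real n + 1) *
      (birkhoff_avg (\<theta> 1) f n x + birkhoff_avg (\<theta> (-1)) f n x) - f x / (2 * real n + 1)) \<longlonglongrightarrow>
      1/2 * (F x + G x) - 0"
      by (intro tendsto_intros elim l1 l2)
    thus ?case unfolding sym_avg_birkhoff_avg[OF T] by simp
  qed
  moreover have "\<bar>(F x + G x) / 2\<bar> \<le> b" for x using Fb[of x] Gb[of x] by (simp add: abs_le_iff)
  moreover have "(\<integral>x. (F x + G x) / 2 \<partial>M) = (\<integral>x. f x \<partial>M)" using int Fi Gi by simp
  ultimately show ?thesis by (intro bexI[of _ "\<lambda>x. (F x + G x) / 2"]) auto
qed

text \<open>All levels use the same window size \<open>n\<close>, so the nested average is one
  average over a cube and not an iterated limit.\<close>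

fun multi_avg :: "(int \<Rightarrow> 'a \<Rightarrow> 'a) list \<Rightarrow> ('a \<Rightarrow> real) \<Rightarrow> nat \<Rightarrow> 'a \<Rightarrow> real" where
  "multi_avg [] f n = f"
| "multi_avg (\<theta> # \<theta>s) f n = sym_avg \<theta> (multi_avg \<theta>s f n) n"

lemma multi_avg_measurable:
  assumes "\<forall>\<theta>\<in>set \<theta>s. int_action M \<theta>" "f \<in> borel_measurable M"
  shows "multi_avg \<theta>s f n \<in> borel_measurable M"
  using assms by (induction \<theta>s) (auto intro: sym_avg_measurable)

lemma multi_avg_bound:
  assumes "\<And>x. \<bar>f x\<bar> \<le> b"
  shows "\<bar>multi_avg \<theta>s f n x\<bar> \<le> b"
proof (induction \<theta>s arbitrary: x)
  case (Cons \<theta> \<theta>s)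
  have "\<bar>multi_avg (\<theta> # \<theta>s) f n x\<bar> \<le> sym_avg \<theta> (\<lambda>x. \<bar>multi_avg \<theta>s f n x\<bar>) n x"
    using sym_avg_abs_le[of \<theta> "multi_avg \<theta>s f n"] by simp
  also have "\<dots> \<le> sym_avg \<theta> (\<lambda>_. b) n x" using Cons.IH by (intro sym_avg_mono)
  finally show ?case by (simp add: sym_avg_const)
qed (use assms in auto)

text \<open>The inner average depends on \<open>n\<close> too; its distance to its limit is dominated by the tail
  supremum \<open>g N\<close>, whose own averages converge to a limit of small integral.\<close>

lemma (in prob_space) multi_birkhoff_pointwise:
  assumes "\<forall>\<theta>\<in>set \<theta>s. int_action M \<theta>" and "f \<in> borel_measurable M"
    and "\<And>x. \<bar>f x\<bar> \<le> b"
  shows "\<exists>F \<in> borel_measurable M. (\<forall>x. \<bar>F x\<bar> \<le> b) \<and>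
     (AE x in M. (\<lambda>n. multi_avg \<theta>s f n x) \<longlonglongrightarrow> F x)"
  using assms
proof (induction \<theta>s)
  case Nil
  thus ?case by (intro bexI[of _ f]) auto
next
  case (Cons \<theta> \<theta>s)
  hence \<theta>: "int_action M \<theta>" and \<theta>s: "\<forall>\<theta>\<in>set \<theta>s. int_action M \<theta>"
    and f[measurable]: "f \<in> borel_measurable M" by auto
  note fb = Cons.prems(3)
  define m where "m n x = multi_avg \<theta>s f n x" for n x
  have mb: "\<bar>m n x\<bar> \<le> b" for n x unfolding m_def by (rule multi_avg_bound[OF fb])
  have [measurable]: "m n \<in> borel_measurable M" for n
    unfolding m_def[abs_def] by (rule multi_avg_measurable[OF \<theta>s f])
  obtain F where F[measurable]: "F \<in> borel_measurable M" and Fb: "\<And>x. \<bar>F x\<bar> \<le> b"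
    and Fc: "AE x in M. (\<lambda>n. m n x) \<longlonglongrightarrow> F x"
    using Cons.IH[OF \<theta>s f fb] unfolding m_def by blast
  obtain F' where F'[measurable]: "F' \<in> borel_measurable M" and F'b: "\<And>x. \<bar>F' x\<bar> \<le> b"
    and F'c: "AE x in M. (\<lambda>n. sym_avg \<theta> F n x) \<longlonglongrightarrow> F' x"
    using sym_birkhoff_pointwise[OF \<theta> F Fb] by blast
  define g where "g N x = (SUP n\<in>{N..}. \<bar>m n x - F x\<bar>)" for N x
  have db: "\<bar>m n x - F x\<bar> \<le> 2 * b" for n x using mb[of n x] Fb[of x] by linarith
  have bdd: "bdd_above ((\<lambda>n. \<bar>m n x - F x\<bar>) ` {N..})" for N x
    using db by (intro bdd_aboveI2[where M="2*b"]) auto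
  have gle: "\<bar>m n x - F x\<bar> \<le> g N x" if "N \<le> n" for n N x
    unfolding g_def using that by (intro cSUP_upper bdd) auto
  have g0: "0 \<le> g N x" for N x using gle[of N N x] by linarith
  have gb: "g N x \<le> 2 * b" for N x unfolding g_def using db by (intro cSUP_least) auto
  have [measurable]: "g N \<in> borel_measurable M" for N
    unfolding g_def[abs_def] by (intro borel_measurable_cSUP bdd) auto
  have gabs: "\<bar>g N x\<bar> \<le> 2 * b" for N x using g0[of N x] gb[of N x] by simp
  have "AE x in M. (\<lambda>N. g N x) \<longlonglongrightarrow> 0" using Fc
  proof eventually_elim
    case (elim x)
    show ?case
    proof (rule LIMSEQ_I)
      fix r :: real assume "0 < r"
      then obtain N where N: "\<And>n. n \<ge> N \<Longrightarrow> \<bar>m n x - F x\<bar> < r / 2"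
        using LIMSEQ_D[OF elim, of "r/2"] by auto
      have "norm (g n x - 0) < r" if "n \<ge> N" for n
      proof -
        have "g n x \<le> r / 2" unfolding g_def using N that by (intro cSUP_least) (auto intro: less_imp_le)
        thus ?thesis using g0[of n x] \<open>0 < r\<close> by simp
      qed
      thus "\<exists>no. \<forall>n\<ge>no. norm (g n x - 0) < r" by blast
    qed
  qed
  hence "(\<lambda>N. \<integral>x. g N x \<partial>M) \<longlonglongrightarrow> (\<integral>x. 0 \<partial>M)"
    using gabs by (intro integral_dominated_convergence[where w="\<lambda>_. 2 * b"]) auto
  hence gi: "(\<lambda>N. \<integral>x. g N x \<partial>M) \<longlonglongrightarrow> 0" by simp
  have "\<exists>G. G \<in> borel_measurable M \<and> (\<forall>x. \<bar>G x\<bar> \<le> 2 * b) \<and> (\<integral>x. G x \<partial>M) = (\<integral>x. g N x \<partial>M) \<and>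
     (AE x in M. (\<lambda>n. sym_avg \<theta> (g N) n x) \<longlonglongrightarrow> G x)" for N
    using sym_birkhoff_pointwise[of \<theta> "g N" "2 * b", OF \<theta> _ gabs] by auto
  hence "\<exists>G. \<forall>N. G N \<in> borel_measurable M \<and> (\<forall>x. \<bar>G N x\<bar> \<le> 2 * b) \<and> (\<integral>x. G N x \<partial>M) = (\<integral>x. g N x \<partial>M) \<and>
     (AE x in M. (\<lambda>n. sym_avg \<theta> (g N) n x) \<longlonglongrightarrow> G N x)"
    by (intro choice allI)
  then obtain G where Gm[measurable]: "\<And>N. G N \<in> borel_measurable M" and Gb: "\<And>N x. \<bar>G N x\<bar> \<le> 2 * b"
    and Gi: "\<And>N. (\<integral>x. G N x \<partial>M) = (\<integral>x. g N x \<partial>M)"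
    and Gc: "\<And>N. AE x in M. (\<lambda>n. sym_avg \<theta> (g N) n x) \<longlonglongrightarrow> G N x"
    by blast
  have Gc': "AE x in M. \<forall>N. (\<lambda>n. sym_avg \<theta> (g N) n x) \<longlonglongrightarrow> G N x"
    using Gc by (simp add: AE_all_countable)
  have pos: "0 \<le> L" if "(\<lambda>n. sym_avg \<theta> (g N) n x) \<longlonglongrightarrow> L" for N x L
  proof (rule LIMSEQ_le_const[OF that])
    have "0 \<le> sym_avg \<theta> (g N) n x" for n using sym_avg_mono[of "\<lambda>_. 0" "g N"] g0 by (simp add: sym_avg_const)
    thus "\<exists>N'. \<forall>n\<ge>N'. 0 \<le> sym_avg \<theta> (g N) n x" by blast
  qed
  \<comment> \<open>Absolute values keep the infimum bounded below at every point, since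
    \<open>G N\<close> is known to be nonnegative only almost everywhere. Its integral lies below
    that of every \<open>g N\<close> and is therefore 0.\<close>
  define H where "H x = (INF N. \<bar>G N x\<bar>)" for x
  have bddH: "bdd_below (range (\<lambda>N. \<bar>G N x\<bar>))" for x by (intro bdd_belowI2[where m=0]) auto
  have H0: "0 \<le> H x" for x unfolding H_def by (intro cINF_greatest) auto
  have HG: "H x \<le> \<bar>G N x\<bar>" for x N unfolding H_def by (intro cINF_lower bddH) auto
  have Hb: "\<bar>H x\<bar> \<le> 2 * b" for x using H0[of x] HG[of x 0] Gb[of 0 x] by linarith
  have [measurable]: "H \<in> borel_measurable M"
    unfolding H_def[abs_def] by (intro borel_measurable_cINF bddH) auto
  have intH: "integrable M H" using Hb by (intro integrable_const_bound[where B="2*b"]) auto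
  have intG: "integrable M (G N)" for N using Gb by (intro integrable_const_bound[where B="2*b"]) auto
  have "(\<integral>x. H x \<partial>M) \<le> (\<integral>x. g N x \<partial>M)" for N
    unfolding Gi[symmetric]
  proof (rule integral_mono_AE[OF intH intG])
    show "AE x in M. H x \<le> G N x" using Gc'
    proof eventually_elim
      case (elim x)
      hence "0 \<le> G N x" by (intro pos) blast
      thus ?case using HG[of x N] by simp
    qed
  qed
  hence "(\<integral>x. H x \<partial>M) \<le> 0" by (intro LIMSEQ_le_const[OF gi]) auto
  moreover have "0 \<le> (\<integral>x. H x \<partial>M)" using H0 by simp
  ultimately have "(\<integral>x. H x \<partial>M) = 0" by (rule antisym)
  hence "AE x in M. H x = 0"
    using integral_nonneg_eq_0_iff_AE[of M H] intH H0 by auto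
  hence "AE x in M. (\<lambda>n. sym_avg \<theta> (m n) n x) \<longlonglongrightarrow> F' x"
    using Gc' F'c
  proof eventually_elim
    case (elim x)
    have "(\<lambda>n. sym_avg \<theta> (m n) n x - sym_avg \<theta> F n x) \<longlonglongrightarrow> 0"
    proof (rule LIMSEQ_I)
      fix r :: real assume r: "0 < r"
      have "\<exists>N. \<bar>G N x\<bar> < r"
      proof (rule ccontr)
        assume "\<not> ?thesis"
        hence "r \<le> H x" unfolding H_def by (intro cINF_greatest) (auto simp: not_less)
        thus False using elim(1) r by simp
      qed
      then obtain N where "G N x < r" by (auto simp: abs_less_iff)
      hence "\<forall>\<^sub>F n in sequentially. sym_avg \<theta> (g N) n x < r"
        using elim(2) by (auto intro: order_tendstoD)
      then obtain n0 where n0: "\<And>n. n \<ge> n0 \<Longrightarrow> sym_avg \<theta> (g N) n x < r"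
        by (auto simp: eventually_sequentially)
      have "norm (sym_avg \<theta> (m n) n x - sym_avg \<theta> F n x - 0) < r" if "n \<ge> max n0 N" for n
      proof -
        have "\<bar>sym_avg \<theta> (m n) n x - sym_avg \<theta> F n x\<bar> \<le> sym_avg \<theta> (\<lambda>x. \<bar>m n x - F x\<bar>) n x"
          unfolding sym_avg_diff by (rule sym_avg_abs_le)
        also have "\<dots> \<le> sym_avg \<theta> (g N) n x" using that by (intro sym_avg_mono gle) auto
        also have "\<dots> < r" using that by (intro n0) auto
        finally show ?thesis by simp
      qed
      thus "\<exists>no. \<forall>n\<ge>no. norm (sym_avg \<theta> (m n) n x - sym_avg \<theta> F n x - 0) < r" by blast
    qed
    from tendsto_add[OF this elim(3)] show ?case by simp
  qed
  moreover have "m n = multi_avg \<theta>s f n" for n by (simp add: m_def fun_eq_iff)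
  ultimately show ?case using F'b by (intro bexI[of _ F']) auto
qed

text \<open>Boxes that are flat outside the coordinates in \<open>S\<close> interpolate between
  \<open>{0}\<close> and \<open>box n\<close>; axes are added one by one, in step with the nesting
  of \<open>multi_avg\<close>.\<close>

definition coord_box :: "'n::finite set \<Rightarrow> nat \<Rightarrow> 'n site set" where
  "coord_box S n = {x. \<forall>i. if i \<in> S then \<bar>x $ i\<bar> \<le> int n else x $ i = 0}"

lemma coord_box_UNIV: "coord_box UNIV n = box n"
  by (simp add: coord_box_def box_def)

lemma sum_coord_box_insert:
  assumes "i \<notin> S"
  shows "(\<Sum>x\<in>coord_box (insert i S) n. h x) = (\<Sum>j\<in>{- int n..int n}. \<Sum>x\<in>coord_box S n. h (x + axis i j))"
proof -
  have zero: "x $ i = 0" if "x \<in> coord_box S n" for x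
    using that assms by (auto simp: coord_box_def dest: spec[of _ i])
  have "(\<Sum>x\<in>coord_box (insert i S) n. h x) =
     (\<Sum>(j,x)\<in>{- int n..int n} \<times> coord_box S n. h (x + axis i j))"
  proof (rule sum.reindex_bij_witness[where j="\<lambda>y. (y $ i, y - axis i (y $ i))" and i="\<lambda>(j,x). x + axis i j"])
    fix p assume p: "p \<in> {- int n..int n} \<times> coord_box S n"
    obtain j x where [simp]: "p = (j, x)" by (cases p)
    have x0: "x $ i = 0" using p zero by auto
    have "\<forall>k. if k \<in> insert i S then \<bar>(x + axis i j) $ k\<bar> \<le> int n else (x + axis i j) $ k = 0"
    proof
      fix k
      have "if k \<in> S then \<bar>x $ k\<bar> \<le> int n else x $ k = 0" using p by (simp add: coord_box_def)
      thus "if k \<in> insert i S then \<bar>(x + axis i j) $ k\<bar> \<le> int n else (x + axis i j) $ k = 0"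
        using p x0 assms by (cases "k = i") (auto simp: axis_def)
    qed
    thus "(case p of (j, x) \<Rightarrow> x + axis i j) \<in> coord_box (insert i S) n" by (simp add: coord_box_def)
    show "((case p of (j, x) \<Rightarrow> x + axis i j) $ i, (case p of (j, x) \<Rightarrow> x + axis i j) -
        axis i ((case p of (j, x) \<Rightarrow> x + axis i j) $ i)) = p"
      using x0 by (simp add: axis_def)
  qed (use assms in \<open>auto simp: coord_box_def axis_def vec_eq_iff split: if_splits\<close>)
  thus ?thesis by (simp add: sum.cartesian_product)
qed

lemma multi_avg_coord_box:
  fixes \<Theta> :: "'n::finite site \<Rightarrow> 'a \<Rightarrow> 'a"
  assumes add: "\<And>x y z. \<Theta> (x + y) z = \<Theta> x (\<Theta> y z)" and z: "\<And>z. \<Theta> 0 z = z" and "distinct ks"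
  shows "multi_avg (map (\<lambda>i j. \<Theta> (axis i j)) ks) f n z =
     (\<Sum>x\<in>coord_box (set ks) n. f (\<Theta> x z)) / (2 * real n + 1) ^ length ks"
  using \<open>distinct ks\<close>
proof (induction ks arbitrary: z)
  case Nil
  have "coord_box {} n = {0 :: 'n site}" by (auto simp: coord_box_def vec_eq_iff)
  thus ?case by (simp add: z)
next
  case (Cons i ks)
  have "sym_avg (\<lambda>j. \<Theta> (axis i j)) (multi_avg (map (\<lambda>i j. \<Theta> (axis i j)) ks) f n) n z =
    (\<Sum>j\<in>{- int n..int n}. (\<Sum>x\<in>coord_box (set ks) n. f (\<Theta> x (\<Theta> (axis i j) z))) / (2 * real n + 1) ^ length ks)
      / (2 * real n + 1)"
    using Cons by (simp add: sym_avg_def)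
  thus ?case using Cons.prems
    by (simp add: sum_coord_box_insert sum_divide_distrib[symmetric] add mult.commute)
qed

text \<open>Counting by averaging: for the trivial action on \<open>unit\<close> the nested average
  of the constant 1 equals 1, and it is also a sum of ones over the box divided by the power.
  Finiteness of the box follows from this afterwards, because an infinite set has
  \<open>card\<close> 0.\<close>

lemma card_box: "real (card (box n :: 'n::finite site set)) = (2 * real n + 1) ^ CARD('n)"
proof -
  obtain ks :: "'n list" where ks: "set ks = UNIV" "distinct ks"
    using finite_distinct_list[of "UNIV :: 'n set"] by auto
  have c: "multi_avg \<theta>s (\<lambda>_. 1) n x = 1" for \<theta>s :: "(int \<Rightarrow> unit \<Rightarrow> unit) list" and x
    by (induction \<theta>s arbitrary: x) (simp_all add: sym_avg_def del: of_nat_add)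
  have "length ks = CARD('n)" using ks distinct_card by fastforce
  thus ?thesis
    using multi_avg_coord_box[of "\<lambda>_ (z::unit). z" ks "\<lambda>_. 1" n "()"] ks c
    by (simp add: coord_box_UNIV field_simps)
qed

lemma card_box_pos: "0 < card (box n :: 'n::finite site set)"
proof -
  have "0 < real (card (box n :: 'n::finite site set))" unfolding card_box by simp
  thus ?thesis by simp
qed

lemma finite_box [simp]: "finite (box n)"
  using card_box_pos card_gt_0_iff by blast

lemma (in prob_space) box_birkhoff_pointwise:
  fixes \<Theta> :: "'n::finite site \<Rightarrow> 'a \<Rightarrow> 'a"
  assumes mp: "\<And>x. measure_preserving_map M (\<Theta> x)"
    and add: "\<And>x y z. \<Theta> (x + y) z = \<Theta> x (\<Theta> y z)" and z: "\<And>z. \<Theta> 0 z = z"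
    and f: "f \<in> borel_measurable M" and b: "\<And>x. \<bar>f x\<bar> \<le> b"
  shows "AE x in M. convergent (\<lambda>n. (\<Sum>y\<in>box n. f (\<Theta> y x)) / real (card (box n :: 'n site set)))"
proof -
  obtain ks :: "'n list" where ks: "set ks = UNIV" "distinct ks"
    using finite_distinct_list[of "UNIV :: 'n set"] by auto
  have len: "length ks = CARD('n)" using ks distinct_card by fastforce
  have ax: "axis i (j + k) = axis i j + (axis i k :: 'n site)" "axis i 0 = (0 :: 'n site)" for i j k
    by (auto simp: vec_eq_iff axis_def)
  have "int_action M (\<lambda>j. \<Theta> (axis i j))" for i
    unfolding int_action_def using mp by (auto simp: ax add z)
  hence "\<exists>F \<in> borel_measurable M. (\<forall>x. \<bar>F x\<bar> \<le> b) \<and>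
     (AE x in M. (\<lambda>n. multi_avg (map (\<lambda>i j. \<Theta> (axis i j)) ks) f n x) \<longlonglongrightarrow> F x)"
    by (intro multi_birkhoff_pointwise f b) auto
  then obtain F where "AE x in M. (\<lambda>n. multi_avg (map (\<lambda>i j. \<Theta> (axis i j)) ks) f n x) \<longlonglongrightarrow> F x"
    by blast
  thus ?thesis
  proof eventually_elim
    case (elim x)
    have "multi_avg (map (\<lambda>i j. \<Theta> (axis i j)) ks) f n x =
      (\<Sum>y\<in>box n. f (\<Theta> y x)) / real (card (box n :: 'n site set))" for n
      unfolding multi_avg_coord_box[OF add z ks(2)] by (simp add: ks coord_box_UNIV card_box len)
    thus ?case using elim by (auto simp: convergent_def)
  qed
qed

subsection \<open>Growth of boxes\<close>

text \<open>The argument of type \<open>'n itself\<close> carries the dimension, which the radius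
  alone does not determine.\<close>

definition vol :: "'n::finite itself \<Rightarrow> nat \<Rightarrow> real" where
  "vol _ n = real (card (box n :: 'n site set))"

lemma vol_eq: "vol TYPE('n::finite) n = (2 * real n + 1) ^ CARD('n)"
  by (simp add: vol_def card_box)

lemma vol_pos [simp]: "0 < vol TYPE('n::finite) n"
  by (simp add: vol_eq)

lemma vol_nonzero [simp]: "vol TYPE('n::finite) n \<noteq> 0"
  by (simp add: vol_eq)

lemma vol_mono: "m \<le> n \<Longrightarrow> vol TYPE('n::finite) m \<le> vol TYPE('n) n"
  by (auto simp: vol_eq intro!: power_mono)

text \<open>Since \<open>(2 * k + 1) * (2 * r + 1) = 2 * ((2 * r + 1) * k + r) + 1\<close>, this
  radius is the one that copies of \<open>box r\<close> fill without remainder.\<close>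

lemma vol_tile: "vol TYPE('n::finite) ((2 * r + 1) * k + r) = vol TYPE('n) k * vol TYPE('n) r"
  by (simp add: vol_eq power_mult_distrib[symmetric]) (simp add: algebra_simps)

lemma boxD: "x \<in> box n \<Longrightarrow> \<bar>x $ i\<bar> \<le> int n"
  by (simp add: box_def)

lemma boxI: "(\<And>i. \<bar>x $ i\<bar> \<le> int n) \<Longrightarrow> x \<in> box n"
  by (simp add: box_def)

lemma box_mono: "m \<le> n \<Longrightarrow> box m \<subseteq> (box n :: 'n::finite site set)"
proof (intro subsetI boxI)
  fix x :: "'n site" and i assume "m \<le> n" "x \<in> box m"
  thus "\<bar>x $ i\<bar> \<le> int n" using boxD[of x m i] by simp
qed

lemma finite_subset_box:
  fixes T :: "'n::finite site set"
  assumes "finite T"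
  shows "\<exists>n. T \<subseteq> box n"
  using assms
proof (induction T)
  case (insert x T)
  then obtain n where n: "T \<subseteq> box n" by auto
  have "x \<in> box (nat (\<Sum>i\<in>UNIV. \<bar>x $ i\<bar>))"
    by (auto simp: box_def sum_nonneg intro!: member_le_sum[of _ UNIV "\<lambda>i. \<bar>x $ i\<bar>"])
  thus ?case using n box_mono[of n "n + nat (\<Sum>i\<in>UNIV. \<bar>x $ i\<bar>)"]
      box_mono[of "nat (\<Sum>i\<in>UNIV. \<bar>x $ i\<bar>)" "n + nat (\<Sum>i\<in>UNIV. \<bar>x $ i\<bar>)"]
    by (intro exI[of _ "n + nat (\<Sum>i\<in>UNIV. \<bar>x $ i\<bar>)"]) auto
qed auto

lemma vol_ratio_tendsto:
  assumes "(\<lambda>n. real (g n) / real n) \<longlonglongrightarrow> 0"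
  shows "(\<lambda>n. vol TYPE('n::finite) n / vol TYPE('n) (n + g n)) \<longlonglongrightarrow> 1"
proof -
  have "(\<lambda>n. 2 * real (g n) / (2 * real n + 1)) \<longlonglongrightarrow> 0"
  proof (rule tendsto_sandwich[OF _ _ tendsto_const assms])
    show "\<forall>\<^sub>F n in sequentially. 2 * real (g n) / (2 * real n + 1) \<le> real (g n) / real n"
      using eventually_gt_at_top[of "0::nat"]
      by eventually_elim (auto simp: field_simps)
  qed auto
  hence "(\<lambda>n. (1 / (1 + 2 * real (g n) / (2 * real n + 1))) ^ CARD('n)) \<longlonglongrightarrow> (1 / (1 + 0)) ^ CARD('n)"
    by (intro tendsto_intros) auto
  moreover have "(1 / (1 + 2 * real (g n) / (2 * real n + 1))) = (2 * real n + 1) / (2 * real (n + g n) + 1)" for n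
    by (simp add: divide_simps)
  ultimately show ?thesis by (simp add: vol_eq power_divide)
qed

lemma vol_ratio_const_tendsto: "(\<lambda>n. vol TYPE('n::finite) (n - r) / vol TYPE('n) n) \<longlonglongrightarrow> 1"
proof -
  have "(\<lambda>n. real r / real n) \<longlonglongrightarrow> 0" by (rule lim_const_over_n)
  hence l: "(\<lambda>n. vol TYPE('n) n / vol TYPE('n) (n + r)) \<longlonglongrightarrow> 1" by (rule vol_ratio_tendsto)
  show ?thesis by (rule LIMSEQ_offset[where k=r]) (use l in simp)
qed

text \<open>For \<open>n \<ge> r\<close> the radius in the numerator is the largest one up to
  \<open>n\<close> that is congruent to \<open>r\<close> modulo \<open>M\<close>, so it misses
  \<open>n\<close> by less than \<open>M\<close>. With \<open>M = 2 * r + 1\<close> it belongs to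
  the part of \<open>box n\<close> that can be tiled exactly.\<close>

lemma tile_ratio_tendsto:
  assumes "M > 0"
  shows "(\<lambda>n. vol TYPE('n::finite) (M * ((n - r) div M) + r) / vol TYPE('n) n) \<longlonglongrightarrow> 1"
proof (rule tendsto_sandwich[OF _ _ vol_ratio_const_tendsto[of M] tendsto_const])
  show "\<forall>\<^sub>F n in sequentially. vol TYPE('n) (n - M) / vol TYPE('n) n \<le>
      vol TYPE('n) (M * ((n - r) div M) + r) / vol TYPE('n) n"
    using eventually_ge_at_top[of r]
  proof eventually_elim
    case (elim n)
    have "n - r < M * ((n - r) div M) + M"
      using mult_div_mod_eq[of M "n - r"] mod_less_divisor[OF assms, of "n - r"] by linarith
    thus ?case using elim by (intro divide_right_mono vol_mono less_imp_le[OF vol_pos]) auto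
  qed
  show "\<forall>\<^sub>F n in sequentially. vol TYPE('n) (M * ((n - r) div M) + r) / vol TYPE('n) n \<le> 1"
    using eventually_ge_at_top[of r]
  proof eventually_elim
    case (elim n)
    have "M * ((n - r) div M) + r \<le> n" using elim times_div_less_eq_dividend[of M "n - r"] by linarith
    thus ?case by (simp add: vol_mono)
  qed
qed

text \<open>The centres have spacing \<open>2 * r + 1\<close>, while \<open>m\<close> is the radius
  of the copy: \<open>m = r\<close> gives a partition, \<open>m < r\<close> leaves
  corridors.\<close>

definition tile :: "nat \<Rightarrow> nat \<Rightarrow> 'n::finite site \<Rightarrow> 'n site set" where
  "tile r m x = (\<lambda>a. a + (2 * int r + 1) *s x) ` box m"

text \<open>In a coordinate where \<open>x\<close> and \<open>y\<close> differ the centres are at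
  least \<open>2 * r + 1\<close> apart, while the offsets account for at most \<open>2 * r\<close>.
  The radii are asymmetric because a tile together with its corridor has to miss the bare
  neighbouring tiles.\<close>

lemma tile_disjoint:
  assumes "x \<noteq> y" "m \<le> r"
  shows "tile r r x \<inter> tile r m (y :: 'n::finite site) = {}"
proof -
  obtain i where i: "x $ i \<noteq> y $ i" using assms by (auto simp: vec_eq_iff)
  have False if "a \<in> box r" "b \<in> box m" "a + (2 * int r + 1) *s x = b + (2 * int r + 1) *s y" for a b :: "'n site"
  proof -
    have "(a + (2 * int r + 1) *s x) $ i = (b + (2 * int r + 1) *s y) $ i" using that by simp
    hence e: "a $ i - b $ i = (2 * int r + 1) * (y $ i - x $ i)" by (simp add: algebra_simps)
    have "\<bar>a $ i\<bar> \<le> int r" "\<bar>b $ i\<bar> \<le> int r"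
      using boxD[OF that(1), of i] boxD[OF that(2), of i] assms(2) by auto
    hence le: "\<bar>(2 * int r + 1) * (y $ i - x $ i)\<bar> \<le> 2 * int r" unfolding e[symmetric] by linarith
    have ab: "\<bar>2 * int r + 1\<bar> = 2 * int r + 1" by simp
    have "(2 * int r + 1) * 1 \<le> (2 * int r + 1) * \<bar>y $ i - x $ i\<bar>"
      using i by (intro mult_left_mono) auto
    also have "\<dots> \<le> 2 * int r" using le unfolding abs_mult ab .
    finally show False by simp
  qed
  thus ?thesis by (auto simp: tile_def)
qed

lemma tile_subset_box:
  assumes "x \<in> box k"
  shows "tile r m x \<subseteq> box ((2 * r + 1) * k + m)"
proof
  fix z assume "z \<in> tile r m x"
  then obtain a where a: "a \<in> box m" "z = a + (2 * int r + 1) *s x" by (auto simp: tile_def)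
  have "\<bar>z $ i\<bar> \<le> int ((2 * r + 1) * k + m)" for i
  proof -
    have "\<bar>z $ i\<bar> \<le> \<bar>a $ i\<bar> + (2 * int r + 1) * \<bar>x $ i\<bar>"
      using abs_triangle_ineq[of "a $ i" "(2 * int r + 1) * x $ i"]
      by (simp only: a(2) vector_add_component vector_smult_component abs_mult)
    also have "\<dots> \<le> int m + (2 * int r + 1) * int k"
      using a assms by (intro add_mono mult_left_mono) (auto dest: boxD)
    finally show ?thesis by (simp add: algebra_simps)
  qed
  thus "z \<in> box ((2 * r + 1) * k + m)" by (simp add: box_def)
qed

lemma card_tile: "card (tile r m (x :: 'n::finite site)) = card (box m :: 'n site set)"
  unfolding tile_def by (rule card_image) (auto simp: inj_on_def)

text \<open>Disjoint tiles inside the large box must fill it, because by \<open>vol_tile\<close>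
  they have as many sites in total.\<close>

lemma box_tiling: "(\<Union>x\<in>box k. tile r r x) = (box ((2 * r + 1) * k + r) :: 'n::finite site set)"
proof (rule card_subset_eq)
  show "(\<Union>x\<in>box k. tile r r x) \<subseteq> (box ((2 * r + 1) * k + r) :: 'n site set)"
    using tile_subset_box by blast
  have "card (\<Union>x\<in>box k. tile r r (x :: 'n site)) = (\<Sum>x\<in>(box k :: 'n site set). card (tile r r x))"
  proof (rule card_UN_disjoint)
    show "\<forall>x\<in>box k. finite (tile r r (x :: 'n site))" by (simp add: tile_def)
    show "\<forall>x\<in>box k. \<forall>y\<in>box k. x \<noteq> y \<longrightarrow> tile r r x \<inter> tile r r (y :: 'n site) = {}"
      by (simp add: tile_disjoint)
  qed simp
  also have "\<dots> = card (box k :: 'n site set) * card (box r :: 'n site set)" by (simp add: card_tile)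
  also have "real \<dots> = real (card (box ((2 * r + 1) * k + r) :: 'n site set))"
    using vol_tile[of r k, where 'n='n] by (simp add: vol_def)
  finally show "card (\<Union>x\<in>box k. tile r r (x :: 'n site)) = card (box ((2 * r + 1) * k + r) :: 'n site set)"
    by (metis of_nat_eq_iff)
qed auto

text \<open>Fekete's argument with corridors: a large box is packed with translates of \<open>box m\<close> that are
  separated by corridors of relative width \<open>g m / m\<close>.\<close>

lemma box_superadditive_convergent:
  fixes F :: "'n::finite site set \<Rightarrow> real"
  assumes mono: "\<And>T D. finite D \<Longrightarrow> T \<subseteq> D \<Longrightarrow> F T \<le> F D"
    and empty: "F {} = 0"
    and shift: "\<And>T x. finite T \<Longrightarrow> F ((\<lambda>a. a + x) ` T) = F T"
    and super: "\<And>m D. finite D \<Longrightarrow> D \<inter> box (m + g m) = {} \<Longrightarrow> F (box m) + F D - c m \<le> F (box m \<union> D)"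
    and c: "(\<lambda>n. c n / vol TYPE('n) n) \<longlonglongrightarrow> 0"
    and g: "(\<lambda>n. real (g n) / real n) \<longlonglongrightarrow> 0"
  shows "convergent (\<lambda>n. ereal (F (box n) / vol TYPE('n) n))"
proof -
  define l where "l = liminf (\<lambda>n. ereal (F (box n) / vol TYPE('n) n))"
  \<comment> \<open>Each new tile is moved to the origin, where \<open>super\<close> applies: with
    spacing radius \<open>m + g m\<close> its corridor misses all earlier tiles. A tile pays
    \<open>c m\<close> once.\<close>
  have tiles: "real (card X) * (F (box m) - c m) \<le> F (\<Union>x\<in>X. tile (m + g m) m x)" if "finite X" for X m
    using that
  proof (induction X)
    case (insert x X)
    define y where "y = (2 * int (m + g m) + 1) *s x"
    define B where "B = (\<Union>x\<in>X. tile (m + g m) m x)"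
    have fB: "finite B" using insert by (auto simp: B_def tile_def)
    define D where "D = (\<lambda>a. a + (- y)) ` B"
    have "tile (m + g m) (m + g m) x \<inter> B = {}"
      unfolding B_def using insert tile_disjoint[of x _ m "m + g m"] by fastforce
    hence dis: "D \<inter> box (m + g m) = {}"
      unfolding D_def tile_def y_def[symmetric] by (force simp: image_iff)
    have "(\<Union>x\<in>insert x X. tile (m + g m) m x) = (\<lambda>a. a + y) ` (box m \<union> D)"
      by (simp add: image_Un D_def image_image B_def) (simp add: tile_def y_def)
    hence "F (\<Union>x\<in>insert x X. tile (m + g m) m x) = F (box m \<union> D)"
      using shift fB by (simp add: D_def)
    also have "\<dots> \<ge> F (box m) + F D - c m" using fB dis by (intro super) (auto simp: D_def)
    also have "F D = F B" unfolding D_def using fB by (rule shift)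
    finally show ?case using insert by (simp add: B_def algebra_simps)
  qed (simp add: empty)
  \<comment> \<open>Tiles are packed into the largest exactly divisible sub-box of
    \<open>box n\<close>; the sites left over can only increase \<open>F\<close>.\<close>
  have low: "ereal ((F (box m) - c m) / vol TYPE('n) (m + g m)) \<le> l" for m
  proof -
    define r where "r = m + g m"
    define M where "M = 2 * r + 1"
    define a where "a = (F (box m) - c m) / vol TYPE('n) r"
    have "(\<lambda>n. ereal (a * (vol TYPE('n) (M * ((n - r) div M) + r) / vol TYPE('n) n))) \<longlonglongrightarrow> ereal (a * 1)"
      unfolding lim_ereal by (intro tendsto_intros tile_ratio_tendsto) (simp add: M_def)
    hence "ereal a = liminf (\<lambda>n. ereal (a * (vol TYPE('n) (M * ((n - r) div M) + r) / vol TYPE('n) n)))"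
      by (subst lim_imp_Liminf[OF sequentially_bot]) (simp_all only: mult_1_right)
    also have "\<dots> \<le> l" unfolding l_def
    proof (rule Liminf_mono)
      show "\<forall>\<^sub>F n in sequentially. ereal (a * (vol TYPE('n) (M * ((n - r) div M) + r) / vol TYPE('n) n))
          \<le> ereal (F (box n) / vol TYPE('n) n)"
        using eventually_ge_at_top[of r]
      proof eventually_elim
        case (elim n)
        define k where "k = (n - r) div M"
        have kn: "M * k + r \<le> n" using elim times_div_less_eq_dividend[of M "n - r"] unfolding k_def by linarith
        have "vol TYPE('n) k * (F (box m) - c m) \<le> F (\<Union>x\<in>(box k :: 'n site set). tile r m x)"
          using tiles[of "box k :: 'n site set" m] by (simp add: r_def vol_def)
        also have "\<dots> \<le> F (box n)"
        proof (rule mono)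
          have "tile r m x \<subseteq> (box n :: 'n site set)" if "x \<in> box k" for x :: "'n site"
            using tile_subset_box[OF that, of r m] box_mono[of "M * k + m" n] kn by (auto simp: M_def r_def)
          thus "(\<Union>x\<in>(box k :: 'n site set). tile r m x) \<subseteq> box n" by blast
        qed simp
        finally have "vol TYPE('n) k * (F (box m) - c m) \<le> F (box n)" .
        moreover have "a * vol TYPE('n) (M * k + r) = vol TYPE('n) k * (F (box m) - c m)"
          unfolding a_def M_def vol_tile by simp
        ultimately have "a * vol TYPE('n) (M * k + r) \<le> F (box n)" by simp
        hence "a * vol TYPE('n) (M * k + r) / vol TYPE('n) n \<le> F (box n) / vol TYPE('n) n"
          by (intro divide_right_mono less_imp_le[OF vol_pos])
        thus ?case by (simp add: k_def)
      qed
    qed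
    finally show ?thesis by (simp add: a_def r_def)
  qed
  have pos: "0 \<le> F T" if "finite T" for T using mono[OF that, of "{}"] empty by simp
  have l0: "0 \<le> l" unfolding l_def zero_ereal_def
    by (intro Liminf_bounded) (auto simp: pos less_imp_le)
  have "limsup (\<lambda>n. ereal (F (box n) / vol TYPE('n) n)) \<le> l"
  \<comment> \<open>For finite \<open>l\<close>, \<open>low\<close> bounds \<open>F (box m)\<close>
    by \<open>l\<close> times a volume asymptotic to that of \<open>box m\<close>, plus
    \<open>c m\<close>. An infinite \<open>l\<close> is immediate, and \<open>l0\<close> excludes
    minus infinity.\<close>
  proof (cases l)
    case (real r)
    define u where "u m = r / (vol TYPE('n) m / vol TYPE('n) (m + g m)) + c m / vol TYPE('n) m" for m
    have "(\<lambda>m. ereal (u m)) \<longlonglongrightarrow> ereal (r / 1 + 0)" unfolding lim_ereal u_def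
      by (intro tendsto_intros vol_ratio_tendsto g c) auto
    hence "limsup (\<lambda>m. ereal (u m)) = ereal r" by (simp add: lim_imp_Limsup)
    moreover have "F (box m) / vol TYPE('n) m \<le> u m" for m
    proof -
      have "(F (box m) - c m) / vol TYPE('n) (m + g m) \<le> r" using low[of m] real by simp
      hence "F (box m) - c m \<le> r * vol TYPE('n) (m + g m)" by (simp add: pos_divide_le_eq)
      hence "(F (box m) - c m) / vol TYPE('n) m \<le> r * vol TYPE('n) (m + g m) / vol TYPE('n) m"
        by (intro divide_right_mono less_imp_le[OF vol_pos])
      thus ?thesis by (simp add: u_def diff_divide_distrib)
    qed
    hence "limsup (\<lambda>n. ereal (F (box n) / vol TYPE('n) n)) \<le> limsup (\<lambda>m. ereal (u m))"
      by (intro Limsup_mono) auto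
    ultimately show ?thesis using real by simp
  qed (use l0 in auto)
  moreover have "l \<le> limsup (\<lambda>n. ereal (F (box n) / vol TYPE('n) n))"
    unfolding l_def by (intro Liminf_le_Limsup) simp
  ultimately have "limsup (\<lambda>n. ereal (F (box n) / vol TYPE('n) n)) = l" by (rule antisym)
  hence "(\<lambda>n. ereal (F (box n) / vol TYPE('n) n)) \<longlonglongrightarrow> l"
    by (simp add: tendsto_iff_Liminf_eq_Limsup l_def)
  thus ?thesis by (auto simp: convergent_def)
qed

subsection \<open>Cylinder probabilities\<close>

definition cyl :: "'n::finite site set \<Rightarrow> ('n site \<Rightarrow> 'a) \<Rightarrow> ('n site \<Rightarrow> 'a) set" where
  "cyl T \<zeta> = {\<xi>. \<forall>x\<in>T. \<xi> x = \<zeta> x}"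

definition local_on :: "'n::finite site set \<Rightarrow> (('n site \<Rightarrow> 'a) \<Rightarrow> 'b) \<Rightarrow> bool" where
  "local_on T f \<longleftrightarrow> (\<forall>\<xi> \<xi>'. (\<forall>x\<in>T. \<xi> x = \<xi>' x) \<longrightarrow> f \<xi> = f \<xi>')"

definition glue :: "'n::finite site set \<Rightarrow> ('n site \<Rightarrow> 'a) \<Rightarrow> ('n site \<Rightarrow> 'a) \<Rightarrow> ('n site \<Rightarrow> 'a)" where
  "glue T s t = (\<lambda>x. if x \<in> T then s x else t x)"

text \<open>Extensional functions: finitely many for finite \<open>T\<close> and a finite alphabet,
  yet still total configurations, so functions local on \<open>T\<close> can be evaluated at
  them.\<close>

abbreviation cfgs :: "'n::finite site set \<Rightarrow> ('n site \<Rightarrow> 'a) set" where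
  "cfgs T \<equiv> PiE T (\<lambda>_. UNIV)"

lemma local_onD: "local_on T f \<Longrightarrow> (\<And>x. x \<in> T \<Longrightarrow> \<xi> x = \<xi>' x) \<Longrightarrow> f \<xi> = f \<xi>'"
  unfolding local_on_def by blast

lemma space_cfg [simp]: "space cfg_space = UNIV"
  by (auto simp: cfg_space_def space_PiM)

lemma cyl_measurable [measurable]: "finite T \<Longrightarrow> cyl T \<zeta> \<in> sets cfg_space"
proof -
  assume T: "finite T"
  have "cyl T \<zeta> = {\<xi> \<in> space cfg_space. \<forall>x\<in>T. \<xi> x = \<zeta> x}" by (auto simp: cyl_def)
  also have "\<dots> \<in> sets cfg_space"
  proof (rule sets.sets_Collect_finite_All[OF _ T])
    fix x assume "x \<in> T"
    have [measurable]: "(\<lambda>\<xi>. \<xi> x) \<in> measurable cfg_space (count_space UNIV)"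
      unfolding cfg_space_def by (rule measurable_component_singleton) simp
    show "{\<xi> \<in> space cfg_space. \<xi> x = \<zeta> x} \<in> sets cfg_space" by measurable
  qed
  finally show ?thesis .
qed

lemma cyl_prob_eq:
  assumes "sets Q = sets cfg_space"
  shows "cyl_prob Q T \<zeta> = measure Q (cyl T \<zeta>)"
proof -
  have "space Q = UNIV" using sets_eq_imp_space_eq[OF assms] by simp
  thus ?thesis by (simp add: cyl_prob_def cyl_def)
qed

lemma finite_cfgs [simp]: "finite T \<Longrightarrow> finite (cfgs T :: ('n::finite site \<Rightarrow> 'a::finite) set)"
  by (intro finite_PiE) auto

lemma restrict_in_cfgs: "restrict \<xi> T \<in> cfgs T"
  by (rule restrict_PiE_iff[THEN iffD2]) simp

text \<open>The pattern \<open>restrict \<xi> T\<close> is the only one whose cylinder contains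
  \<open>\<xi>\<close>. The finite expansion gives measurability, integrability and the value of the
  integral of local functions.\<close>

lemma local_eq_sum:
  fixes f :: "('n::finite site \<Rightarrow> 'a::finite) \<Rightarrow> real"
  assumes T: "finite T" and f: "local_on T f"
  shows "f \<xi> = (\<Sum>\<zeta>\<in>cfgs T. indicator (cyl T \<zeta>) \<xi> * f \<zeta>)"
proof -
  have "(\<Sum>\<zeta>\<in>cfgs T. indicator (cyl T \<zeta>) \<xi> * f \<zeta>) = (\<Sum>\<zeta>\<in>{restrict \<xi> T}. indicator (cyl T \<zeta>) \<xi> * f \<zeta>)"
  proof (rule sum.mono_neutral_right)
    show "{restrict \<xi> T} \<subseteq> cfgs T" by (simp add: restrict_in_cfgs)
    show "\<forall>\<zeta>\<in>cfgs T - {restrict \<xi> T}. indicator (cyl T \<zeta>) \<xi> * f \<zeta> = 0"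
    proof
      fix \<zeta> assume z: "\<zeta> \<in> cfgs T - {restrict \<xi> T}"
      have "\<zeta> = restrict \<xi> T" if "\<xi> \<in> cyl T \<zeta>"
        using z that by (auto simp: cyl_def PiE_def extensional_def fun_eq_iff restrict_def)
      thus "indicator (cyl T \<zeta>) \<xi> * f \<zeta> = 0" using z by (auto simp: indicator_def)
    qed
  qed (use T in simp)
  also have "\<dots> = f \<xi>" using local_onD[OF f, of "restrict \<xi> T" \<xi>] by (auto simp: cyl_def indicator_def)
  finally show ?thesis by simp
qed

lemma local_measurable:
  fixes f :: "('n::finite site \<Rightarrow> 'a::finite) \<Rightarrow> real"
  assumes "finite T" "local_on T f"
  shows "f \<in> borel_measurable cfg_space"
proof -
  have [measurable]: "cyl T \<zeta> \<in> sets cfg_space" for \<zeta> :: "'n site \<Rightarrow> 'a" using assms(1) by (rule cyl_measurable)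
  have "f = (\<lambda>\<xi>. \<Sum>\<zeta>\<in>cfgs T. indicator (cyl T \<zeta>) \<xi> * f \<zeta>)" using local_eq_sum[OF assms] by blast
  also have "\<dots> \<in> borel_measurable cfg_space" by measurable
  finally show ?thesis .
qed

lemma local_integral:
  fixes f :: "('n::finite site \<Rightarrow> 'a::finite) \<Rightarrow> real"
  assumes T: "finite T" "local_on T f" and Q: "prob_space Q" "sets Q = sets cfg_space"
  shows "integrable Q f" "(\<integral>\<xi>. f \<xi> \<partial>Q) = (\<Sum>\<zeta>\<in>cfgs T. cyl_prob Q T \<zeta> * f \<zeta>)"
proof -
  interpret prob_space Q by fact
  have sp: "space Q = UNIV" using sets_eq_imp_space_eq[OF Q(2)] by simp
  have eq: "f = (\<lambda>\<xi>. \<Sum>\<zeta>\<in>cfgs T. indicator (cyl T \<zeta>) \<xi> * f \<zeta>)" using local_eq_sum[OF T] by blast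
  have int: "integrable Q (\<lambda>\<xi>. indicator (cyl T \<zeta>) \<xi> * f \<zeta>)" for \<zeta>
    using cyl_measurable[OF T(1), of \<zeta>] Q(2)
    by (intro integrable_mult_left integrable_real_indicator) (auto simp: less_top[symmetric])
  show "integrable Q f" by (subst eq) (intro Bochner_Integration.integrable_sum int)
  have "(\<integral>\<xi>. f \<xi> \<partial>Q) = (\<integral>\<xi>. (\<Sum>\<zeta>\<in>cfgs T. indicator (cyl T \<zeta>) \<xi> * f \<zeta>) \<partial>Q)" using eq by simp
  also have "\<dots> = (\<Sum>\<zeta>\<in>cfgs T. (\<integral>\<xi>. indicator (cyl T \<zeta>) \<xi> * f \<zeta> \<partial>Q))"
    by (intro Bochner_Integration.integral_sum int)
  also have "\<dots> = (\<Sum>\<zeta>\<in>cfgs T. cyl_prob Q T \<zeta> * f \<zeta>)" by (simp add: cyl_prob_eq[OF Q(2)] sp)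
  finally show "(\<integral>\<xi>. f \<xi> \<partial>Q) = (\<Sum>\<zeta>\<in>cfgs T. cyl_prob Q T \<zeta> * f \<zeta>)" .
qed

lemma sum_cfgs_Un:
  fixes h :: "('n::finite site \<Rightarrow> 'a) \<Rightarrow> 'b::comm_monoid_add"
  assumes "T \<inter> D = {}"
  shows "(\<Sum>\<zeta>\<in>cfgs (T \<union> D). h \<zeta>) = (\<Sum>s\<in>cfgs T. \<Sum>t\<in>cfgs D. h (glue T s t))"
proof -
  have "(\<Sum>\<zeta>\<in>cfgs (T \<union> D). h \<zeta>) = (\<Sum>(s,t)\<in>cfgs T \<times> cfgs D. h (glue T s t))"
  proof (rule sum.reindex_bij_witness[where j="\<lambda>\<zeta>. (restrict \<zeta> T, restrict \<zeta> D)" and i="\<lambda>(s,t). glue T s t"])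
    fix \<zeta> :: "'n site \<Rightarrow> 'a" assume z: "\<zeta> \<in> cfgs (T \<union> D)"
    have "glue T (restrict \<zeta> T) (restrict \<zeta> D) = \<zeta>"
      using z by (auto simp: glue_def fun_eq_iff PiE_def extensional_def)
    thus "(case (restrict \<zeta> T, restrict \<zeta> D) of (s, t) \<Rightarrow> glue T s t) = \<zeta>"
      "(case (restrict \<zeta> T, restrict \<zeta> D) of (s, t) \<Rightarrow> h (glue T s t)) = h \<zeta>" by auto
  qed (use assms in \<open>auto simp: glue_def fun_eq_iff PiE_def extensional_def\<close>)
  thus ?thesis by (simp add: sum.cartesian_product)
qed

lemma sum_cfgs_translate:
  fixes f g :: "('n::finite site \<Rightarrow> 'a) \<Rightarrow> 'b::comm_monoid_add"
  assumes fg: "\<And>\<zeta>. f \<zeta> = g (restrict (shift x \<zeta>) T)"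
  shows "(\<Sum>\<zeta>\<in>cfgs ((\<lambda>a. a + x) ` T). f \<zeta>) = (\<Sum>\<zeta>\<in>cfgs T. g \<zeta>)"
proof (rule sum.reindex_bij_witness[where j="\<lambda>\<zeta>. restrict (shift x \<zeta>) T"
      and i="\<lambda>\<zeta>. restrict (shift (- x) \<zeta>) ((\<lambda>a. a + x) ` T)"])
  fix \<zeta> :: "'n site \<Rightarrow> 'a" assume z: "\<zeta> \<in> cfgs ((\<lambda>a. a + x) ` T)"
  have "restrict (shift (- x) (restrict (shift x \<zeta>) T)) ((\<lambda>a. a + x) ` T) y = \<zeta> y" for y
  proof (cases "y \<in> (\<lambda>a. a + x) ` T")
    case True
    then obtain a where "a \<in> T" "y = a + x" by auto
    thus ?thesis by (auto simp: shift_def add.commute)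
  next
    case False
    thus ?thesis using z by (simp add: PiE_def extensional_def)
  qed
  thus "restrict (shift (- x) (restrict (shift x \<zeta>) T)) ((\<lambda>a. a + x) ` T) = \<zeta>" by blast
next
  fix \<zeta> :: "'n site \<Rightarrow> 'a" assume z: "\<zeta> \<in> cfgs T"
  have "restrict (shift x (restrict (shift (- x) \<zeta>) ((\<lambda>a. a + x) ` T))) T y = \<zeta> y" for y
    using z by (cases "y \<in> T") (auto simp: shift_def add.commute PiE_def extensional_def)
  thus "restrict (shift x (restrict (shift (- x) \<zeta>) ((\<lambda>a. a + x) ` T))) T = \<zeta>" by blast
qed (rule restrict_in_cfgs fg[symmetric])+

text \<open>Finite-dimensional distributions in the abstract, so that uniform weights are covered
  without constructing a product measure. Weights take full configurations as arguments, hence the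
  locality clause.\<close>

definition consistent_weights :: "('n::finite site set \<Rightarrow> ('n site \<Rightarrow> 'a) \<Rightarrow> real) \<Rightarrow> bool" where
  "consistent_weights p \<longleftrightarrow> (\<forall>T \<zeta>. 0 \<le> p T \<zeta>) \<and> (\<forall>T. local_on T (p T)) \<and> (\<forall>\<zeta>. p {} \<zeta> = 1) \<and>
     (\<forall>T D s. finite T \<longrightarrow> finite D \<longrightarrow> T \<inter> D = {} \<longrightarrow> (\<Sum>t\<in>cfgs D. p (T \<union> D) (glue T s t)) = p T s)"

lemma cyl_prob_consistent:
  fixes Q :: "('n::finite site \<Rightarrow> 'a::finite) measure"
  assumes Q: "prob_space Q" "sets Q = sets cfg_space"
  shows "consistent_weights (cyl_prob Q)"
  unfolding consistent_weights_def
proof (intro conjI allI impI)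
  interpret prob_space Q by fact
  have sp: "space Q = UNIV" using sets_eq_imp_space_eq[OF Q(2)] by simp
  fix T D :: "'n site set" and s \<zeta> :: "'n site \<Rightarrow> 'a"
  show "0 \<le> cyl_prob Q T \<zeta>" by (simp add: cyl_prob_def)
  show "local_on T (cyl_prob Q T)" by (auto simp: local_on_def cyl_prob_def)
  show "cyl_prob Q {} \<zeta> = 1" using prob_space sp by (simp add: cyl_prob_def)
  assume fin: "finite T" "finite D" and dis: "T \<inter> D = {}"
  have m: "cyl (T \<union> D) z \<in> sets Q" for z using fin cyl_measurable[of "T \<union> D" z] Q(2) by simp
  have "cyl T s = (\<Union>t\<in>cfgs D. cyl (T \<union> D) (glue T s t))"
  proof (intro equalityI subsetI)
    fix \<xi> assume "\<xi> \<in> cyl T s"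
    hence "\<xi> \<in> cyl (T \<union> D) (glue T s (restrict \<xi> D))" by (auto simp: cyl_def glue_def)
    moreover have "restrict \<xi> D \<in> cfgs D" by auto
    ultimately show "\<xi> \<in> (\<Union>t\<in>cfgs D. cyl (T \<union> D) (glue T s t))" by blast
  qed (auto simp: cyl_def glue_def)
  moreover have "disjoint_family_on (\<lambda>t. cyl (T \<union> D) (glue T s t)) (cfgs D)"
  proof (unfold disjoint_family_on_def, intro ballI impI equals0I)
    fix t t' \<xi> assume t: "t \<in> cfgs D" "t' \<in> cfgs D" "t \<noteq> t'"
      and \<xi>: "\<xi> \<in> cyl (T \<union> D) (glue T s t) \<inter> cyl (T \<union> D) (glue T s t')"
    have "t x = t' x" for x
    proof (cases "x \<in> D")
      case True
      hence "x \<notin> T" using dis by auto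
      moreover have "\<xi> x = glue T s t x" "\<xi> x = glue T s t' x"
        using \<xi> True unfolding cyl_def by blast+
      ultimately show ?thesis by (simp add: glue_def)
    qed (use t in \<open>auto simp: PiE_def extensional_def\<close>)
    thus False using t by auto
  qed
  moreover have "(\<lambda>t. cyl (T \<union> D) (glue T s t)) ` cfgs D \<subseteq> sets Q" using m by blast
  ultimately show "(\<Sum>t\<in>cfgs D. cyl_prob Q (T \<union> D) (glue T s t)) = cyl_prob Q T s"
    using finite_measure_finite_Union[of "cfgs D" "\<lambda>t. cyl (T \<union> D) (glue T s t)"] fin
    by (simp add: cyl_prob_eq[OF Q(2)])
qed

lemma uniform_consistent:
  "consistent_weights (\<lambda>(T :: 'n::finite site set) (\<zeta> :: 'n site \<Rightarrow> 'a::finite). (1 / real CARD('a)) ^ card T)"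
  unfolding consistent_weights_def
  by (auto simp: local_on_def card_PiE card_Un_disjoint power_add field_simps power_divide)

section \<open>Relative entropy between consistent families of weights\<close>

lemma gibbs_inequality:
  fixes q p :: "'a \<Rightarrow> real"
  assumes "\<And>x. x \<in> X \<Longrightarrow> 0 \<le> q x" "\<And>x. x \<in> X \<Longrightarrow> 0 \<le> p x"
    and "\<And>x. x \<in> X \<Longrightarrow> q x \<noteq> 0 \<Longrightarrow> p x \<noteq> 0" and "sum p X \<le> sum q X"
  shows "0 \<le> (\<Sum>x\<in>X. q x * ln (q x / p x))"
proof -
  have "0 \<le> (\<Sum>x\<in>X. q x - p x)" using assms(4) by (simp add: sum_subtractf)
  also have "\<dots> \<le> (\<Sum>x\<in>X. q x * ln (q x / p x))"
  proof (rule sum_mono)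
    fix x assume x: "x \<in> X"
    show "q x - p x \<le> q x * ln (q x / p x)"
    proof (cases "q x = 0")
      case False
      hence pos: "0 < q x" "0 < p x" using assms(1-3)[OF x] by force+
      hence "ln (p x / q x) \<le> p x / q x - 1" by (intro ln_le_minus_one) simp
      hence "q x * ln (p x / q x) \<le> q x * (p x / q x - 1)" using pos by (intro mult_left_mono) auto
      hence "q x * ln (p x / q x) \<le> p x - q x" using pos by (simp add: right_diff_distrib)
      thus ?thesis using pos by (simp add: ln_div right_diff_distrib)
    qed (use assms(2)[OF x] in auto)
  qed
  finally show ?thesis .
qed

text \<open>Division and \<open>ln\<close> are total, so this real number represents the relative
  entropy of the marginals on \<open>T\<close> under absolute continuity, which the lemmas below
  carry as \<open>ac\<close>.\<close>

definition weights_kl :: "('n::finite site set \<Rightarrow> ('n site \<Rightarrow> 'a::finite) \<Rightarrow> real) \<Rightarrow>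
    ('n site set \<Rightarrow> ('n site \<Rightarrow> 'a) \<Rightarrow> real) \<Rightarrow> 'n site set \<Rightarrow> real" where
  "weights_kl q p T = (\<Sum>\<zeta>\<in>cfgs T. q T \<zeta> * ln (q T \<zeta> / p T \<zeta>))"

context
  fixes q :: "'n::finite site set \<Rightarrow> ('n site \<Rightarrow> 'a::finite) \<Rightarrow> real"
  assumes q: "consistent_weights q"
begin

lemma weights_nonneg: "0 \<le> q T \<zeta>"
  using q by (simp add: consistent_weights_def)

lemma weights_local: "local_on T (q T)"
  using q by (simp add: consistent_weights_def)

lemma weights_glue: "q T (glue T s t) = q T s"
  by (rule local_onD[OF weights_local]) (simp add: glue_def)

lemma weights_empty: "q {} \<zeta> = 1"
  using q by (simp add: consistent_weights_def)

lemma weights_marginal: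
  assumes "finite T" "finite D" "T \<inter> D = {}"
  shows "(\<Sum>t\<in>cfgs D. q (T \<union> D) (glue T s t)) = q T s"
  using q assms by (simp add: consistent_weights_def)

lemma weights_sum: "finite T \<Longrightarrow> (\<Sum>t\<in>cfgs T. q T t) = 1"
  using weights_marginal[of "{}" T undefined] weights_empty by (simp add: glue_def)

lemma weights_marginal_expect:
  assumes T: "finite T" "finite D" "T \<inter> D = {}" and f: "local_on T f"
  shows "(\<Sum>\<zeta>\<in>cfgs (T \<union> D). q (T \<union> D) \<zeta> * f \<zeta>) = (\<Sum>s\<in>cfgs T. q T s * f s)"
proof -
  have "(\<Sum>\<zeta>\<in>cfgs (T \<union> D). q (T \<union> D) \<zeta> * f \<zeta>) = (\<Sum>s\<in>cfgs T. \<Sum>t\<in>cfgs D. q (T \<union> D) (glue T s t) * f s)"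
    unfolding sum_cfgs_Un[OF T(3)]
    by (intro sum.cong refl arg_cong2[where f="(*)"] local_onD[OF f]) (simp add: glue_def)
  thus ?thesis by (simp add: sum_distrib_right[symmetric] weights_marginal T)
qed

lemma weights_antimono:
  assumes "finite D" "T \<subseteq> D"
  shows "q D \<zeta> \<le> q T \<zeta>"
proof -
  have D: "D = T \<union> (D - T)" and fin: "finite T" "finite (D - T)"
    using assms finite_subset by auto
  have "q D \<zeta> = q D (glue T \<zeta> (restrict \<zeta> (D - T)))"
    by (rule local_onD[OF weights_local]) (auto simp: glue_def)
  also have "\<dots> \<le> (\<Sum>t\<in>cfgs (D - T). q D (glue T \<zeta> t))"
    by (rule member_le_sum[OF restrict_in_cfgs]) (use fin in \<open>auto simp: weights_nonneg\<close>)
  also have "\<dots> = q T \<zeta>" using weights_marginal[of T "D - T" \<zeta>] D fin by auto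
  finally show ?thesis .
qed

end

context
  fixes q p :: "'n::finite site set \<Rightarrow> ('n site \<Rightarrow> 'a::finite) \<Rightarrow> real"
  assumes q: "consistent_weights q" and p: "consistent_weights p"
    and ac: "\<And>T \<zeta>. finite T \<Longrightarrow> p T \<zeta> = 0 \<Longrightarrow> q T \<zeta> = 0"
begin

lemma weights_pos:
  assumes "finite D" "T \<subseteq> D" "q D \<zeta> \<noteq> 0"
  shows "0 < q T \<zeta>" "0 < p T \<zeta>"
proof -
  have "0 < q D \<zeta>" using weights_nonneg[OF q] assms(3) by (metis less_eq_real_def)
  thus 1: "0 < q T \<zeta>" using weights_antimono[OF q assms(1,2), of \<zeta>] by simp
  have "finite T" using assms finite_subset by auto
  hence "p T \<zeta> \<noteq> 0" using ac 1 by fastforce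
  thus "0 < p T \<zeta>" using weights_nonneg[OF p] by (metis less_eq_real_def)
qed

text \<open>Marginalisation puts the logarithms of different regions on the common weights
  \<open>q D\<close>, where entropies can be compared term by term.\<close>

lemma weights_kl_expect:
  assumes "finite D" "T \<subseteq> D"
  shows "weights_kl q p T = (\<Sum>\<zeta>\<in>cfgs D. q D \<zeta> * ln (q T \<zeta> / p T \<zeta>))"
proof -
  have D: "T \<union> (D - T) = D" and fin: "finite T" "finite (D - T)"
    using assms finite_subset by auto
  have "local_on T (\<lambda>\<zeta>. ln (q T \<zeta> / p T \<zeta>))"
    using weights_local[OF q, of T] weights_local[OF p, of T] unfolding local_on_def by metis
  from weights_marginal_expect[OF q fin _ this] D show ?thesis by (simp add: weights_kl_def)
qed

text \<open>Gibbs' inequality for \<open>q\<close> on the union against the product of its two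
  marginals: mutual information is nonnegative. Replacing \<open>p\<close> on the union by the
  product of its marginals costs at most \<open>c\<close>.\<close>

lemma weights_kl_superadditive:
  assumes fin: "finite T" "finite D" and dis: "T \<inter> D = {}"
    and c: "\<And>\<zeta>. p (T \<union> D) \<zeta> \<le> exp c * (p T \<zeta> * p D \<zeta>)"
  shows "weights_kl q p T + weights_kl q p D - c \<le> weights_kl q p (T \<union> D)"
proof -
  let ?S = "T \<union> D"
  have fS: "finite ?S" using fin by simp
  have "(\<Sum>\<zeta>\<in>cfgs ?S. q T \<zeta> * q D \<zeta>) = (\<Sum>s\<in>cfgs T. \<Sum>t\<in>cfgs D. q T s * q D t)"
    unfolding sum_cfgs_Un[OF dis] using dis
    by (intro sum.cong refl arg_cong2[where f="(*)"] local_onD[OF weights_local[OF q]]) (auto simp: glue_def)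
  also have "\<dots> = 1" by (simp add: sum_distrib_left[symmetric] weights_sum[OF q] fin)
  finally have "0 \<le> (\<Sum>\<zeta>\<in>cfgs ?S. q ?S \<zeta> * ln (q ?S \<zeta> / (q T \<zeta> * q D \<zeta>)))"
    using weights_pos(1)[OF fS, of T] weights_pos(1)[OF fS, of D]
    by (intro gibbs_inequality) (auto simp: weights_nonneg[OF q] weights_sum[OF q fS] less_le)
  also have "\<dots> \<le> (\<Sum>\<zeta>\<in>cfgs ?S. q ?S \<zeta> * (ln (q ?S \<zeta> / p ?S \<zeta>) - ln (q T \<zeta> / p T \<zeta>) - ln (q D \<zeta> / p D \<zeta>) + c))"
  proof (rule sum_mono)
    fix \<zeta> :: "'n site \<Rightarrow> 'a"
    show "q ?S \<zeta> * ln (q ?S \<zeta> / (q T \<zeta> * q D \<zeta>)) \<le>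
      q ?S \<zeta> * (ln (q ?S \<zeta> / p ?S \<zeta>) - ln (q T \<zeta> / p T \<zeta>) - ln (q D \<zeta> / p D \<zeta>) + c)"
    proof (cases "q ?S \<zeta> = 0")
      case False
      note pos = weights_pos[OF fS _ False]
      have P: "0 < q ?S \<zeta>" "0 < p ?S \<zeta>" "0 < q T \<zeta>" "0 < p T \<zeta>" "0 < q D \<zeta>" "0 < p D \<zeta>"
        using pos[of ?S] pos[of T] pos[of D] by auto
      have "ln (p ?S \<zeta>) \<le> ln (exp c * (p T \<zeta> * p D \<zeta>))" using P c[of \<zeta>] by simp
      also have "\<dots> = c + ln (p T \<zeta>) + ln (p D \<zeta>)" using P by (simp add: ln_mult)
      finally show ?thesis using P by (intro mult_left_mono) (auto simp: ln_div ln_mult)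
    qed simp
  qed
  also have "\<dots> = weights_kl q p ?S - weights_kl q p T - weights_kl q p D + c"
    unfolding weights_kl_expect[OF fS Un_upper1] weights_kl_expect[OF fS Un_upper2]
      weights_kl_expect[OF fS order_refl]
    by (simp add: algebra_simps sum.distrib sum_subtractf sum_distrib_left[symmetric] weights_sum[OF q fS])
  finally show ?thesis by simp
qed

text \<open>Chain rule: the difference is the relative entropy of \<open>q D\<close> against the
  hybrid \<open>q T * (p D / p T)\<close>, which combines the marginal of \<open>q\<close> on
  \<open>T\<close> with the conditional law of \<open>p\<close> given \<open>T\<close>.\<close>

lemma weights_kl_mono:
  assumes "finite D" "T \<subseteq> D"
  shows "weights_kl q p T \<le> weights_kl q p D"
proof -
  have D: "T \<union> (D - T) = D" and fin: "finite T" "finite (D - T)" and dis: "T \<inter> (D - T) = {}"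
    using assms finite_subset by auto
  have "(\<Sum>\<zeta>\<in>cfgs D. q T \<zeta> * (p D \<zeta> / p T \<zeta>)) =
     (\<Sum>s\<in>cfgs T. \<Sum>t\<in>cfgs (D - T). q T s * (p D (glue T s t) / p T s))"
    using sum_cfgs_Un[OF dis, of "\<lambda>\<zeta>. q T \<zeta> * (p D \<zeta> / p T \<zeta>)"] unfolding D
    by (simp add: weights_glue[OF q] weights_glue[OF p])
  also have "\<dots> = (\<Sum>s\<in>cfgs T. q T s * (p T s / p T s))"
    using weights_marginal[OF p fin dis] unfolding D
    by (auto simp: sum_distrib_left[symmetric] sum_divide_distrib[symmetric] intro!: sum.cong)
  also have "\<dots> \<le> (\<Sum>s\<in>cfgs T. q T s)" using weights_nonneg[OF q] by (intro sum_mono) auto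
  finally have le: "(\<Sum>\<zeta>\<in>cfgs D. q T \<zeta> * (p D \<zeta> / p T \<zeta>)) \<le> 1" using weights_sum[OF q fin(1)] by simp
  have "0 \<le> (\<Sum>\<zeta>\<in>cfgs D. q D \<zeta> * ln (q D \<zeta> / (q T \<zeta> * (p D \<zeta> / p T \<zeta>))))"
  proof (rule gibbs_inequality)
    fix \<zeta> assume "q D \<zeta> \<noteq> 0"
    from weights_pos[OF assms(1) _ this, of T] weights_pos[OF assms(1) _ this, of D] assms(2)
    show "q T \<zeta> * (p D \<zeta> / p T \<zeta>) \<noteq> 0" by auto
  qed (use le weights_sum[OF q assms(1)] weights_nonneg[OF q] weights_nonneg[OF p] in auto)
  also have "\<dots> = (\<Sum>\<zeta>\<in>cfgs D. q D \<zeta> * (ln (q D \<zeta> / p D \<zeta>) - ln (q T \<zeta> / p T \<zeta>)))"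
  proof (rule sum.cong[OF refl])
    fix \<zeta> :: "'n site \<Rightarrow> 'a"
    show "q D \<zeta> * ln (q D \<zeta> / (q T \<zeta> * (p D \<zeta> / p T \<zeta>))) =
      q D \<zeta> * (ln (q D \<zeta> / p D \<zeta>) - ln (q T \<zeta> / p T \<zeta>))"
    proof (cases "q D \<zeta> = 0")
      case False
      have "0 < q D \<zeta>" "0 < p D \<zeta>" "0 < q T \<zeta>" "0 < p T \<zeta>"
        using weights_pos[OF assms(1) _ False, of T] weights_pos[OF assms(1) _ False, of D] assms(2) by auto
      thus ?thesis by (simp add: ln_div ln_mult)
    qed simp
  qed
  also have "\<dots> = weights_kl q p D - weights_kl q p T"
    unfolding weights_kl_expect[OF assms] weights_kl_expect[OF assms(1) order_refl]
    by (simp add: right_diff_distrib sum_subtractf)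
  finally show ?thesis by simp
qed

lemma weights_kl_shift:
  assumes qs: "\<And>\<zeta>. q ((\<lambda>a. a + x) ` T) \<zeta> = q T (shift x \<zeta>)"
    and ps: "\<And>\<zeta>. p ((\<lambda>a. a + x) ` T) \<zeta> = p T (shift x \<zeta>)"
  shows "weights_kl q p ((\<lambda>a. a + x) ` T) = weights_kl q p T"
  unfolding weights_kl_def
proof (rule sum_cfgs_translate)
  fix \<zeta> :: "'n site \<Rightarrow> 'a"
  have "q T (restrict (shift x \<zeta>) T) = q T (shift x \<zeta>)" "p T (restrict (shift x \<zeta>) T) = p T (shift x \<zeta>)"
    by (auto intro!: local_onD[OF weights_local[OF q]] local_onD[OF weights_local[OF p]])
  thus "q ((\<lambda>a. a + x) ` T) \<zeta> * ln (q ((\<lambda>a. a + x) ` T) \<zeta> / p ((\<lambda>a. a + x) ` T) \<zeta>) =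
     q T (restrict (shift x \<zeta>) T) * ln (q T (restrict (shift x \<zeta>) T) / p T (restrict (shift x \<zeta>) T))"
    by (simp add: qs ps)
qed

end

subsection \<open>Existence of entropy densities\<close>

lemma shift_measurable [measurable]: "shift x \<in> measurable cfg_space cfg_space"
  unfolding cfg_space_def
  by (rule measurable_PiM_single') (auto simp: shift_def space_PiM intro!: measurable_component_singleton)

lemma shift_measure_preserving:
  assumes "transl_inv_measure Q"
  shows "measure_preserving_map Q (shift x)"
proof -
  have s: "sets Q = sets cfg_space" and d: "distr Q cfg_space (shift x) = Q"
    using assms by (auto simp: transl_inv_measure_def)
  have "distr Q Q (shift x) = distr Q cfg_space (shift x)" by (rule distr_cong) (auto simp: s)
  thus ?thesis unfolding measure_preserving_map_def
    using d s shift_measurable[of x] by (simp cong: measurable_cong_sets)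
qed

lemma cyl_prob_shift:
  assumes Q: "transl_inv_measure Q" and T: "finite T"
  shows "cyl_prob Q ((\<lambda>a. a + x) ` T) \<zeta> = cyl_prob Q T (shift x \<zeta>)"
proof -
  have s: "sets Q = sets cfg_space" and d: "distr Q cfg_space (shift x) = Q"
    using Q by (auto simp: transl_inv_measure_def)
  have sp: "space Q = UNIV" using sets_eq_imp_space_eq[OF s] by simp
  have m: "shift x \<in> measurable Q cfg_space" using shift_measurable[of x] s by (simp cong: measurable_cong_sets)
  have "measure Q (cyl T (shift x \<zeta>)) = measure (distr Q cfg_space (shift x)) (cyl T (shift x \<zeta>))" using d by simp
  also have "\<dots> = measure Q (shift x -` cyl T (shift x \<zeta>) \<inter> space Q)"
    by (rule measure_distr[OF m cyl_measurable[OF T]])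
  also have "shift x -` cyl T (shift x \<zeta>) \<inter> space Q = cyl ((\<lambda>a. a + x) ` T) \<zeta>"
    by (auto simp: cyl_def shift_def sp add.commute)
  finally show ?thesis by (simp add: cyl_prob_eq[OF s])
qed

lemma cyl_coord_sigma:
  assumes "finite T" "T \<subseteq> S"
  shows "cyl T \<zeta> \<in> coord_sigma S"
proof -
  interpret sigma_algebra UNIV "coord_sigma S"
    unfolding coord_sigma_def by (rule sigma_algebra_sigma_sets) auto
  show ?thesis using assms
  proof (induction T)
    case empty
    show ?case using top by (simp add: cyl_def)
  next
    case (insert x T)
    have "{\<eta>. \<eta> x = \<zeta> x} \<in> coord_sigma S"
      unfolding coord_sigma_def using insert by (intro sigma_sets.Basic) auto
    hence "{\<eta>. \<eta> x = \<zeta> x} \<inter> cyl T \<zeta> \<in> coord_sigma S" using insert by (intro Int) auto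
    moreover have "{\<eta>. \<eta> x = \<zeta> x} \<inter> cyl T \<zeta> = cyl (insert x T) \<zeta>" by (auto simp: cyl_def)
    ultimately show ?case by simp
  qed
qed

lemma rel_entropy_box_ac:
  fixes Q :: "('n::finite site \<Rightarrow> 'a::finite) measure"
  assumes "\<And>\<zeta>. cyl_prob P (box n) \<zeta> = 0 \<Longrightarrow> cyl_prob Q (box n) \<zeta> = 0"
  shows "rel_entropy_box Q P n = ereal (weights_kl (cyl_prob Q) (cyl_prob P) (box n) / vol TYPE('n) n)"
proof -
  have "rel_term (cyl_prob Q (box n) \<zeta>) (cyl_prob P (box n) \<zeta>) =
     ereal (cyl_prob Q (box n) \<zeta> * ln (cyl_prob Q (box n) \<zeta> / cyl_prob P (box n) \<zeta>))" for \<zeta>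
    using assms[of \<zeta>] by (simp add: rel_term_def zero_ereal_def)
  thus ?thesis by (simp add: rel_entropy_box_def weights_kl_def vol_def)
qed

text \<open>A pattern on \<open>T\<close> charged by \<open>Q\<close> extends to a charged pattern
  on the box, and under \<open>P\<close> the extension stays null. One infinite term makes the sum
  infinite, as no term is minus infinity.\<close>

lemma rel_entropy_box_not_ac:
  fixes Q :: "('n::finite site \<Rightarrow> 'a::finite) measure"
  assumes Q: "prob_space Q" "sets Q = sets cfg_space" and P: "prob_space P" "sets P = sets cfg_space"
    and T: "T \<subseteq> box n" and z: "cyl_prob P T \<zeta> = 0" "cyl_prob Q T \<zeta> \<noteq> 0"
  shows "rel_entropy_box Q P n = \<infinity>"
proof -
  note q = cyl_prob_consistent[OF Q] and p = cyl_prob_consistent[OF P]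
  have fT: "finite T" using T finite_box by (rule finite_subset)
  have U: "T \<union> (box n - T) = box n" using T by auto
  have "(\<Sum>t\<in>cfgs (box n - T). cyl_prob Q (box n) (glue T \<zeta> t)) \<noteq> 0"
    using weights_marginal[OF q fT, of "box n - T" \<zeta>, unfolded U] z by auto
  then obtain t where t: "cyl_prob Q (box n) (glue T \<zeta> t) \<noteq> 0" by (meson sum.neutral)
  define \<xi> where "\<xi> = restrict (glue T \<zeta> t) (box n)"
  have 1: "cyl_prob Q (box n) \<xi> \<noteq> 0"
    using t local_onD[OF weights_local[OF q], of "box n" \<xi> "glue T \<zeta> t"] by (simp add: \<xi>_def)
  have "cyl_prob P (box n) \<xi> \<le> cyl_prob P T \<xi>" using T by (intro weights_antimono[OF p]) auto
  also have "\<dots> = cyl_prob P T \<zeta>"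
    using T by (intro local_onD[OF weights_local[OF p]]) (auto simp: \<xi>_def glue_def)
  finally have 2: "cyl_prob P (box n) \<xi> = 0" using z weights_nonneg[OF p, of "box n" \<xi>] by simp
  have "(\<Sum>\<zeta>\<in>cfgs (box n). rel_term (cyl_prob Q (box n) \<zeta>) (cyl_prob P (box n) \<zeta>)) = \<infinity>"
    unfolding sum_Pinfty
  proof (intro conjI bexI)
    show "\<xi> \<in> cfgs (box n)" unfolding \<xi>_def by (rule restrict_in_cfgs)
    show "rel_term (cyl_prob Q (box n) \<xi>) (cyl_prob P (box n) \<xi>) = \<infinity>" using 1 2 by (simp add: rel_term_def)
  qed simp
  thus ?thesis using card_box_pos[of n, where 'n='n] by (auto simp: rel_entropy_box_def card_gt_0_iff)
qed

lemma rel_entropy_box_not_ac_tendsto: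
  fixes Q :: "('n::finite site \<Rightarrow> 'a::finite) measure"
  assumes Q: "prob_space Q" "sets Q = sets cfg_space" and P: "prob_space P" "sets P = sets cfg_space"
    and T: "finite T" and z: "cyl_prob P T \<zeta> = 0" "cyl_prob Q T \<zeta> \<noteq> 0"
  shows "rel_entropy_box Q P \<longlonglongrightarrow> \<infinity>"
proof -
  obtain m where m: "T \<subseteq> box m" using finite_subset_box[OF T] by auto
  have "\<forall>\<^sub>F n in sequentially. rel_entropy_box Q P n = \<infinity>"
    using eventually_ge_at_top[of m]
    by eventually_elim (use m box_mono in \<open>blast intro: rel_entropy_box_not_ac[OF Q P _ z]\<close>)
  thus ?thesis by (rule tendsto_eventually)
qed

text \<open>If absolute continuity fails somewhere, the box terms are eventually infinite. Otherwise
  the upper decoupling bound is the near-factorisation of the reference weights required by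
  \<open>weights_kl_superadditive\<close>, with loss \<open>c m\<close> and corridor
  \<open>g m\<close>.\<close>

lemma rel_entropy_box_convergent:
  fixes Q :: "('n::finite site \<Rightarrow> 'a::finite) measure"
  assumes Q: "prob_space Q" "transl_inv_measure Q" and P: "prob_space P" "asymptotically_decoupled P"
  shows "convergent (rel_entropy_box Q P)"
proof -
  have tP: "transl_inv_measure P" using P by (simp add: asymptotically_decoupled_def)
  have sQ: "sets Q = sets cfg_space" and sP: "sets P = sets cfg_space"
    using Q tP by (auto simp: transl_inv_measure_def)
  note q = cyl_prob_consistent[OF Q(1) sQ] and p = cyl_prob_consistent[OF P(1) sP]
  show ?thesis
  proof (cases "\<forall>T \<zeta>. finite T \<longrightarrow> cyl_prob P T \<zeta> = 0 \<longrightarrow> cyl_prob Q T \<zeta> = 0")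
    case False
    then obtain T \<zeta> where "finite T" "cyl_prob P T \<zeta> = 0" "cyl_prob Q T \<zeta> \<noteq> 0" by blast
    from rel_entropy_box_not_ac_tendsto[OF Q(1) sQ P(1) sP this] show ?thesis by (auto simp: convergent_def)
  next
    case True
    hence ac: "\<And>T \<zeta>. finite T \<Longrightarrow> cyl_prob P T \<zeta> = 0 \<Longrightarrow> cyl_prob Q T \<zeta> = 0" by blast
    obtain g :: "nat \<Rightarrow> nat" and c where c: "(\<lambda>n. c n / real (card (box n :: 'n site set))) \<longlonglongrightarrow> 0"
      and g: "(\<lambda>n. real (g n) / real n) \<longlonglongrightarrow> 0"
      and dec: "\<And>n A B. A \<in> coord_sigma (box n) \<Longrightarrow> B \<in> coord_sigma (- box (n + g n)) \<Longrightarrow>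
           measure P A * measure P B \<noteq> 0 \<Longrightarrow> measure P (A \<inter> B) / (measure P A * measure P B) \<le> exp (c n)"
      using P(2) unfolding asymptotically_decoupled_def by blast
    let ?H = "weights_kl (cyl_prob Q) (cyl_prob P)"
    have "convergent (\<lambda>n. ereal (?H (box n) / vol TYPE('n) n))"
    proof (rule box_superadditive_convergent[where g=g and c=c])
      show "?H T \<le> ?H D"
        if "finite D" "T \<subseteq> D" for T D using weights_kl_mono[OF q p ac] that by blast
      show "?H {} = 0"
        by (simp add: weights_kl_def weights_empty[OF q] weights_empty[OF p])
      show "?H ((\<lambda>a. a + x) ` T) = ?H T"
        if "finite T" for T x
        using that by (intro weights_kl_shift[OF q p ac]) (auto intro: cyl_prob_shift[OF Q(2)] cyl_prob_shift[OF tP])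
      show "(\<lambda>n. c n / vol TYPE('n) n) \<longlonglongrightarrow> 0" using c by (simp add: vol_def)
      show "(\<lambda>n. real (g n) / real n) \<longlonglongrightarrow> 0" by fact
      fix m and D :: "'n site set" assume D: "finite D" "D \<inter> box (m + g m) = {}"
      show "?H (box m) + ?H D - c m
          \<le> ?H (box m \<union> D)"
      proof (rule weights_kl_superadditive[OF q p ac])
        show "box m \<inter> D = {}" using D box_mono[of m "m + g m"] by auto
        fix \<zeta> :: "'n site \<Rightarrow> 'a"
        have cap: "cyl (box m \<union> D) \<zeta> = cyl (box m) \<zeta> \<inter> cyl D \<zeta>" by (auto simp: cyl_def)
        show "cyl_prob P (box m \<union> D) \<zeta> \<le> exp (c m) * (cyl_prob P (box m) \<zeta> * cyl_prob P D \<zeta>)"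
        \<comment> \<open>Decoupling speaks only about events of positive probability. If a factor
          is 0, the cylinder on the union is null by monotonicity.\<close>
        proof (cases "cyl_prob P (box m) \<zeta> * cyl_prob P D \<zeta> = 0")
          case True
          thus ?thesis using weights_antimono[OF p, of "box m \<union> D" "box m" \<zeta>]
            weights_antimono[OF p, of "box m \<union> D" "D" \<zeta>] D by auto
        next
          case False
          hence pos: "0 < cyl_prob P (box m) \<zeta> * cyl_prob P D \<zeta>"
            using weights_nonneg[OF p] by (metis less_eq_real_def mult_nonneg_nonneg)
          have "cyl_prob P (box m \<union> D) \<zeta> / (cyl_prob P (box m) \<zeta> * cyl_prob P D \<zeta>) \<le> exp (c m)"
            using dec[OF cyl_coord_sigma[OF finite_box order_refl], OF cyl_coord_sigma, of D m \<zeta> \<zeta>] D False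
            by (auto simp: cyl_prob_eq[OF sP] cap)
          thus ?thesis using pos by (simp add: pos_divide_le_eq)
        qed
      qed (use D in auto)
    qed
    moreover have "rel_entropy_box Q P = (\<lambda>n. ereal (?H (box n) / vol TYPE('n) n))"
      by (intro ext rel_entropy_box_ac ac) auto
    ultimately show ?thesis by simp
  qed
qed

definition box_entropy :: "('n::finite site \<Rightarrow> 'a::finite) measure \<Rightarrow> nat \<Rightarrow> real" where
  "box_entropy Q n = - (\<Sum>\<zeta>\<in>cfgs (box n). cyl_prob Q (box n) \<zeta> * ln (cyl_prob Q (box n) \<zeta>))"

text \<open>The entropy is \<open>ln CARD('a)\<close> per site minus the relative entropy with respect to uniform
  weights, so the superadditivity argument applies with no corridor.\<close>

lemma box_entropy_tendsto:
  fixes Q :: "('n::finite site \<Rightarrow> 'a::finite) measure"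
  assumes Q: "prob_space Q" "transl_inv_measure Q"
  shows "(\<lambda>n. box_entropy Q n / vol TYPE('n) n) \<longlonglongrightarrow> ks_entropy Q"
proof -
  have sQ: "sets Q = sets cfg_space" using Q by (auto simp: transl_inv_measure_def)
  note q = cyl_prob_consistent[OF Q(1) sQ]
  define p where "p = (\<lambda>(T :: 'n site set) (\<zeta> :: 'n site \<Rightarrow> 'a). (1 / real CARD('a)) ^ card T)"
  have p: "consistent_weights p" unfolding p_def by (rule uniform_consistent)
  have pp: "0 < p T \<zeta>" for T \<zeta> by (simp add: p_def)
  hence ac: "cyl_prob Q T \<zeta> = 0" if "p T \<zeta> = 0" for T \<zeta> using that by (metis less_irrefl)
  let ?H = "weights_kl (cyl_prob Q) p"
  have "convergent (\<lambda>n. ereal (?H (box n) / vol TYPE('n) n))"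
  proof (rule box_superadditive_convergent[where g="\<lambda>_. 0" and c="\<lambda>_. 0"])
    show "?H T \<le> ?H D"
      if "finite D" "T \<subseteq> D" for T D using weights_kl_mono[OF q p ac] that by blast
    show "?H {} = 0"
      by (simp add: weights_kl_def weights_empty[OF q] weights_empty[OF p])
    show "?H ((\<lambda>a. a + x) ` T) = ?H T"
      if "finite T" for T x
      using that by (intro weights_kl_shift[OF q p ac]) (auto intro: cyl_prob_shift[OF Q(2)] simp: p_def card_image)
    fix m and D :: "'n site set" assume D: "finite D" "D \<inter> box (m + 0) = {}"
    show "?H (box m) + ?H D - 0
        \<le> ?H (box m \<union> D)"
      using D by (intro weights_kl_superadditive[OF q p ac]) (auto simp: p_def card_Un_disjoint power_add Int_commute)
  qed auto
  then obtain L where L: "(\<lambda>n. ereal (?H (box n) / vol TYPE('n) n)) \<longlonglongrightarrow> L"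
    by (auto simp: convergent_def)
  have eq: "?H (box n) = vol TYPE('n) n * ln (real CARD('a)) - box_entropy Q n" for n
  proof -
    have "?H (box n) =
      (\<Sum>\<zeta>\<in>cfgs (box n). cyl_prob Q (box n) \<zeta> * ln (cyl_prob Q (box n) \<zeta>) +
          cyl_prob Q (box n) \<zeta> * (vol TYPE('n) n * ln (real CARD('a))))"
      unfolding weights_kl_def
    proof (rule sum.cong[OF refl])
      fix \<zeta> :: "'n site \<Rightarrow> 'a"
      show "cyl_prob Q (box n) \<zeta> * ln (cyl_prob Q (box n) \<zeta> / p (box n) \<zeta>) =
        cyl_prob Q (box n) \<zeta> * ln (cyl_prob Q (box n) \<zeta>) + cyl_prob Q (box n) \<zeta> * (vol TYPE('n) n * ln (real CARD('a)))"
      proof (cases "cyl_prob Q (box n) \<zeta> = 0")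
        case False
        hence "0 < cyl_prob Q (box n) \<zeta>" using weights_nonneg[OF q] by (metis less_eq_real_def)
        hence "ln (cyl_prob Q (box n) \<zeta> / p (box n) \<zeta>) = ln (cyl_prob Q (box n) \<zeta>) + vol TYPE('n) n * ln (real CARD('a))"
          using pp[of "box n" \<zeta>] by (simp add: ln_div) (simp add: p_def power_divide ln_div ln_realpow vol_def)
        thus ?thesis by (simp add: distrib_left)
      qed simp
    qed
    also have "\<dots> = vol TYPE('n) n * ln (real CARD('a)) - box_entropy Q n"
      by (simp add: sum.distrib sum_distrib_right[symmetric] weights_sum[OF q] box_entropy_def)
    finally show ?thesis .
  qed
  have "0 \<le> box_entropy Q n" for n
  proof -
    have "cyl_prob Q (box n) \<zeta> * ln (cyl_prob Q (box n) \<zeta>) \<le> 0" for \<zeta>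
    proof (cases "cyl_prob Q (box n) \<zeta> = 0")
      case False
      interpret prob_space Q by fact
      have "cyl_prob Q (box n) \<zeta> \<le> 1" by (simp add: cyl_prob_def)
      moreover have "0 < cyl_prob Q (box n) \<zeta>" using False weights_nonneg[OF q] by (metis less_eq_real_def)
      ultimately show ?thesis by (intro mult_nonneg_nonpos) (auto simp: ln_le_zero_iff)
    qed simp
    thus ?thesis unfolding box_entropy_def by (simp add: sum_nonpos)
  qed
  hence up: "?H (box n) / vol TYPE('n) n \<le> ln (real CARD('a))" for n
    unfolding eq by (simp add: diff_divide_distrib less_imp_le)
  have low: "0 \<le> ?H (box n) / vol TYPE('n) n" for n
    using weights_kl_mono[OF q p ac, of "box n" "{}"]
    by (simp add: weights_kl_def weights_empty[OF q] weights_empty[OF p] less_imp_le)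
  \<comment> \<open>Nonnegativity of Shannon entropy and of relative entropy confine the limit to a
    bounded interval, so the extended limit is a real number.\<close>
  have "L \<le> ereal (ln (real CARD('a)))" using up by (intro LIMSEQ_le_const2[OF L]) auto
  moreover have "ereal 0 \<le> L" using low by (intro LIMSEQ_le_const[OF L]) auto
  ultimately obtain l where l: "L = ereal l" by (cases L) auto
  have "(\<lambda>n. ?H (box n) / vol TYPE('n) n) \<longlonglongrightarrow> l" using L l by simp
  hence "(\<lambda>n. ln (real CARD('a)) - ?H (box n) / vol TYPE('n) n) \<longlonglongrightarrow> ln (real CARD('a)) - l"
    by (intro tendsto_intros)
  hence t: "(\<lambda>n. box_entropy Q n / vol TYPE('n) n) \<longlonglongrightarrow> ln (real CARD('a)) - l"
    unfolding eq by (simp add: diff_divide_distrib)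
  moreover have "ks_entropy Q = lim (\<lambda>n. box_entropy Q n / vol TYPE('n) n)"
    by (simp add: ks_entropy_def box_entropy_def vol_def)
  ultimately show ?thesis by (simp add: limI)
qed

subsection \<open>Finite-range potentials\<close>

text \<open>Quantitative form of the hypotheses on the potential: \<open>R\<close> controls
  coordinate differences within an interacting set, and \<open>b\<close> is a uniform bound that
  exists by translation invariance over finite alphabets. The empty set meets no volume and never
  enters a Hamiltonian.\<close>

locale range_potential =
  fixes \<Phi> :: "'n::finite site set \<Rightarrow> ('n site \<Rightarrow> 'e::finite \<times> 'd::finite) \<Rightarrow> real"
    and R :: nat and b :: real
  assumes pot_local: "\<And>A. finite A \<Longrightarrow> local_on A (\<Phi> A)"
    and pot_range: "\<And>A x y \<xi>. finite A \<Longrightarrow> x \<in> A \<Longrightarrow> y \<in> A \<Longrightarrow> y - x \<notin> box R \<Longrightarrow> \<Phi> A \<xi> = 0"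
    and pot_bound: "\<And>A \<xi>. finite A \<Longrightarrow> A \<noteq> {} \<Longrightarrow> \<bar>\<Phi> A \<xi>\<bar> \<le> b"
    and pot_shift: "\<And>A x \<xi>. finite A \<Longrightarrow> \<Phi> ((\<lambda>a. a + x) ` A) \<xi> = \<Phi> A (shift x \<xi>)"
begin

text \<open>Restricting to admissible diameter makes the family finite for finite \<open>T\<close>;
  the finite sets left out carry zero interaction.\<close>

definition touching :: "'n site set \<Rightarrow> 'n site set set" where
  "touching T = {A. A \<inter> T \<noteq> {} \<and> (\<forall>x\<in>A. \<forall>y\<in>A. y - x \<in> box R)}"

definition inner_sets :: "'n site set \<Rightarrow> 'n site set set" where
  "inner_sets T = {A \<in> touching T. A \<subseteq> T}"

definition edge_sets :: "'n site set \<Rightarrow> 'n site set set" where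
  "edge_sets T = {A \<in> touching T. \<not> A \<subseteq> T}"

definition edge_bound :: "'n site set \<Rightarrow> real" where
  "edge_bound T = b * real (card (edge_sets T))"

text \<open>Energy with free boundary: sets leaving \<open>T\<close> are ignored, so, unlike the
  Hamiltonian, it reads the configuration only inside \<open>T\<close>.\<close>

definition free_energy :: "'n site set \<Rightarrow> ('n site \<Rightarrow> 'e \<times> 'd) \<Rightarrow> real" where
  "free_energy T \<xi> = (\<Sum>A\<in>inner_sets T. \<Phi> A \<xi>)"

definition free_partition :: "'n site set \<Rightarrow> ('n site \<Rightarrow> 'd) \<Rightarrow> real" where
  "free_partition T \<eta> = (\<Sum>s\<in>cfgs T. exp (- free_energy T (\<lambda>x. (s x, \<eta> x))))"

lemma b_nonneg: "0 \<le> b"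
  using pot_bound[of "{0}" undefined] by simp

lemma touching_finite_member: "A \<in> touching T \<Longrightarrow> finite A"
proof -
  assume A: "A \<in> touching T"
  then obtain x where x: "x \<in> A" by (auto simp: touching_def)
  have "A \<subseteq> (\<lambda>a. a + x) ` box R"
  proof
    fix y assume "y \<in> A"
    hence "y - x \<in> box R" using A x by (simp add: touching_def)
    thus "y \<in> (\<lambda>a. a + x) ` box R" by (intro image_eqI[of _ _ "y - x"]) auto
  qed
  thus ?thesis by (rule finite_subset) simp
qed

lemma touching_nonempty: "A \<in> touching T \<Longrightarrow> A \<noteq> {}"
  by (auto simp: touching_def)

lemma touching_UN: "touching T = (\<Union>x\<in>T. touching {x})"
  by (auto simp: touching_def)

lemma finite_touching:
  assumes "finite T"
  shows "finite (touching T)"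
proof -
  have "touching {x} \<subseteq> Pow ((\<lambda>a. a + x) ` box R)" for x
  proof
    fix A assume A: "A \<in> touching {x}"
    have "y \<in> (\<lambda>a. a + x) ` box R" if "y \<in> A" for y
      using A that by (intro image_eqI[of _ _ "y - x"]) (auto simp: touching_def)
    thus "A \<in> Pow ((\<lambda>a. a + x) ` box R)" by blast
  qed
  hence "finite (touching {x})" for x by (rule finite_subset) simp
  thus ?thesis using assms by (subst touching_UN) auto
qed

lemma inj_translate: "inj (\<lambda>A :: 'n site set. (\<lambda>a. a + x) ` A)"
proof (rule injI)
  fix A B :: "'n site set" assume "(\<lambda>a. a + x) ` A = (\<lambda>a. a + x) ` B"
  moreover have "inj (\<lambda>a :: 'n site. a + x)" by (auto intro: injI)
  ultimately show "A = B" by (simp add: inj_image_eq_iff)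
qed

lemma touching_translate_subset:
  "(\<lambda>A. (\<lambda>a. a + x) ` A) ` touching T \<subseteq> touching ((\<lambda>a. a + x) ` T)"
  by (auto simp: touching_def)

lemma translate_back: "(\<lambda>a. a + x) ` (\<lambda>a. a + (- x)) ` A = (A :: 'n site set)"
  "(\<lambda>a. a + (- x)) ` (\<lambda>a. a + x) ` A = (A :: 'n site set)"
  by (simp_all add: image_image)

lemma translate_subset_iff: "(\<lambda>a. a + x) ` A \<subseteq> (\<lambda>a. a + x) ` B \<longleftrightarrow> A \<subseteq> (B :: 'n site set)"
  by (rule inj_image_subset_iff) (auto intro: injI)

lemma touching_translate:
  "touching ((\<lambda>a. a + x) ` T) = (\<lambda>A. (\<lambda>a. a + x) ` A) ` touching T"
proof (intro equalityI touching_translate_subset subsetI)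
  fix A assume "A \<in> touching ((\<lambda>a. a + x) ` T)"
  hence "(\<lambda>a. a + (- x)) ` A \<in> touching ((\<lambda>a. a + (- x)) ` (\<lambda>a. a + x) ` T)"
    using touching_translate_subset[of "- x" "(\<lambda>a. a + x) ` T"] by blast
  hence "(\<lambda>a. a + (- x)) ` A \<in> touching T" unfolding translate_back .
  thus "A \<in> (\<lambda>A. (\<lambda>a. a + x) ` A) ` touching T" using translate_back(1)[of x A] by (metis imageI)
qed

lemma inner_translate: "inner_sets ((\<lambda>a. a + x) ` T) = (\<lambda>A. (\<lambda>a. a + x) ` A) ` inner_sets T"
  unfolding inner_sets_def touching_translate by (auto simp: translate_subset_iff)

lemma edge_translate: "edge_sets ((\<lambda>a. a + x) ` T) = (\<lambda>A. (\<lambda>a. a + x) ` A) ` edge_sets T"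
  unfolding edge_sets_def touching_translate by (auto simp: translate_subset_iff)

lemma edge_bound_translate: "edge_bound ((\<lambda>a. a + x) ` T) = edge_bound T"
  unfolding edge_bound_def edge_translate by (simp add: card_image inj_on_subset[OF inj_translate])

lemma card_touching_le:
  assumes "finite T"
  shows "card (touching T) \<le> card (touching {0}) * card T"
proof -
  have eq: "card (touching {x}) = card (touching {0})" for x
    using touching_translate[of x "{0}"] by (simp add: card_image inj_on_subset[OF inj_translate])
  have "card (\<Union>x\<in>T. touching {x}) \<le> (\<Sum>x\<in>T. card (touching {x}))"
    by (rule card_UN_le[OF assms])
  also have "\<dots> = (\<Sum>x\<in>T. card (touching {0}))" by (rule sum.cong[OF refl eq])
  finally have "card (\<Union>x\<in>T. touching {x}) \<le> (\<Sum>x\<in>T. card (touching {0}))" .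
  thus ?thesis by (subst touching_UN) (simp add: mult.commute)
qed

lemma finite_inner [simp]: "finite T \<Longrightarrow> finite (inner_sets T)"
  and finite_edge [simp]: "finite T \<Longrightarrow> finite (edge_sets T)"
  using finite_touching by (auto simp: inner_sets_def edge_sets_def)

lemma sum_pot_bound:
  assumes "S \<subseteq> touching T" "finite T"
  shows "\<bar>\<Sum>A\<in>S. \<Phi> A \<xi>\<bar> \<le> b * real (card S)"
proof -
  have "\<bar>\<Sum>A\<in>S. \<Phi> A \<xi>\<bar> \<le> (\<Sum>A\<in>S. \<bar>\<Phi> A \<xi>\<bar>)" by (rule sum_abs)
  also have "\<dots> \<le> (\<Sum>A\<in>S. b)"
    using assms touching_finite_member touching_nonempty by (intro sum_mono pot_bound) blast+
  finally show ?thesis by (simp add: mult.commute)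
qed

text \<open>Bound for the interactions through a single site; times \<open>card T\<close> it
  controls both the free energy and the boundary term of \<open>T\<close>.\<close>

definition site_const :: real where
  "site_const = b * real (card (touching {0}))"

lemma sum_pot_bound_card:
  assumes "S \<subseteq> touching T" "finite T"
  shows "b * real (card S) \<le> site_const * real (card T)"
proof -
  have "card S \<le> card (touching {0}) * card T"
    using card_touching_le[OF assms(2)] card_mono[OF finite_touching[OF assms(2)] assms(1)] by simp
  hence "real (card S) \<le> real (card (touching {0}) * card T)" by (rule of_nat_mono)
  hence "b * real (card S) \<le> b * real (card (touching {0}) * card T)" using b_nonneg by (rule mult_left_mono)
  thus ?thesis by (simp add: site_const_def mult.assoc)
qed

lemma edge_bound_card: "finite T \<Longrightarrow> edge_bound T \<le> site_const * real (card T)"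
  unfolding edge_bound_def by (rule sum_pot_bound_card) (auto simp: edge_sets_def)

lemma edge_bound_nonneg: "0 \<le> edge_bound T"
  by (simp add: edge_bound_def b_nonneg)

lemma free_energy_abs_le:
  assumes "finite T"
  shows "\<bar>free_energy T \<xi>\<bar> \<le> site_const * real (card T)"
proof -
  have s: "inner_sets T \<subseteq> touching T" by (auto simp: inner_sets_def)
  show ?thesis unfolding free_energy_def
    using sum_pot_bound[OF s assms, of \<xi>] sum_pot_bound_card[OF s assms] by simp
qed

lemma sum_pot_local:
  assumes "\<And>A. A \<in> S \<Longrightarrow> finite A \<and> A \<subseteq> T"
  shows "local_on T (\<lambda>\<xi>. \<Sum>A\<in>S. \<Phi> A \<xi>)"
  unfolding local_on_def
proof (intro allI impI sum.cong refl)
  fix \<xi> \<xi>' :: "'n site \<Rightarrow> 'e \<times> 'd" and A assume "\<forall>x\<in>T. \<xi> x = \<xi>' x" "A \<in> S"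
  thus "\<Phi> A \<xi> = \<Phi> A \<xi>'" using assms by (intro local_onD[OF pot_local]) blast+
qed

lemma free_energy_local: "local_on T (free_energy T)"
  unfolding free_energy_def[abs_def]
  by (rule sum_pot_local) (auto simp: inner_sets_def dest: touching_finite_member)

lemma free_energy_shift:
  "free_energy ((\<lambda>a. a + x) ` T) \<xi> = free_energy T (shift x \<xi>)"
  unfolding free_energy_def inner_translate
proof (subst sum.reindex[OF inj_on_subset[OF inj_translate subset_UNIV]], rule sum.cong[OF refl])
  fix A assume "A \<in> inner_sets T"
  hence "finite A" by (auto simp: inner_sets_def dest: touching_finite_member)
  thus "((\<lambda>A. \<Phi> A \<xi>) \<circ> (\<lambda>A. (\<lambda>a. a + x) ` A)) A = \<Phi> A (shift x \<xi>)" by (simp add: pot_shift)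
qed

text \<open>A set inside the union but inside neither part crosses the boundary of \<open>T\<close>.
  The bound involves \<open>T\<close> alone, however large \<open>D\<close> is, so tiles can be
  added to a growing region at a fixed cost each.\<close>

lemma free_energy_Un:
  assumes "finite T" "finite D" "T \<inter> D = {}"
  shows "\<bar>free_energy (T \<union> D) \<xi> - (free_energy T \<xi> + free_energy D \<xi>)\<bar> \<le> edge_bound T"
proof -
  define S where "S = inner_sets (T \<union> D) - (inner_sets T \<union> inner_sets D)"
  have sub: "inner_sets T \<union> inner_sets D \<subseteq> inner_sets (T \<union> D)"
    by (auto simp: inner_sets_def touching_def)
  have dis: "inner_sets T \<inter> inner_sets D = {}"
    using assms(3) by (fastforce simp: inner_sets_def touching_def)
  have SE: "S \<subseteq> edge_sets T"
    using assms(3) by (auto simp: S_def inner_sets_def edge_sets_def touching_def)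
  have "free_energy (T \<union> D) \<xi> = (\<Sum>A\<in>S. \<Phi> A \<xi>) + (\<Sum>A\<in>inner_sets T \<union> inner_sets D. \<Phi> A \<xi>)"
    unfolding free_energy_def S_def using assms by (intro sum.subset_diff[OF sub]) auto
  also have "(\<Sum>A\<in>inner_sets T \<union> inner_sets D. \<Phi> A \<xi>) = free_energy T \<xi> + free_energy D \<xi>"
    unfolding free_energy_def using assms dis by (intro sum.union_disjoint) auto
  finally have eq: "free_energy (T \<union> D) \<xi> - (free_energy T \<xi> + free_energy D \<xi>) = (\<Sum>A\<in>S. \<Phi> A \<xi>)" by simp
  have "\<bar>\<Sum>A\<in>S. \<Phi> A \<xi>\<bar> \<le> b * real (card S)"
    using SE assms by (intro sum_pot_bound[of _ T]) (auto simp: edge_sets_def)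
  also have "\<dots> \<le> edge_bound T"
    unfolding edge_bound_def using SE assms b_nonneg by (intro mult_left_mono of_nat_mono card_mono) auto
  finally show ?thesis unfolding eq .
qed

text \<open>Finite range makes all terms outside \<open>touching \<Lambda>\<close> vanish, so the
  infinite sum is a finite one.\<close>

lemma hamiltonian_eq_sum:
  assumes "finite \<Lambda>"
  shows "hamiltonian \<Phi> \<Lambda> \<xi> = (\<Sum>A\<in>touching \<Lambda>. \<Phi> A \<xi>)"
proof -
  have "hamiltonian \<Phi> \<Lambda> \<xi> = infsum (\<lambda>A. \<Phi> A \<xi>) (touching \<Lambda>)"
    unfolding hamiltonian_def
  proof (rule infsum_cong_neutral)
    fix A assume A: "A \<in> {A. finite A \<and> A \<inter> \<Lambda> \<noteq> {}} - touching \<Lambda>"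
    then obtain x y where "x \<in> A" "y \<in> A" "y - x \<notin> box R" by (auto simp: touching_def)
    thus "\<Phi> A \<xi> = 0" using A by (intro pot_range[of A x y]) auto
  next
    fix A assume A: "A \<in> touching \<Lambda> - {A. finite A \<and> A \<inter> \<Lambda> \<noteq> {}}"
    thus "\<Phi> A \<xi> = 0" using touching_finite_member by (auto simp: touching_def)
  qed auto
  thus ?thesis using finite_touching[OF assms] by simp
qed

text \<open>The part of the Hamiltonian that does not see \<open>T\<close>. It is common to all
  patterns on \<open>T\<close> and will cancel from Gibbs probabilities.\<close>

definition rest_energy :: "'n site set \<Rightarrow> 'n site set \<Rightarrow> ('n site \<Rightarrow> 'e \<times> 'd) \<Rightarrow> real" where
  "rest_energy \<Lambda> T \<xi> = (\<Sum>A\<in>{A \<in> touching \<Lambda>. A \<inter> T = {}}. \<Phi> A \<xi>)"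

lemma rest_energy_local: "local_on (- T) (rest_energy \<Lambda> T)"
  unfolding rest_energy_def[abs_def]
  by (rule sum_pot_local) (auto dest: touching_finite_member)

text \<open>A set touching \<open>\<Lambda>\<close> lies inside \<open>T\<close>, misses
  \<open>T\<close>, or crosses its boundary; only the last kind enters the error.\<close>

lemma hamiltonian_split:
  assumes "finite \<Lambda>" "T \<subseteq> \<Lambda>"
  shows "\<bar>hamiltonian \<Phi> \<Lambda> \<xi> - (free_energy T \<xi> + rest_energy \<Lambda> T \<xi>)\<bar> \<le> edge_bound T"
proof -
  have fT: "finite T" using assms(2,1) by (rule finite_subset)
  have split: "touching \<Lambda> = (inner_sets T \<union> {A \<in> touching \<Lambda>. A \<inter> T = {}}) \<union> edge_sets T"
    using assms(2) unfolding inner_sets_def edge_sets_def touching_def by blast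
  have "hamiltonian \<Phi> \<Lambda> \<xi> = (\<Sum>A\<in>inner_sets T \<union> {A \<in> touching \<Lambda>. A \<inter> T = {}}. \<Phi> A \<xi>) + (\<Sum>A\<in>edge_sets T. \<Phi> A \<xi>)"
    unfolding hamiltonian_eq_sum[OF assms(1)]
  proof (subst split, rule sum.union_disjoint)
    show "(inner_sets T \<union> {A \<in> touching \<Lambda>. A \<inter> T = {}}) \<inter> edge_sets T = {}"
      unfolding inner_sets_def edge_sets_def touching_def by blast
  qed (use fT finite_touching[OF assms(1)] in auto)
  also have "(\<Sum>A\<in>inner_sets T \<union> {A \<in> touching \<Lambda>. A \<inter> T = {}}. \<Phi> A \<xi>) = free_energy T \<xi> + rest_energy \<Lambda> T \<xi>"
    unfolding free_energy_def rest_energy_def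
  proof (rule sum.union_disjoint)
    show "inner_sets T \<inter> {A \<in> touching \<Lambda>. A \<inter> T = {}} = {}"
      unfolding inner_sets_def touching_def by blast
  qed (use fT finite_touching[OF assms(1)] in auto)
  finally show ?thesis
    using sum_pot_bound[of "edge_sets T" T \<xi>] fT by (simp add: edge_bound_def edge_sets_def)
qed

end

section \<open>Free partition functions and their near-additivity\<close>

lemma sum_exp_close:
  fixes a a' :: "'i \<Rightarrow> real"
  assumes "\<And>i. i \<in> I \<Longrightarrow> \<bar>a i - a' i\<bar> \<le> w"
  shows "(\<Sum>i\<in>I. exp (- a i)) \<le> exp w * (\<Sum>i\<in>I. exp (- a' i))"
proof -
  have "(\<Sum>i\<in>I. exp (- a i)) \<le> (\<Sum>i\<in>I. exp (w - a' i))"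
  proof (rule sum_mono)
    fix i assume "i \<in> I"
    from assms[OF this] show "exp (- a i) \<le> exp (w - a' i)" by simp
  qed
  also have "\<dots> = exp w * (\<Sum>i\<in>I. exp (- a' i))" by (simp add: sum_distrib_left exp_diff exp_minus divide_inverse)
  finally show ?thesis .
qed

text \<open>The logarithm of a sum of exponentials is 1-Lipschitz in the supremum norm of the
  exponents, so energy estimates become pressure estimates with the same constant.\<close>

lemma ln_sum_exp_close:
  fixes a a' :: "'i \<Rightarrow> real"
  assumes "finite I" "I \<noteq> {}" and w: "\<And>i. i \<in> I \<Longrightarrow> \<bar>a i - a' i\<bar> \<le> w"
  shows "\<bar>ln (\<Sum>i\<in>I. exp (- a i)) - ln (\<Sum>i\<in>I. exp (- a' i))\<bar> \<le> w"
proof -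
  let ?x = "\<Sum>i\<in>I. exp (- a i)" and ?y = "\<Sum>i\<in>I. exp (- a' i)"
  have pos: "0 < ?x" "0 < ?y" using assms by (auto intro: sum_pos)
  have "?x \<le> exp w * ?y" using w by (rule sum_exp_close)
  hence "ln ?x \<le> ln (exp w * ?y)" using pos by simp
  moreover have "?y \<le> exp w * ?x" using w by (intro sum_exp_close) (simp add: abs_minus_commute)
  hence "ln ?y \<le> ln (exp w * ?x)" using pos by simp
  ultimately show ?thesis using pos by (simp add: ln_mult abs_le_iff)
qed

lemma cfgs_nonempty [simp]: "cfgs T \<noteq> {}"
  by (simp add: PiE_eq_empty_iff)

context range_potential
begin

lemma free_energy_pair_glue:
  "free_energy T (\<lambda>x. (glue T s t x, \<eta> x)) = free_energy T (\<lambda>x. (s x, \<eta> x))"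
  by (rule local_onD[OF free_energy_local]) (simp add: glue_def)

lemma free_partition_pos: "finite T \<Longrightarrow> 0 < free_partition T \<eta>"
  unfolding free_partition_def by (intro sum_pos) auto

lemma free_partition_local: "local_on T (free_partition T)"
  unfolding local_on_def free_partition_def
  by (intro allI impI sum.cong refl arg_cong[where f=exp] arg_cong[where f=uminus]
      local_onD[OF free_energy_local]) simp

text \<open>Comparison with zero energy, for which the sum counts the
  \<open>CARD('e) ^ card T\<close> spin patterns.\<close>

lemma ln_free_partition_abs_le:
  assumes "finite T"
  shows "\<bar>ln (free_partition T \<eta>)\<bar> \<le> (site_const + ln (real CARD('e))) * real (card T)"
proof -
  have "\<bar>ln (free_partition T \<eta>) - ln (\<Sum>s\<in>(cfgs T :: ('n site \<Rightarrow> 'e) set). exp (- 0))\<bar> \<le> site_const * real (card T)"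
    unfolding free_partition_def
    by (rule ln_sum_exp_close) (use assms free_energy_abs_le in auto)
  moreover have "ln (\<Sum>s\<in>(cfgs T :: ('n site \<Rightarrow> 'e) set). exp (- 0)) = real (card T) * ln (real CARD('e))"
    using assms by (simp add: card_PiE ln_realpow)
  moreover have "0 \<le> real (card T) * ln (real CARD('e))" by (simp add: Suc_leI)
  ultimately show ?thesis unfolding distrib_right mult.commute[of "ln (real CARD('e))"] by linarith
qed

text \<open>Without interactions across the boundary of \<open>T\<close> the sum over glued patterns
  factorises. As for energies, the cost depends on \<open>T\<close> only.\<close>

lemma ln_free_partition_Un:
  assumes fin: "finite T" "finite D" and dis: "T \<inter> D = {}"
  shows "\<bar>ln (free_partition (T \<union> D) \<eta>) - (ln (free_partition T \<eta>) + ln (free_partition D \<eta>))\<bar> \<le> edge_bound T"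
proof -
  define a where "a st = free_energy (T \<union> D) (\<lambda>x. (glue T (fst st) (snd st) x, \<eta> x))" for st
  define a' where "a' st = free_energy T (\<lambda>x. (fst st x, \<eta> x)) + free_energy D (\<lambda>x. (snd st x, \<eta> x))"
    for st :: "('n site \<Rightarrow> 'e) \<times> ('n site \<Rightarrow> 'e)"
  have 1: "free_partition (T \<union> D) \<eta> = (\<Sum>st\<in>cfgs T \<times> cfgs D. exp (- a st))"
    unfolding free_partition_def sum_cfgs_Un[OF dis] a_def by (simp add: sum.cartesian_product case_prod_beta)
  have 2: "free_partition T \<eta> * free_partition D \<eta> = (\<Sum>st\<in>cfgs T \<times> cfgs D. exp (- a' st))"
    unfolding free_partition_def a'_def sum_product sum.cartesian_product
    by (simp add: case_prod_beta exp_add exp_diff exp_minus field_simps)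
  have "\<bar>ln (\<Sum>st\<in>cfgs T \<times> cfgs D. exp (- a st)) - ln (\<Sum>st\<in>cfgs T \<times> cfgs D. exp (- a' st))\<bar> \<le> edge_bound T"
  proof (rule ln_sum_exp_close)
    fix st :: "('n site \<Rightarrow> 'e) \<times> ('n site \<Rightarrow> 'e)"
    have "free_energy D (\<lambda>x. (glue T (fst st) (snd st) x, \<eta> x)) = free_energy D (\<lambda>x. (snd st x, \<eta> x))"
      using dis by (intro local_onD[OF free_energy_local]) (auto simp: glue_def)
    thus "\<bar>a st - a' st\<bar> \<le> edge_bound T"
      using free_energy_Un[OF fin dis, of "\<lambda>x. (glue T (fst st) (snd st) x, \<eta> x)"]
      unfolding a_def a'_def free_energy_pair_glue by simp
  qed (use fin in auto)
  thus ?thesis unfolding 1[symmetric] 2[symmetric]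
    using free_partition_pos[OF fin(1), of \<eta>] free_partition_pos[OF fin(2), of \<eta>] by (simp add: ln_mult)
qed

text \<open>Each site of \<open>D - T\<close> costs \<open>site_const\<close> through the boundary
  of \<open>D - T\<close> and \<open>site_const + ln (real CARD('e))\<close> through the partition
  function of that region, whence the constant.\<close>

lemma ln_free_partition_growth:
  assumes "finite D" "T \<subseteq> D"
  shows "\<bar>ln (free_partition D \<eta>) - ln (free_partition T \<eta>)\<bar> \<le>
     (2 * site_const + ln (real CARD('e))) * (real (card D) - real (card T))"
proof -
  have fin: "finite T" "finite (D - T)" using finite_subset[OF assms(2,1)] assms(1) by simp_all
  have U: "(D - T) \<union> T = D" using assms by auto
  have c: "real (card (D - T)) = real (card D) - real (card T)"
    using assms fin by (simp add: card_Diff_subset card_mono of_nat_diff)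
  have "\<bar>ln (free_partition D \<eta>) - (ln (free_partition (D - T) \<eta>) + ln (free_partition T \<eta>))\<bar> \<le> edge_bound (D - T)"
    using ln_free_partition_Un[OF fin(2,1), of \<eta>, unfolded U] by blast
  moreover have "edge_bound (D - T) \<le> site_const * real (card (D - T))" by (rule edge_bound_card[OF fin(2)])
  moreover note ln_free_partition_abs_le[OF fin(2), of \<eta>]
  ultimately have "\<bar>ln (free_partition D \<eta>) - ln (free_partition T \<eta>)\<bar> \<le>
      site_const * real (card (D - T)) + (site_const + ln (real CARD('e))) * real (card (D - T))"
    by linarith
  thus ?thesis unfolding c by (simp add: algebra_simps)
qed

text \<open>The case \<open>T = \<Lambda>\<close> of the splitting, with no rest energy: the
  boundary condition acts only through crossing sets.\<close>

lemma partition_fn_close: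
  assumes "finite \<Lambda>"
  shows "\<bar>ln (partition_fn \<Phi> \<Lambda> \<sigma>b \<eta>) - ln (free_partition \<Lambda> \<eta>)\<bar> \<le> edge_bound \<Lambda>"
  unfolding partition_fn_def free_partition_def
proof (rule ln_sum_exp_close)
  fix s :: "'n site \<Rightarrow> 'e"
  have "rest_energy \<Lambda> \<Lambda> \<xi> = 0" for \<xi>
    unfolding rest_energy_def by (rule sum.neutral) (auto simp: touching_def)
  moreover have "free_energy \<Lambda> (join_cfg \<Lambda> s \<sigma>b \<eta>) = free_energy \<Lambda> (\<lambda>x. (s x, \<eta> x))"
    by (rule local_onD[OF free_energy_local]) (simp add: join_cfg_def)
  ultimately show "\<bar>hamiltonian \<Phi> \<Lambda> (join_cfg \<Lambda> s \<sigma>b \<eta>) - free_energy \<Lambda> (\<lambda>x. (s x, \<eta> x))\<bar> \<le> edge_bound \<Lambda>"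
    using hamiltonian_split[OF assms order_refl, of "join_cfg \<Lambda> s \<sigma>b \<eta>"] by simp
qed (use assms in auto)

text \<open>A crossing set has a site outside the box, so all its sites in the box lie in the shell
  between \<open>box (n - R)\<close> and \<open>box n\<close>.\<close>

lemma edge_bound_box_le:
  assumes "R \<le> n"
  shows "edge_bound (box n) \<le> site_const * (vol TYPE('n) n - vol TYPE('n) (n - R))"
proof -
  have "edge_sets (box n) \<subseteq> touching (box n - box (n - R))"
  proof
    fix A assume A: "A \<in> edge_sets (box n)"
    then obtain x y where x: "x \<in> A" "x \<in> box n" and y: "y \<in> A" "y \<notin> box n"
      by (auto simp: edge_sets_def touching_def)
    have yx: "y - x \<in> box R" using A x y by (auto simp: edge_sets_def touching_def)
    have "x \<notin> box (n - R)"
    proof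
      assume x': "x \<in> box (n - R)"
      have "\<bar>y $ i\<bar> \<le> int n" for i
        using boxD[OF x', of i] boxD[OF yx, of i] assms by (simp add: of_nat_diff)
      thus False using y boxI by blast
    qed
    thus "A \<in> touching (box n - box (n - R))" using A x by (auto simp: edge_sets_def touching_def)
  qed
  hence "edge_bound (box n) \<le> site_const * real (card (box n - box (n - R) :: 'n site set))"
    unfolding edge_bound_def by (rule sum_pot_bound_card) simp
  also have "real (card (box n - box (n - R) :: 'n site set)) = vol TYPE('n) n - vol TYPE('n) (n - R)"
    unfolding vol_def by (simp add: card_Diff_subset box_mono card_mono of_nat_diff)
  finally show ?thesis .
qed

lemma edge_bound_box_tendsto: "(\<lambda>n. edge_bound (box n) / vol TYPE('n) n) \<longlonglongrightarrow> 0"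
proof (rule tendsto_sandwich[OF _ _ tendsto_const])
  show "\<forall>\<^sub>F n in sequentially. 0 \<le> edge_bound (box n) / vol TYPE('n) n"
    by (simp add: edge_bound_nonneg less_imp_le)
  show "\<forall>\<^sub>F n in sequentially. edge_bound (box n) / vol TYPE('n) n \<le> site_const * (1 - vol TYPE('n) (n - R) / vol TYPE('n) n)"
    using eventually_ge_at_top[of R]
  proof eventually_elim
    case (elim n)
    have "edge_bound (box n) / vol TYPE('n) n \<le> site_const * (vol TYPE('n) n - vol TYPE('n) (n - R)) / vol TYPE('n) n"
      by (intro divide_right_mono edge_bound_box_le[OF elim] less_imp_le[OF vol_pos])
    thus ?case by (simp add: diff_divide_distrib right_diff_distrib)
  qed
  have "(\<lambda>n. site_const * (1 - vol TYPE('n) (n - R) / vol TYPE('n) n)) \<longlonglongrightarrow> site_const * (1 - 1)"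
    by (intro tendsto_intros vol_ratio_const_tendsto)
  thus "(\<lambda>n. site_const * (1 - vol TYPE('n) (n - R) / vol TYPE('n) n)) \<longlonglongrightarrow> 0" by simp
qed

lemma free_partition_shift: "free_partition ((\<lambda>a. a + x) ` T) \<eta> = free_partition T (shift x \<eta>)"
  unfolding free_partition_def
proof (rule sum_cfgs_translate)
  fix s :: "'n site \<Rightarrow> 'e"
  have "free_energy T (\<lambda>y. (restrict (shift x s) T y, shift x \<eta> y)) = free_energy T (shift x (\<lambda>y. (s y, \<eta> y)))"
    by (rule local_onD[OF free_energy_local]) (simp add: shift_def)
  thus "exp (- free_energy ((\<lambda>a. a + x) ` T) (\<lambda>y. (s y, \<eta> y))) =
     exp (- free_energy T (\<lambda>y. (restrict (shift x s) T y, shift x \<eta> y)))" by (simp add: free_energy_shift)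
qed

text \<open>Tiles are added one at a time, and \<open>ln_free_partition_Un\<close> charges only the
  boundary of the added tile.\<close>

lemma ln_free_partition_tiles:
  assumes "finite X"
  shows "\<bar>ln (free_partition (\<Union>x\<in>X. tile m m x) \<eta>) -
     (\<Sum>x\<in>X. ln (free_partition (box m) (shift ((2 * int m + 1) *s x) \<eta>)))\<bar> \<le> real (card X) * edge_bound (box m)"
  using assms
proof (induction X)
  case empty
  have "inner_sets {} = {}" by (auto simp: inner_sets_def touching_def)
  thus ?case by (simp add: free_partition_def free_energy_def)
next
  case (insert x X)
  let ?B = "\<Union>x\<in>X. tile m m x"
  have fin: "finite (tile m m x)" "finite ?B" using insert by (auto simp: tile_def)
  have "tile m m x \<inter> ?B = {}" using insert tile_disjoint[of x _ m m] by fastforce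
  from ln_free_partition_Un[OF fin this, of \<eta>]
  have "\<bar>ln (free_partition (tile m m x \<union> ?B) \<eta>) - (ln (free_partition (tile m m x) \<eta>) + ln (free_partition ?B \<eta>))\<bar>
      \<le> edge_bound (box m)"
    by (simp add: tile_def edge_bound_translate)
  moreover have "free_partition (tile m m x) \<eta> = free_partition (box m) (shift ((2 * int m + 1) *s x) \<eta>)"
    unfolding tile_def by (rule free_partition_shift)
  ultimately show ?case using insert by (simp add: algebra_simps abs_le_iff)
qed

end

subsection \<open>Pressure and joint measures\<close>

text \<open>Cauchy criterion: once \<open>w m\<close> is small, all late members of the sequence lie
  near the same \<open>L\<close> and hence near each other.\<close>

lemma convergent_if_approximable:
  fixes a w :: "nat \<Rightarrow> real"
  assumes w: "w \<longlonglongrightarrow> 0"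
    and approx: "\<And>m. \<exists>u v L. u \<longlonglongrightarrow> L \<and> v \<longlonglongrightarrow> w m \<and> (\<forall>\<^sub>F n in sequentially. \<bar>a n - u n\<bar> \<le> v n)"
  shows "convergent a"
proof -
  have "Cauchy a"
  proof (rule CauchyI)
    fix e :: real assume e: "0 < e"
    have "\<forall>\<^sub>F m in sequentially. w m < e / 8" using e by (intro order_tendstoD[OF w]) simp
    then obtain m where m: "w m < e / 8" by (auto simp: eventually_sequentially)
    obtain u v L where u: "u \<longlonglongrightarrow> L" and v: "v \<longlonglongrightarrow> w m" and uv: "\<forall>\<^sub>F n in sequentially. \<bar>a n - u n\<bar> \<le> v n"
      using approx by blast
    have "\<forall>\<^sub>F n in sequentially. \<bar>u n - L\<bar> < e / 4" using tendstoD[OF u, of "e / 4"] e by (simp add: dist_real_def)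
    moreover have "\<forall>\<^sub>F n in sequentially. v n < e / 8" using m by (rule order_tendstoD[OF v])
    ultimately have "\<forall>\<^sub>F n in sequentially. \<bar>a n - L\<bar> < e / 2"
      using uv by eventually_elim linarith
    then obtain N where "\<And>n. n \<ge> N \<Longrightarrow> \<bar>a n - L\<bar> < e / 2" by (auto simp: eventually_sequentially)
    hence "norm (a n - a k) < e" if "n \<ge> N" "k \<ge> N" for n k
      using that by (smt (verit, best) field_sum_of_halves real_norm_def)
    thus "\<exists>M. \<forall>m\<ge>M. \<forall>n\<ge>M. norm (a m - a n) < e" by blast
  qed
  thus ?thesis by (simp add: Cauchy_convergent_iff)
qed

lemma local_on_snd:
  fixes f :: "('n::finite site \<Rightarrow> 'd) \<Rightarrow> 'b"
  assumes "local_on S f"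
  shows "local_on S (\<lambda>\<xi> :: 'n site \<Rightarrow> 'e \<times> 'd. f (snd \<circ> \<xi>))"
  unfolding local_on_def
proof (intro allI impI)
  fix \<xi> \<xi>' :: "'n site \<Rightarrow> 'e \<times> 'd" assume "\<forall>x\<in>S. \<xi> x = \<xi>' x"
  thus "f (snd \<circ> \<xi>) = f (snd \<circ> \<xi>')" by (intro local_onD[OF assms]) simp
qed

text \<open>Cylinders are open and closed, so weak convergence can be tested on their
  indicators.\<close>

lemma cyl_indicator_continuous:
  assumes "finite T"
  shows "continuous_map cfg_top euclideanreal (indicator (cyl T \<zeta>) :: ('n::finite site \<Rightarrow> 'a) \<Rightarrow> real)"
  using assms
proof (induction T)
  case empty
  have "indicator (cyl {} \<zeta>) = (\<lambda>_. 1 :: real)" by (auto simp: cyl_def)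
  thus ?case by simp
next
  case (insert x T)
  have 1: "continuous_map cfg_top (discrete_topology UNIV) (\<lambda>\<xi> :: 'n site \<Rightarrow> 'a. \<xi> x)"
    unfolding cfg_top_def by (rule continuous_map_product_projection) simp
  have 2: "continuous_map (discrete_topology UNIV) euclideanreal (\<lambda>a. if a = \<zeta> x then 1 else 0)"
    by simp
  have "continuous_map cfg_top euclideanreal (\<lambda>\<xi> :: 'n site \<Rightarrow> 'a. if \<xi> x = \<zeta> x then 1 else 0)"
    using continuous_map_compose[OF 1 2] by (simp add: comp_def)
  from continuous_map_real_mult[OF this insert.IH]
  have "continuous_map cfg_top euclideanreal (\<lambda>\<xi>. (if \<xi> x = \<zeta> x then 1 else 0) * indicator (cyl T \<zeta>) \<xi>)" .
  moreover have "(\<lambda>\<xi>. (if \<xi> x = \<zeta> x then 1 else 0) * indicator (cyl T \<zeta>) \<xi>) = (indicator (cyl (insert x T) \<zeta>) :: _ \<Rightarrow> real)"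
    by (auto simp: cyl_def indicator_def fun_eq_iff)
  ultimately show ?case by simp
qed

context range_potential
begin

text \<open>For fixed tile radius \<open>m\<close> the logarithm over \<open>box n\<close> is a sum
  over tiles, up to the tile boundaries and an uncovered rim. Per site, the rim vanishes as
  \<open>n\<close> grows and the tile boundaries vanish as \<open>m\<close> grows.\<close>

lemma ln_free_partition_convergent:
  assumes S: "\<And>m. convergent (\<lambda>k. (\<Sum>x\<in>box k. ln (free_partition (box m) (shift ((2 * int m + 1) *s x) \<eta>))) / vol TYPE('n) k)"
  shows "convergent (\<lambda>n. ln (free_partition (box n) \<eta>) / vol TYPE('n) n)"
proof (rule convergent_if_approximable[OF edge_bound_box_tendsto])
  fix m
  let ?V = "vol TYPE('n)"
  define S where "S k = (\<Sum>x\<in>box k. ln (free_partition (box m) (shift ((2 * int m + 1) *s x) \<eta>)))" for k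
  obtain L where L: "(\<lambda>k. S k / ?V k) \<longlonglongrightarrow> L" using S[of m] by (auto simp: convergent_def S_def)
  define M where "M = 2 * m + 1"
  define k where "k n = (n - m) div M" for n
  \<comment> \<open>The fraction of \<open>box n\<close> covered by the exact tiling; the constant
    \<open>C\<close> is the price per uncovered site from
    \<open>ln_free_partition_growth\<close>.\<close>
  define \<rho> where "\<rho> n = ?V (M * k n + m) / ?V n" for n
  define C where "C = 2 * site_const + ln (real CARD('e))"
  have \<rho>: "\<rho> \<longlonglongrightarrow> 1" unfolding \<rho>_def k_def by (rule tile_ratio_tendsto) (simp add: M_def)
  have kinf: "filterlim k at_top sequentially"
    unfolding filterlim_at_top
  proof
    fix Z
    show "\<forall>\<^sub>F n in sequentially. Z \<le> k n"
      using eventually_ge_at_top[of "Z * M + m"]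
    proof eventually_elim
      case (elim n)
      hence "Z * M \<le> n - m" by simp
      hence "Z * M div M \<le> (n - m) div M" by (rule div_le_mono)
      moreover have "M \<noteq> 0" by (simp add: M_def)
      ultimately show ?case by (simp add: k_def)
    qed
  qed
  have "(\<lambda>n. S (k n) / ?V (k n)) \<longlonglongrightarrow> L" using filterlim_compose[OF L kinf] .
  hence u: "(\<lambda>n. S (k n) / ?V (k n) / ?V m * \<rho> n) \<longlonglongrightarrow> L / ?V m * 1" by (intro tendsto_intros \<rho>) auto
  have v: "(\<lambda>n. edge_bound (box m) / ?V m * \<rho> n + C * (1 - \<rho> n)) \<longlonglongrightarrow> edge_bound (box m) / ?V m * 1 + C * (1 - 1)"
    by (intro tendsto_intros \<rho>)
  have "\<forall>\<^sub>F n in sequentially. \<bar>ln (free_partition (box n) \<eta>) / ?V n - S (k n) / ?V (k n) / ?V m * \<rho> n\<bar> \<le>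
      edge_bound (box m) / ?V m * \<rho> n + C * (1 - \<rho> n)"
    using eventually_ge_at_top[of m]
  proof eventually_elim
    case (elim n)
    define q where "q = M * k n + m"
    have qn: "q \<le> n" using elim times_div_less_eq_dividend[of M "n - m"] unfolding q_def k_def by linarith
    have Vq: "?V q = ?V (k n) * ?V m" unfolding q_def M_def by (rule vol_tile)
    have rq: "\<rho> n = ?V q / ?V n" by (simp add: \<rho>_def q_def)
    have "\<bar>ln (free_partition (box n) \<eta>) - ln (free_partition (box q) \<eta>)\<bar> \<le> C * (?V n - ?V q)"
      unfolding C_def vol_def by (rule ln_free_partition_growth) (auto simp: box_mono qn)
    moreover have "\<bar>ln (free_partition (box q) \<eta>) - S (k n)\<bar> \<le> ?V (k n) * edge_bound (box m)"
      using ln_free_partition_tiles[of "box (k n)" m \<eta>] box_tiling[of m "k n", where 'n='n]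
      unfolding S_def q_def M_def vol_def by simp
    ultimately have "\<bar>ln (free_partition (box n) \<eta>) - S (k n)\<bar> \<le> ?V (k n) * edge_bound (box m) + C * (?V n - ?V q)"
      by linarith
    hence "\<bar>ln (free_partition (box n) \<eta>) - S (k n)\<bar> / ?V n \<le>
       (?V (k n) * edge_bound (box m) + C * (?V n - ?V q)) / ?V n"
      by (intro divide_right_mono less_imp_le[OF vol_pos])
    moreover have "\<bar>ln (free_partition (box n) \<eta>) - S (k n)\<bar> / ?V n =
      \<bar>ln (free_partition (box n) \<eta>) / ?V n - S (k n) / ?V n\<bar>"
      by (simp add: diff_divide_distrib[symmetric] abs_divide less_imp_le)
    moreover have "S (k n) / ?V n = S (k n) / ?V (k n) / ?V m * \<rho> n" unfolding rq Vq by simp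
    moreover have "(?V (k n) * edge_bound (box m) + C * (?V n - ?V q)) / ?V n =
      edge_bound (box m) / ?V m * \<rho> n + C * (1 - \<rho> n)"
      unfolding rq by (simp add: Vq add_divide_distrib diff_divide_distrib right_diff_distrib)
    ultimately show ?case by simp
  qed
  thus "\<exists>u v L. u \<longlonglongrightarrow> L \<and> v \<longlonglongrightarrow> edge_bound (box m) / ?V m \<and>
      (\<forall>\<^sub>F n in sequentially. \<bar>ln (free_partition (box n) \<eta>) / ?V n - u n\<bar> \<le> v n)"
    using u v[simplified]
    by (intro exI[of _ "\<lambda>n. S (k n) / ?V (k n) / ?V m * \<rho> n"] exI[of _ "L / ?V m * 1"]
        exI[of _ "\<lambda>n. edge_bound (box m) / ?V m * \<rho> n + C * (1 - \<rho> n)"] conjI) auto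
qed

lemma ln_free_partition_local: "local_on T (\<lambda>\<eta>. ln (free_partition T \<eta>))"
  using free_partition_local[of T] unfolding local_on_def by metis

text \<open>The shifts by multiples of \<open>2 * m + 1\<close> form a measure-preserving lattice
  action, and the logarithm for one tile is bounded and local. The countably many \<open>m\<close>
  share one exceptional null set.\<close>

lemma ln_free_partition_AE_convergent:
  fixes K :: "('n site \<Rightarrow> 'e \<times> 'd) measure"
  assumes K: "prob_space K" "transl_inv_measure K"
  shows "AE \<xi> in K. convergent (\<lambda>n. ln (free_partition (box n) (snd \<circ> \<xi>)) / vol TYPE('n) n)"
proof -
  interpret prob_space K by fact
  have sK: "sets K = sets cfg_space" using K by (simp add: transl_inv_measure_def)
  define f where "f m \<xi> = ln (free_partition (box m) (snd \<circ> \<xi>))" for m and \<xi> :: "'n site \<Rightarrow> 'e \<times> 'd"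
  have "AE \<xi> in K. convergent (\<lambda>k. (\<Sum>x\<in>box k. f m (shift ((2 * int m + 1) *s x) \<xi>)) / real (card (box k :: 'n site set)))" for m
  proof (rule box_birkhoff_pointwise)
    show "measure_preserving_map K (shift ((2 * int m + 1) *s x))" for x by (rule shift_measure_preserving[OF K(2)])
    show "shift ((2 * int m + 1) *s (x + y)) \<xi> = shift ((2 * int m + 1) *s x) (shift ((2 * int m + 1) *s y) \<xi>)"
      for x y and \<xi> :: "'n site \<Rightarrow> 'e \<times> 'd"
      by (simp add: shift_def vector_add_ldistrib fun_eq_iff add.assoc add.left_commute)
    show "shift ((2 * int m + 1) *s 0) \<xi> = \<xi>" for \<xi> :: "'n site \<Rightarrow> 'e \<times> 'd" by (simp add: shift_def)
    have "f m \<in> borel_measurable cfg_space" unfolding f_def[abs_def]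
      by (rule local_measurable[of "box m"]) (auto intro!: local_on_snd ln_free_partition_local)
    thus "f m \<in> borel_measurable K" using sK by (simp cong: measurable_cong_sets)
    show "\<bar>f m \<xi>\<bar> \<le> (site_const + ln (real CARD('e))) * real (card (box m :: 'n site set))" for \<xi>
      unfolding f_def by (rule ln_free_partition_abs_le) simp
  qed
  hence "AE \<xi> in K. \<forall>m. convergent (\<lambda>k. (\<Sum>x\<in>box k. f m (shift ((2 * int m + 1) *s x) \<xi>)) / real (card (box k :: 'n site set)))"
    by (simp add: AE_all_countable)
  thus ?thesis
  proof eventually_elim
    case (elim \<xi>)
    have "snd \<circ> shift y \<xi> = shift y (snd \<circ> \<xi>)" for y by (simp add: shift_def fun_eq_iff)
    thus ?case using elim by (intro ln_free_partition_convergent) (simp add: f_def vol_def)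
  qed
qed

section \<open>Gibbs probabilities of cylinders and their weak limits\<close>

lemma finite_Union_touching: "finite \<Lambda> \<Longrightarrow> finite (\<Union>(touching \<Lambda>))"
  using finite_touching touching_finite_member by blast

lemma hamiltonian_join_local:
  assumes "finite \<Lambda>"
  shows "local_on (\<Union>(touching \<Lambda>)) (\<lambda>\<eta>. hamiltonian \<Phi> \<Lambda> (join_cfg \<Lambda> s \<sigma>b \<eta>))"
  unfolding local_on_def hamiltonian_eq_sum[OF assms]
proof (intro allI impI)
  fix \<eta> \<eta>' :: "'n site \<Rightarrow> 'd" assume "\<forall>x\<in>\<Union>(touching \<Lambda>). \<eta> x = \<eta>' x"
  thus "(\<Sum>A\<in>touching \<Lambda>. \<Phi> A (join_cfg \<Lambda> s \<sigma>b \<eta>)) = (\<Sum>A\<in>touching \<Lambda>. \<Phi> A (join_cfg \<Lambda> s \<sigma>b \<eta>'))"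
    by (intro local_onD[OF sum_pot_local[of "touching \<Lambda>" "\<Union>(touching \<Lambda>)"]])
       (auto simp: join_cfg_def intro: touching_finite_member)
qed

lemma partition_fn_local:
  assumes "finite \<Lambda>"
  shows "local_on (\<Union>(touching \<Lambda>)) (partition_fn \<Phi> \<Lambda> \<sigma>b)"
  unfolding local_on_def partition_fn_def
  using hamiltonian_join_local[OF assms, of _ \<sigma>b] unfolding local_on_def
  by (intro allI impI sum.cong refl arg_cong[where f="\<lambda>r. exp (- r)"]) blast

lemma gibbs_expect_cyl_local:
  assumes "finite \<Lambda>"
  shows "local_on (\<Union>(touching \<Lambda>) \<union> T) (\<lambda>\<eta>. gibbs_expect \<Phi> \<Lambda> \<sigma>b \<eta> (indicator (cyl T \<zeta>)))"
  unfolding local_on_def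
proof (intro allI impI)
  fix \<eta> \<eta>' :: "'n site \<Rightarrow> 'd" assume eq: "\<forall>x\<in>\<Union>(touching \<Lambda>) \<union> T. \<eta> x = \<eta>' x"
  have 1: "partition_fn \<Phi> \<Lambda> \<sigma>b \<eta> = partition_fn \<Phi> \<Lambda> \<sigma>b \<eta>'"
    using eq by (intro local_onD[OF partition_fn_local[OF assms]]) blast
  have 2: "hamiltonian \<Phi> \<Lambda> (join_cfg \<Lambda> s \<sigma>b \<eta>) = hamiltonian \<Phi> \<Lambda> (join_cfg \<Lambda> s \<sigma>b \<eta>')" for s
    using eq by (intro local_onD[OF hamiltonian_join_local[OF assms]]) blast
  have 3: "indicator (cyl T \<zeta>) (join_cfg \<Lambda> s \<sigma>b \<eta>) = (indicator (cyl T \<zeta>) (join_cfg \<Lambda> s \<sigma>b \<eta>') :: real)" for s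
    using eq by (simp add: indicator_def cyl_def join_cfg_def)
  show "gibbs_expect \<Phi> \<Lambda> \<sigma>b \<eta> (indicator (cyl T \<zeta>)) = gibbs_expect \<Phi> \<Lambda> \<sigma>b \<eta>' (indicator (cyl T \<zeta>))"
    unfolding gibbs_expect_def 1 2 3 ..
qed

text \<open>Probability of the spins of \<open>\<zeta>\<close> on \<open>T\<close> in the
  free-boundary Gibbs measure on \<open>T\<close>, given the disorder of
  \<open>\<zeta>\<close>.\<close>

definition free_weight :: "'n site set \<Rightarrow> ('n site \<Rightarrow> 'e \<times> 'd) \<Rightarrow> real" where
  "free_weight T \<zeta> = exp (- free_energy T \<zeta>) / free_partition T (snd \<circ> \<zeta>)"

text \<open>Numerator and partition function each factorise, up to
  \<open>exp (edge_bound T)\<close>, into a part on \<open>T\<close> and the same factor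
  \<open>E\<close> from \<open>\<Lambda> - T\<close>. This factor cancels, and two boundary errors
  remain that depend neither on \<open>\<Lambda>\<close> nor on the boundary condition. The
  indicator records that the disorder is not resampled.\<close>

lemma gibbs_expect_cyl_bounds:
  assumes L: "finite \<Lambda>" "T \<subseteq> \<Lambda>"
  shows "gibbs_expect \<Phi> \<Lambda> \<sigma>b \<eta> (indicator (cyl T \<zeta>)) \<le>
      exp (2 * edge_bound T) * free_weight T \<zeta> * indicator (cyl T (snd \<circ> \<zeta>)) \<eta>"
    and "exp (- 2 * edge_bound T) * free_weight T \<zeta> * indicator (cyl T (snd \<circ> \<zeta>)) \<eta> \<le>
      gibbs_expect \<Phi> \<Lambda> \<sigma>b \<eta> (indicator (cyl T \<zeta>))"
proof -
  define D where "D = \<Lambda> - T"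
  define W where "W = edge_bound T"
  have LD: "\<Lambda> = T \<union> D" and dis: "T \<inter> D = {}" using L by (auto simp: D_def)
  have fin: "finite T" "finite D" using finite_subset[OF L(2,1)] L(1) by (simp_all add: D_def)
  define J where "J u t = join_cfg \<Lambda> (glue T u t) \<sigma>b \<eta>" for u t
  define h where "h u t = hamiltonian \<Phi> \<Lambda> (J u t)" for u t
  \<comment> \<open>The rest energy does not read the spins on \<open>T\<close>, so the dummy
    \<open>undefined\<close> stands there and \<open>r\<close> depends on \<open>t\<close>
    alone.\<close>
  define r where "r t = rest_energy \<Lambda> T (J undefined t)" for t
  define f where "f u = free_energy T (\<lambda>x. (u x, \<eta> x))" for u
  have close: "\<bar>h u t - (f u + r t)\<bar> \<le> W" for u t
  proof -
    have "rest_energy \<Lambda> T (J u t) = r t"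
      unfolding r_def by (rule local_onD[OF rest_energy_local]) (auto simp: J_def join_cfg_def glue_def)
    moreover have "free_energy T (J u t) = f u"
      unfolding f_def using L(2) by (intro local_onD[OF free_energy_local]) (auto simp: J_def join_cfg_def glue_def)
    ultimately show ?thesis using hamiltonian_split[OF L, of "J u t"] by (simp add: h_def W_def)
  qed
  have close': "\<bar>(f u + r t) - h u t\<bar> \<le> W" for u t using close[of u t] by linarith
  define E where "E = (\<Sum>t\<in>cfgs D. exp (- r t))"
  have E: "0 < E" unfolding E_def using fin by (intro sum_pos) auto
  define Z0 where "Z0 = free_partition T \<eta>"
  have Z0: "0 < Z0" unfolding Z0_def by (rule free_partition_pos[OF fin(1)])
  define Z where "Z = partition_fn \<Phi> \<Lambda> \<sigma>b \<eta>"
  have Zeq: "Z = (\<Sum>p\<in>cfgs T \<times> cfgs D. exp (- h (fst p) (snd p)))"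
    unfolding Z_def partition_fn_def
    by (subst LD, subst sum_cfgs_Un[OF dis])
       (simp add: h_def J_def LD[symmetric] sum.cartesian_product case_prod_beta)
  have ZE: "Z0 * E = (\<Sum>p\<in>cfgs T \<times> cfgs D. exp (- (f (fst p) + r (snd p))))"
    unfolding Z0_def E_def free_partition_def f_def[symmetric] sum_product sum.cartesian_product
    by (simp add: case_prod_beta exp_add[symmetric])
  have Z1: "Z \<le> exp W * (Z0 * E)" and Z2: "Z0 * E \<le> exp W * Z"
    unfolding Zeq ZE by (rule sum_exp_close, rule close close')+
  have Z: "0 < Z" using Z2 Z0 E by (metis exp_gt_zero mult_pos_pos not_le order_less_le_trans zero_less_mult_pos)
  define num where "num = (\<Sum>s\<in>cfgs \<Lambda>. exp (- hamiltonian \<Phi> \<Lambda> (join_cfg \<Lambda> s \<sigma>b \<eta>)) * indicator (cyl T \<zeta>) (join_cfg \<Lambda> s \<sigma>b \<eta>))"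
  have ge: "gibbs_expect \<Phi> \<Lambda> \<sigma>b \<eta> (indicator (cyl T \<zeta>)) = num / Z"
    by (simp add: gibbs_expect_def num_def Z_def)
  have both: "num / Z \<le> exp (2 * W) * free_weight T \<zeta> * indicator (cyl T (snd \<circ> \<zeta>)) \<eta> \<and>
     exp (- 2 * W) * free_weight T \<zeta> * indicator (cyl T (snd \<circ> \<zeta>)) \<eta> \<le> num / Z"
  proof (cases "\<eta> \<in> cyl T (snd \<circ> \<zeta>)")
    case False
    then obtain x where "x \<in> T" "\<eta> x \<noteq> snd (\<zeta> x)" by (auto simp: cyl_def)
    hence "join_cfg \<Lambda> s \<sigma>b \<eta> \<notin> cyl T \<zeta>" for s by (auto simp: cyl_def join_cfg_def) (metis snd_conv)
    hence "num = 0" by (simp add: num_def)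
    thus ?thesis using False by simp
  next
    case True
    hence \<eta>: "\<eta> x = snd (\<zeta> x)" if "x \<in> T" for x using that by (simp add: cyl_def)
    \<comment> \<open>The only spin pattern on \<open>T\<close> compatible with the cylinder, so the
      sum over \<open>u\<close> collapses to it.\<close>
    define u0 where "u0 = restrict (fst \<circ> \<zeta>) T"
    have ind: "indicator (cyl T \<zeta>) (J u t) = (if u = u0 then 1 else 0 :: real)" if "u \<in> cfgs T" for u t
    proof -
      have "J u t \<in> cyl T \<zeta> \<longleftrightarrow> (\<forall>x\<in>T. u x = fst (\<zeta> x))"
        using L(2) \<eta> by (auto simp: cyl_def J_def join_cfg_def glue_def prod_eq_iff subset_iff)
      also have "\<dots> \<longleftrightarrow> u = u0"
        using that by (auto simp: u0_def fun_eq_iff PiE_def extensional_def)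
      finally show ?thesis by (simp add: indicator_def)
    qed
    have u0: "u0 \<in> cfgs T" unfolding u0_def by (rule restrict_in_cfgs)
    have "num = (\<Sum>u\<in>cfgs T. \<Sum>t\<in>cfgs D. exp (- h u t) * indicator (cyl T \<zeta>) (J u t))"
      unfolding num_def by (subst LD, subst sum_cfgs_Un[OF dis]) (simp add: h_def J_def LD[symmetric])
    also have "\<dots> = (\<Sum>u\<in>cfgs T. if u = u0 then (\<Sum>t\<in>cfgs D. exp (- h u t)) else 0)"
      by (intro sum.cong refl) (simp add: ind)
    also have "\<dots> = (\<Sum>t\<in>cfgs D. exp (- h u0 t))" using u0 fin by (simp add: sum.delta)
    finally have num: "num = (\<Sum>t\<in>cfgs D. exp (- h u0 t))" .
    have FE: "exp (- f u0) * E = (\<Sum>t\<in>cfgs D. exp (- (f u0 + r t)))"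
      by (simp add: E_def sum_distrib_left exp_add[symmetric])
    have n1: "num \<le> exp W * (exp (- f u0) * E)" and n2: "exp (- f u0) * E \<le> exp W * num"
        unfolding num FE by (rule sum_exp_close, rule close close')+
    have fz: "f u0 = free_energy T \<zeta>" unfolding f_def
      by (rule local_onD[OF free_energy_local]) (simp add: u0_def \<eta>)
    have "Z0 = free_partition T (snd \<circ> \<zeta>)" unfolding Z0_def
      by (rule local_onD[OF free_partition_local]) (simp add: \<eta>)
    hence fw: "free_weight T \<zeta> = exp (- f u0) / Z0" by (simp add: free_weight_def fz)
    have e2: "exp (2 * W) = exp W * exp W" by (simp add: exp_add[symmetric])
    have "num * (Z0 * E) \<le> (exp W * (exp (- f u0) * E)) * (exp W * Z)"
      by (rule mult_mono[OF n1 Z2]) (use E Z0 in auto)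
    hence "(num * Z0) * E \<le> (exp W * exp W * exp (- f u0) * Z) * E" by (simp only: ac_simps)
    hence "num * Z0 \<le> exp W * exp W * exp (- f u0) * Z" using E by (rule mult_right_le_imp_le)
    hence up: "num / Z \<le> exp (2 * W) * free_weight T \<zeta>" using Z Z0 unfolding fw e2 by (simp add: field_simps)
    have num0: "0 \<le> num" unfolding num by (intro sum_nonneg) simp
    have "(exp (- f u0) * E) * Z \<le> (exp W * num) * (exp W * (Z0 * E))"
      by (rule mult_mono[OF n2 Z1]) (use Z num0 in auto)
    hence "(exp (- f u0) * Z) * E \<le> (exp W * exp W * num * Z0) * E" by (simp only: ac_simps)
    hence "exp (- f u0) * Z \<le> exp W * exp W * num * Z0" using E by (rule mult_right_le_imp_le)
    hence "exp (- f u0) / Z0 \<le> exp (2 * W) * (num / Z)" using Z Z0 unfolding e2 by (simp add: field_simps)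
    hence "exp (- 2 * W) * free_weight T \<zeta> \<le> exp (- 2 * W) * (exp (2 * W) * (num / Z))"
      unfolding fw by (intro mult_left_mono) auto
    also have "\<dots> = num / Z" by (simp add: mult.assoc[symmetric] exp_add[symmetric])
    finally show ?thesis using up True by simp
  qed
  show "gibbs_expect \<Phi> \<Lambda> \<sigma>b \<eta> (indicator (cyl T \<zeta>)) \<le>
      exp (2 * edge_bound T) * free_weight T \<zeta> * indicator (cyl T (snd \<circ> \<zeta>)) \<eta>"
    and "exp (- 2 * edge_bound T) * free_weight T \<zeta> * indicator (cyl T (snd \<circ> \<zeta>)) \<eta> \<le>
      gibbs_expect \<Phi> \<Lambda> \<sigma>b \<eta> (indicator (cyl T \<zeta>))"
    using both unfolding ge W_def by auto
qed

text \<open>The finite-volume bounds are uniform once the volume contains \<open>T\<close>; they are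
  integrated over \<open>P\<close> and passed to the weak limit.\<close>

lemma joint_measure_cyl_bounds:
  assumes P: "prob_space P" "sets P = sets cfg_space" and K: "is_joint_measure \<Phi> P \<sigma>b K"
    and T: "finite T"
  shows "cyl_prob K T \<zeta> \<le> exp (2 * edge_bound T) * (free_weight T \<zeta> * cyl_prob P T (snd \<circ> \<zeta>))"
    and "exp (- 2 * edge_bound T) * (free_weight T \<zeta> * cyl_prob P T (snd \<circ> \<zeta>)) \<le> cyl_prob K T \<zeta>"
proof -
  have sK: "sets K = sets cfg_space" and "prob_space K" using K by (auto simp: is_joint_measure_def)
  interpret K: prob_space K by fact
  interpret P: prob_space P by fact
  have spK: "space K = UNIV" using sets_eq_imp_space_eq[OF sK] by simp
  have spP: "space P = UNIV" using sets_eq_imp_space_eq[OF P(2)] by simp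
  obtain \<Lambda>s where \<Lambda>: "\<And>N. finite (\<Lambda>s N)" "incseq \<Lambda>s" "(\<Union>N. \<Lambda>s N) = UNIV"
    and lim: "\<And>f. continuous_map cfg_top euclideanreal f \<Longrightarrow>
       (\<lambda>N. joint_fv_integral \<Phi> P (\<Lambda>s N) \<sigma>b f) \<longlonglongrightarrow> (\<integral>\<xi>. f \<xi> \<partial>K)"
    using K unfolding is_joint_measure_def by blast
  have "(\<integral>\<xi>. indicator (cyl T \<zeta>) \<xi> \<partial>K) = cyl_prob K T \<zeta>" by (simp add: cyl_prob_eq[OF sK] spK)
  with lim[OF cyl_indicator_continuous[OF T, of \<zeta>]]
  have l: "(\<lambda>N. joint_fv_integral \<Phi> P (\<Lambda>s N) \<sigma>b (indicator (cyl T \<zeta>))) \<longlonglongrightarrow> cyl_prob K T \<zeta>" by simp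
  have "\<exists>N. T \<subseteq> \<Lambda>s N" using T
  proof (induction T)
    case (insert x T)
    then obtain N where N: "T \<subseteq> \<Lambda>s N" by auto
    obtain N' where N': "x \<in> \<Lambda>s N'" using \<Lambda>(3) by auto
    have "\<Lambda>s N \<subseteq> \<Lambda>s (max N N')" "\<Lambda>s N' \<subseteq> \<Lambda>s (max N N')" using \<Lambda>(2) by (auto simp: incseq_def)
    thus ?case using N N' by (intro exI[of _ "max N N'"]) auto
  qed auto
  then obtain N0 where N0: "T \<subseteq> \<Lambda>s N0" by auto
  have sub: "T \<subseteq> \<Lambda>s N" if "N \<ge> N0" for N using N0 incseqD[OF \<Lambda>(2) that] by auto
  have int1: "integrable P (\<lambda>\<eta>. gibbs_expect \<Phi> (\<Lambda>s N) \<sigma>b \<eta> (indicator (cyl T \<zeta>)))" for N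
    using T finite_Union_touching[OF \<Lambda>(1)[of N]]
    by (intro local_integral(1)[OF _ gibbs_expect_cyl_local[OF \<Lambda>(1)] P]) auto
  have int2: "integrable P (\<lambda>\<eta>. c * indicator (cyl T (snd \<circ> \<zeta>)) \<eta>)" for c :: real
    using cyl_measurable[OF T] P(2) by (intro integrable_mult_right integrable_real_indicator) (auto simp: less_top[symmetric])
  have ev: "(\<integral>\<eta>. c * indicator (cyl T (snd \<circ> \<zeta>)) \<eta> \<partial>P) = c * cyl_prob P T (snd \<circ> \<zeta>)" for c
    by (simp add: cyl_prob_eq[OF P(2)] spP)
  have up: "joint_fv_integral \<Phi> P (\<Lambda>s N) \<sigma>b (indicator (cyl T \<zeta>)) \<le>
      exp (2 * edge_bound T) * (free_weight T \<zeta> * cyl_prob P T (snd \<circ> \<zeta>))" if "N \<ge> N0" for N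
    using integral_mono[OF int1 int2 gibbs_expect_cyl_bounds(1)[OF \<Lambda>(1) sub[OF that]]]
    unfolding ev joint_fv_integral_def by (simp add: mult.assoc)
  have low: "exp (- 2 * edge_bound T) * (free_weight T \<zeta> * cyl_prob P T (snd \<circ> \<zeta>)) \<le>
      joint_fv_integral \<Phi> P (\<Lambda>s N) \<sigma>b (indicator (cyl T \<zeta>))" if "N \<ge> N0" for N
    using integral_mono[OF int2 int1 gibbs_expect_cyl_bounds(2)[OF \<Lambda>(1) sub[OF that]]]
    unfolding ev joint_fv_integral_def by (simp add: mult.assoc)
  show "cyl_prob K T \<zeta> \<le> exp (2 * edge_bound T) * (free_weight T \<zeta> * cyl_prob P T (snd \<circ> \<zeta>))"
    using up by (intro LIMSEQ_le_const2[OF l]) blast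
  show "exp (- 2 * edge_bound T) * (free_weight T \<zeta> * cyl_prob P T (snd \<circ> \<zeta>)) \<le> cyl_prob K T \<zeta>"
    using low by (intro LIMSEQ_le_const[OF l]) blast
qed

end

subsection \<open>The disorder marginal\<close>

lemma snd_comp_measurable [measurable]: "(\<lambda>\<xi>. snd \<circ> \<xi>) \<in> measurable cfg_space cfg_space"
proof -
  have "(\<lambda>\<xi> :: 'a site \<Rightarrow> 'b \<times> 'c. snd (\<xi> x)) \<in> measurable cfg_space (count_space UNIV)" for x
    unfolding cfg_space_def
    by (rule measurable_compose[OF measurable_component_singleton]) auto
  thus ?thesis unfolding cfg_space_def
    by (intro measurable_PiM_single') (auto simp: comp_def)
qed

context
  fixes K :: "('n::finite site \<Rightarrow> 'e::finite \<times> 'd::finite) measure"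
  assumes K: "prob_space K" and tK: "transl_inv_measure K"
begin

lemma joint_sets: "sets K = sets cfg_space"
  using tK by (simp add: transl_inv_measure_def)

lemma snd_comp_measurable_joint: "(\<lambda>\<xi>. snd \<circ> \<xi>) \<in> measurable K cfg_space"
  using snd_comp_measurable joint_sets by (simp cong: measurable_cong_sets)

lemma disorder_marginal_prob: "prob_space (disorder_marginal K)"
  unfolding disorder_marginal_def by (rule prob_space.prob_space_distr[OF K snd_comp_measurable_joint])

lemma disorder_marginal_sets: "sets (disorder_marginal K) = sets cfg_space"
  by (simp add: disorder_marginal_def)

lemma disorder_marginal_transl_inv: "transl_inv_measure (disorder_marginal K)"
  unfolding transl_inv_measure_def
proof (intro conjI allI disorder_marginal_sets)
  fix x :: "'n site"
  have m: "shift x \<in> measurable K cfg_space" using shift_measurable joint_sets by (simp cong: measurable_cong_sets)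
  have "distr (disorder_marginal K) cfg_space (shift x) = distr K cfg_space (shift x \<circ> (\<lambda>\<xi>. snd \<circ> \<xi>))"
    unfolding disorder_marginal_def by (rule distr_distr[OF shift_measurable snd_comp_measurable_joint])
  also have "shift x \<circ> (\<lambda>\<xi> :: 'n site \<Rightarrow> 'e \<times> 'd. snd \<circ> \<xi>) = (\<lambda>\<xi>. snd \<circ> \<xi>) \<circ> shift x"
    by (auto simp: fun_eq_iff shift_def)
  also have "distr K cfg_space ((\<lambda>\<xi>. snd \<circ> \<xi>) \<circ> shift x) = distr (distr K cfg_space (shift x)) cfg_space (\<lambda>\<xi>. snd \<circ> \<xi>)"
    by (rule distr_distr[OF snd_comp_measurable m, symmetric])
  also have "distr K cfg_space (shift x) = K" using tK by (simp add: transl_inv_measure_def)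
  finally show "distr (disorder_marginal K) cfg_space (shift x) = disorder_marginal K"
    by (simp only: disorder_marginal_def)
qed

text \<open>Puts quantities of the disorder alone on the weights \<open>cyl_prob K T\<close>, where
  they can be combined with joint quantities pattern by pattern.\<close>

lemma disorder_marginal_expect:
  fixes g :: "('n site \<Rightarrow> 'd) \<Rightarrow> real"
  assumes "finite T" "local_on T g"
  shows "(\<Sum>\<eta>\<in>cfgs T. cyl_prob (disorder_marginal K) T \<eta> * g \<eta>) =
    (\<Sum>\<zeta>\<in>cfgs T. cyl_prob K T \<zeta> * g (snd \<circ> \<zeta>))"
proof -
  have "(\<Sum>\<eta>\<in>cfgs T. cyl_prob (disorder_marginal K) T \<eta> * g \<eta>) = (\<integral>\<eta>. g \<eta> \<partial>disorder_marginal K)"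
    using local_integral(2)[OF assms disorder_marginal_prob disorder_marginal_sets] by simp
  also have "\<dots> = (\<integral>\<xi>. g (snd \<circ> \<xi>) \<partial>K)"
    unfolding disorder_marginal_def
    by (rule integral_distr[OF snd_comp_measurable_joint local_measurable[OF assms]])
  also have "\<dots> = (\<Sum>\<zeta>\<in>cfgs T. cyl_prob K T \<zeta> * g (snd \<circ> \<zeta>))"
    by (rule local_integral(2)[OF assms(1) local_on_snd[OF assms(2)] K joint_sets])
  finally show ?thesis .
qed

lemma disorder_marginal_cyl:
  assumes "finite T"
  shows "cyl_prob (disorder_marginal K) T \<eta> = measure K {\<xi>. snd \<circ> \<xi> \<in> cyl T \<eta>}"
proof -
  have sp: "space K = UNIV" using sets_eq_imp_space_eq[OF joint_sets] by simp
  have "cyl_prob (disorder_marginal K) T \<eta> = measure (disorder_marginal K) (cyl T \<eta>)"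
    by (rule cyl_prob_eq[OF disorder_marginal_sets])
  also have "\<dots> = measure K ((\<lambda>\<xi>. snd \<circ> \<xi>) -` cyl T \<eta> \<inter> space K)"
    unfolding disorder_marginal_def by (rule measure_distr[OF snd_comp_measurable_joint cyl_measurable[OF assms]])
  finally show ?thesis by (simp only: vimage_def sp Int_UNIV_right)
qed

lemma cyl_prob_le_marginal:
  assumes "finite T"
  shows "cyl_prob K T \<zeta> \<le> cyl_prob (disorder_marginal K) T (snd \<circ> \<zeta>)"
proof -
  interpret prob_space K by fact
  have sp: "space K = UNIV" using sets_eq_imp_space_eq[OF joint_sets] by simp
  have "(\<lambda>\<xi>. snd \<circ> \<xi>) -` cyl T (snd \<circ> \<zeta>) \<inter> space K \<in> sets K"
    by (rule measurable_sets[OF snd_comp_measurable_joint cyl_measurable[OF assms]])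
  hence "{\<xi>. snd \<circ> \<xi> \<in> cyl T (snd \<circ> \<zeta>)} \<in> sets K" by (simp only: vimage_def sp Int_UNIV_right)
  thus ?thesis unfolding disorder_marginal_cyl[OF assms] cyl_prob_eq[OF joint_sets]
    by (intro finite_measure_mono) (auto simp: cyl_def)
qed

text \<open>For use in contrapositive form: above a charged disorder cylinder lies a charged joint
  one. By locality, a pattern whose disorder agrees with \<open>\<eta>\<close> on \<open>T\<close>
  may be altered outside \<open>T\<close> until it agrees everywhere.\<close>

lemma disorder_marginal_null:
  assumes "finite T" and z: "\<And>\<zeta>. snd \<circ> \<zeta> = \<eta> \<Longrightarrow> cyl_prob K T \<zeta> = 0"
  shows "cyl_prob (disorder_marginal K) T \<eta> = 0"
proof -
  note kd = cyl_prob_consistent[OF disorder_marginal_prob disorder_marginal_sets]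
  note k = cyl_prob_consistent[OF K joint_sets]
  define g :: "('n site \<Rightarrow> 'd) \<Rightarrow> real" where "g = indicator (cyl T \<eta>)"
  have g: "local_on T g" unfolding g_def local_on_def by (auto simp: cyl_def indicator_def)
  have "(\<Sum>\<zeta>\<in>cfgs T. cyl_prob K T \<zeta> * g (snd \<circ> \<zeta>)) = 0"
  proof (rule sum.neutral, rule ballI)
    fix \<zeta> :: "'n site \<Rightarrow> 'e \<times> 'd"
    show "cyl_prob K T \<zeta> * g (snd \<circ> \<zeta>) = 0"
    proof (cases "snd \<circ> \<zeta> \<in> cyl T \<eta>")
      case True
      have "cyl_prob K T \<zeta> = cyl_prob K T (\<lambda>x. (fst (\<zeta> x), \<eta> x))"
        using True by (intro local_onD[OF weights_local[OF k]]) (auto simp: cyl_def prod_eq_iff)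
      also have "\<dots> = 0" by (rule z) (auto simp: fun_eq_iff)
      finally show ?thesis by simp
    qed (simp add: g_def)
  qed
  hence "(\<Sum>\<eta>\<in>cfgs T. cyl_prob (disorder_marginal K) T \<eta> * g \<eta>) = 0"
    using disorder_marginal_expect[OF assms(1) g] by simp
  moreover have "cyl_prob (disorder_marginal K) T \<eta> = cyl_prob (disorder_marginal K) T (restrict \<eta> T) * g (restrict \<eta> T)"
    using local_onD[OF weights_local[OF kd], of T \<eta> "restrict \<eta> T"] by (simp add: g_def cyl_def)
  moreover have "cyl_prob (disorder_marginal K) T (restrict \<eta> T) * g (restrict \<eta> T) \<le>
      (\<Sum>\<eta>\<in>cfgs T. cyl_prob (disorder_marginal K) T \<eta> * g \<eta>)"
    by (rule member_le_sum[OF restrict_in_cfgs]) (use assms weights_nonneg[OF kd] in \<open>auto simp: g_def\<close>)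
  ultimately show ?thesis using weights_nonneg[OF kd, of T \<eta>] by simp
qed

end

subsection \<open>The entropy identity\<close>

locale joint_setup = range_potential \<Phi> R b
  for \<Phi> :: "'n::finite site set \<Rightarrow> ('n site \<Rightarrow> 'e::finite \<times> 'd::finite) \<Rightarrow> real" and R b +
  fixes P :: "('n site \<Rightarrow> 'd) measure" and \<sigma>b :: "'n site \<Rightarrow> 'e"
    and K\<sigma> K :: "('n site \<Rightarrow> 'e \<times> 'd) measure"
  assumes P: "prob_space P" "asymptotically_decoupled P"
    and J: "is_joint_measure \<Phi> P \<sigma>b K\<sigma>"
    and K: "prob_space K" "transl_inv_measure K"
begin

abbreviation "Kd \<equiv> disorder_marginal K"

lemmas sK = joint_sets[OF K]
lemmas k = cyl_prob_consistent[OF K(1) sK]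
lemmas kd = cyl_prob_consistent[OF disorder_marginal_prob[OF K] disorder_marginal_sets[OF K]]

lemma sP: "sets P = sets cfg_space"
  using P by (simp add: asymptotically_decoupled_def transl_inv_measure_def)

lemmas p = cyl_prob_consistent[OF P(1) sP]

lemma K\<sigma>: "prob_space K\<sigma>" "sets K\<sigma> = sets cfg_space"
  using J by (auto simp: is_joint_measure_def)

lemma free_weight_pos: "finite T \<Longrightarrow> 0 < free_weight T \<zeta>"
  by (simp add: free_weight_def free_partition_pos)

text \<open>Free weights are strictly positive, so the two-sided bound transfers null cylinders in
  both directions. Absolute continuity with respect to \<open>K\<sigma>\<close> thereby reduces to a
  condition on disorder cylinders.\<close>

lemma joint_null_iff:
  assumes "finite T"
  shows "cyl_prob K\<sigma> T \<zeta> = 0 \<longleftrightarrow> cyl_prob P T (snd \<circ> \<zeta>) = 0"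
proof
  assume "cyl_prob K\<sigma> T \<zeta> = 0"
  hence "exp (- 2 * edge_bound T) * free_weight T \<zeta> * cyl_prob P T (snd \<circ> \<zeta>) \<le> 0"
    using joint_measure_cyl_bounds(2)[OF P(1) sP J assms, of \<zeta>] by (simp add: mult.assoc)
  moreover have "0 < exp (- 2 * edge_bound T) * free_weight T \<zeta>" using free_weight_pos[OF assms] by simp
  ultimately show "cyl_prob P T (snd \<circ> \<zeta>) = 0"
    using weights_nonneg[OF p, of T "snd \<circ> \<zeta>"] by (metis antisym mult_le_0_iff not_le)
next
  assume "cyl_prob P T (snd \<circ> \<zeta>) = 0"
  thus "cyl_prob K\<sigma> T \<zeta> = 0"
    using joint_measure_cyl_bounds(1)[OF P(1) sP J assms, of \<zeta>]
      weights_nonneg[OF cyl_prob_consistent[OF K\<sigma>], of T \<zeta>] by simp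
qed

lemma ln_joint_close:
  assumes T: "finite T" and z: "cyl_prob P T (snd \<circ> \<zeta>) \<noteq> 0"
  shows "\<bar>ln (cyl_prob K\<sigma> T \<zeta>) - (ln (cyl_prob P T (snd \<circ> \<zeta>)) - free_energy T \<zeta> - ln (free_partition T (snd \<circ> \<zeta>)))\<bar>
     \<le> 2 * edge_bound T"
proof -
  have pos: "0 < cyl_prob P T (snd \<circ> \<zeta>)" using z weights_nonneg[OF p, of T "snd \<circ> \<zeta>"] by simp
  have pos': "0 < cyl_prob K\<sigma> T \<zeta>"
    using z joint_null_iff[OF T, of \<zeta>] weights_nonneg[OF cyl_prob_consistent[OF K\<sigma>], of T \<zeta>] by simp
  have fw: "0 < free_weight T \<zeta>" by (rule free_weight_pos[OF T])
  have lw: "ln (free_weight T \<zeta>) = - free_energy T \<zeta> - ln (free_partition T (snd \<circ> \<zeta>))"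
    using free_partition_pos[OF T, of "snd \<circ> \<zeta>"] by (simp add: free_weight_def ln_div)
  have "ln (cyl_prob K\<sigma> T \<zeta>) \<le> ln (exp (2 * edge_bound T) * (free_weight T \<zeta> * cyl_prob P T (snd \<circ> \<zeta>)))"
    using joint_measure_cyl_bounds(1)[OF P(1) sP J T, of \<zeta>] pos pos' fw by simp
  moreover have "ln (exp (- 2 * edge_bound T) * (free_weight T \<zeta> * cyl_prob P T (snd \<circ> \<zeta>))) \<le> ln (cyl_prob K\<sigma> T \<zeta>)"
    using joint_measure_cyl_bounds(2)[OF P(1) sP J T, of \<zeta>] pos pos' fw by simp
  ultimately show ?thesis using pos fw by (simp add: ln_mult lw abs_le_iff)
qed

text \<open>With every term written over joint patterns, the logarithms of \<open>K\<close> and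
  \<open>Kd\<close> cancel in \<open>B\<close>, and what is left is the error estimated in
  \<open>ln_joint_close\<close>. A pattern charged by \<open>K\<close> has positive mass under the
  other three measures by \<open>ac\<close>, so the logarithms of quotients split.\<close>

lemma entropy_identity:
  assumes ac: "\<And>\<eta>. cyl_prob P (box n) \<eta> = 0 \<Longrightarrow> cyl_prob Kd (box n) \<eta> = 0"
  shows "\<bar>weights_kl (cyl_prob K) (cyl_prob K\<sigma>) (box n) -
     (weights_kl (cyl_prob Kd) (cyl_prob P) (box n) - box_entropy K n + box_entropy Kd n
      + (\<integral>\<xi>. free_energy (box n) \<xi> \<partial>K) + (\<integral>\<xi>. ln (free_partition (box n) (snd \<circ> \<xi>)) \<partial>K))\<bar> \<le> 2 * edge_bound (box n)"
proof -
  let ?T = "box n :: 'n site set"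
  have T: "finite ?T" by simp
  have 1: "weights_kl (cyl_prob Kd) (cyl_prob P) ?T =
    (\<Sum>\<zeta>\<in>cfgs ?T. cyl_prob K ?T \<zeta> * ln (cyl_prob Kd ?T (snd \<circ> \<zeta>) / cyl_prob P ?T (snd \<circ> \<zeta>)))"
    unfolding weights_kl_def
  proof (rule disorder_marginal_expect[OF K T])
    show "local_on ?T (\<lambda>\<eta>. ln (cyl_prob Kd ?T \<eta> / cyl_prob P ?T \<eta>))"
      using weights_local[OF kd, of ?T] weights_local[OF p, of ?T] unfolding local_on_def by metis
  qed
  have "local_on ?T (\<lambda>\<eta>. ln (cyl_prob Kd ?T \<eta>))"
    using weights_local[OF kd, of ?T] unfolding local_on_def by metis
  hence 2: "box_entropy Kd n = - (\<Sum>\<zeta>\<in>cfgs ?T. cyl_prob K ?T \<zeta> * ln (cyl_prob Kd ?T (snd \<circ> \<zeta>)))"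
    unfolding box_entropy_def using disorder_marginal_expect[OF K T] by simp
  have 3: "(\<integral>\<xi>. free_energy ?T \<xi> \<partial>K) = (\<Sum>\<zeta>\<in>cfgs ?T. cyl_prob K ?T \<zeta> * free_energy ?T \<zeta>)"
    by (rule local_integral(2)[OF T free_energy_local K(1) sK])
  have 4: "(\<integral>\<xi>. ln (free_partition ?T (snd \<circ> \<xi>)) \<partial>K) =
     (\<Sum>\<zeta>\<in>cfgs ?T. cyl_prob K ?T \<zeta> * ln (free_partition ?T (snd \<circ> \<zeta>)))"
    by (rule local_integral(2)[OF T local_on_snd[OF ln_free_partition_local] K(1) sK])
  define B where "B \<zeta> = ln (cyl_prob K ?T \<zeta> / cyl_prob K\<sigma> ?T \<zeta>) -
      ln (cyl_prob Kd ?T (snd \<circ> \<zeta>) / cyl_prob P ?T (snd \<circ> \<zeta>)) - ln (cyl_prob K ?T \<zeta>) +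
      ln (cyl_prob Kd ?T (snd \<circ> \<zeta>)) - free_energy ?T \<zeta> - ln (free_partition ?T (snd \<circ> \<zeta>))" for \<zeta>
  have "weights_kl (cyl_prob K) (cyl_prob K\<sigma>) ?T -
     (weights_kl (cyl_prob Kd) (cyl_prob P) ?T - box_entropy K n + box_entropy Kd n
      + (\<integral>\<xi>. free_energy ?T \<xi> \<partial>K) + (\<integral>\<xi>. ln (free_partition ?T (snd \<circ> \<xi>)) \<partial>K)) =
     (\<Sum>\<zeta>\<in>cfgs ?T. cyl_prob K ?T \<zeta> * B \<zeta>)"
    unfolding 1 2 3 4 B_def
    by (simp add: weights_kl_def box_entropy_def sum.distrib sum_subtractf right_diff_distrib distrib_left)
  also have "\<bar>\<dots>\<bar> \<le> (\<Sum>\<zeta>\<in>cfgs ?T. \<bar>cyl_prob K ?T \<zeta> * B \<zeta>\<bar>)" by (rule sum_abs)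
  also have "\<dots> \<le> (\<Sum>\<zeta>\<in>cfgs ?T. cyl_prob K ?T \<zeta> * (2 * edge_bound ?T))"
  proof (rule sum_mono)
    fix \<zeta> :: "'n site \<Rightarrow> 'e \<times> 'd"
    show "\<bar>cyl_prob K ?T \<zeta> * B \<zeta>\<bar> \<le> cyl_prob K ?T \<zeta> * (2 * edge_bound ?T)"
    proof (cases "cyl_prob K ?T \<zeta> = 0")
      case False
      have kp: "0 < cyl_prob K ?T \<zeta>" using False weights_nonneg[OF k, of ?T \<zeta>] by simp
      hence kdp: "0 < cyl_prob Kd ?T (snd \<circ> \<zeta>)" using cyl_prob_le_marginal[OF K T, of \<zeta>] by simp
      hence pz: "cyl_prob P ?T (snd \<circ> \<zeta>) \<noteq> 0" using ac by force
      hence pp: "0 < cyl_prob P ?T (snd \<circ> \<zeta>)" using weights_nonneg[OF p, of ?T "snd \<circ> \<zeta>"] by simp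
      have sp: "0 < cyl_prob K\<sigma> ?T \<zeta>"
        using pz joint_null_iff[OF T, of \<zeta>] weights_nonneg[OF cyl_prob_consistent[OF K\<sigma>], of ?T \<zeta>] by simp
      have "B \<zeta> = ln (cyl_prob P ?T (snd \<circ> \<zeta>)) - free_energy ?T \<zeta> - ln (free_partition ?T (snd \<circ> \<zeta>)) - ln (cyl_prob K\<sigma> ?T \<zeta>)"
        unfolding B_def using kp kdp pp sp by (simp add: ln_div)
      hence "\<bar>B \<zeta>\<bar> \<le> 2 * edge_bound ?T" using ln_joint_close[OF T pz] by linarith
      thus ?thesis using kp by (simp add: abs_mult)
    qed simp
  qed
  also have "\<dots> = 2 * edge_bound ?T" by (simp add: sum_distrib_right[symmetric] weights_sum[OF k])
  finally show ?thesis .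
qed

section \<open>Densities of energy and pressure\<close>

definition pot_mean :: "'n site set \<Rightarrow> real" where
  "pot_mean A = (\<integral>\<xi>. \<Phi> A \<xi> \<partial>K)"

definition energy_density :: real where
  "energy_density = (\<Sum>A\<in>touching {0}. pot_mean A / real (card A))"

lemma pot_mean_shift:
  assumes "finite A"
  shows "pot_mean ((\<lambda>a. a + x) ` A) = pot_mean A"
proof -
  have "\<Phi> A \<in> borel_measurable K"
    using local_measurable[OF assms pot_local[OF assms]] sK by (simp cong: measurable_cong_sets)
  from mp_integral[OF shift_measure_preserving[OF K(2)] this, of x]
  show ?thesis by (simp add: pot_mean_def pot_shift[OF assms])
qed

lemma pot_mean_abs_le:
  assumes "finite A" "A \<noteq> {}"
  shows "\<bar>pot_mean A\<bar> \<le> b"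
proof -
  interpret prob_space K by (rule K(1))
  have "\<bar>pot_mean A\<bar> \<le> (\<integral>\<xi>. \<bar>\<Phi> A \<xi>\<bar> \<partial>K)" unfolding pot_mean_def by (rule integral_abs_bound)
  also have "\<dots> \<le> (\<integral>\<xi>. b \<partial>K)"
    using local_integral(1)[OF assms(1) pot_local[OF assms(1)] K(1) sK] pot_bound[OF assms]
    by (intro integral_mono) auto
  also have "\<dots> = b" by (simp add: prob_space)
  finally show ?thesis .
qed

lemma energy_density_infsum:
  "infsum (\<lambda>A. (\<integral>\<xi>. \<Phi> A \<xi> \<partial>K) / real (card A)) {A. finite A \<and> 0 \<in> A} = energy_density"
proof -
  have "infsum (\<lambda>A. (\<integral>\<xi>. \<Phi> A \<xi> \<partial>K) / real (card A)) {A. finite A \<and> 0 \<in> A} =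
     infsum (\<lambda>A. pot_mean A / real (card A)) (touching {0})"
  proof (rule infsum_cong_neutral)
    fix A :: "'n site set" assume A: "A \<in> {A. finite A \<and> 0 \<in> A} - touching {0}"
    then obtain x y where "x \<in> A" "y \<in> A" "y - x \<notin> box R" by (auto simp: touching_def)
    hence "\<Phi> A \<xi> = 0" for \<xi> using A by (intro pot_range[of A x y]) auto
    thus "(\<integral>\<xi>. \<Phi> A \<xi> \<partial>K) / real (card A) = 0" by simp
  next
    fix A :: "'n site set" assume "A \<in> touching {0} - {A. finite A \<and> 0 \<in> A}"
    thus "pot_mean A / real (card A) = 0" using touching_finite_member[of A "{0}"] by (auto simp: touching_def)
  qed (auto simp: pot_mean_def)
  thus ?thesis using finite_touching[of "{0}"] by (simp add: energy_density_def)
qed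

text \<open>Double counting: if the mean of \<open>\<Phi> A\<close> is shared equally by the sites
  of \<open>A\<close>, every site receives \<open>energy_density\<close> by translation invariance.
  Sets inside \<open>T\<close> are counted in full and crossing sets only in part, so the error is
  at most \<open>b\<close> per crossing set.\<close>

lemma free_energy_mean_close:
  assumes T: "finite T"
  shows "\<bar>(\<integral>\<xi>. free_energy T \<xi> \<partial>K) - real (card T) * energy_density\<bar> \<le> edge_bound T"
proof -
  define \<phi> where "\<phi> A = pot_mean A / real (card A)" for A
  have int: "integrable K (\<Phi> A)" if "A \<in> touching T" for A
    using touching_finite_member[OF that] local_integral(1)[OF _ pot_local K(1) sK] by blast
  have 1: "(\<integral>\<xi>. free_energy T \<xi> \<partial>K) = (\<Sum>A\<in>inner_sets T. pot_mean A)"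
    unfolding free_energy_def pot_mean_def
    by (rule Bochner_Integration.integral_sum) (auto simp: inner_sets_def int)
  have site: "(\<Sum>A\<in>touching {x}. \<phi> A) = energy_density" for x
  proof -
    have "touching {x} = (\<lambda>A. (\<lambda>a. a + x) ` A) ` touching {0}" using touching_translate[of x "{0}"] by simp
    hence "(\<Sum>A\<in>touching {x}. \<phi> A) = (\<Sum>A\<in>touching {0}. \<phi> ((\<lambda>a. a + x) ` A))"
      by (simp add: sum.reindex[OF inj_on_subset[OF inj_translate subset_UNIV]])
    also have "\<dots> = energy_density"
      unfolding energy_density_def
    proof (rule sum.cong[OF refl])
      fix A assume "A \<in> touching {0}"
      hence "finite A" by (rule touching_finite_member)
      thus "\<phi> ((\<lambda>a. a + x) ` A) = pot_mean A / real (card A)"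
        by (simp add: \<phi>_def pot_mean_shift card_image)
    qed
    finally show ?thesis .
  qed
  have "real (card T) * energy_density = (\<Sum>x\<in>T. \<Sum>A\<in>{A. A \<in> touching T \<and> x \<in> A}. \<phi> A)"
  proof -
    have "{A. A \<in> touching T \<and> x \<in> A} = touching {x}" if "x \<in> T" for x using that by (auto simp: touching_def)
    thus ?thesis by (simp add: site)
  qed
  also have "\<dots> = (\<Sum>A\<in>touching T. \<Sum>x\<in>{x. x \<in> T \<and> x \<in> A}. \<phi> A)"
    by (rule sum.swap_restrict[OF T finite_touching[OF T]])
  also have "\<dots> = (\<Sum>A\<in>touching T. real (card (T \<inter> A)) * \<phi> A)" by (simp add: Int_def)
  also have "\<dots> = (\<Sum>A\<in>inner_sets T. real (card (T \<inter> A)) * \<phi> A) + (\<Sum>A\<in>edge_sets T. real (card (T \<inter> A)) * \<phi> A)"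
  proof -
    have "touching T = inner_sets T \<union> edge_sets T" "inner_sets T \<inter> edge_sets T = {}"
      by (auto simp: inner_sets_def edge_sets_def)
    thus ?thesis using T by (simp add: sum.union_disjoint)
  qed
  also have "(\<Sum>A\<in>inner_sets T. real (card (T \<inter> A)) * \<phi> A) = (\<Sum>A\<in>inner_sets T. pot_mean A)"
  proof (rule sum.cong[OF refl])
    fix A assume "A \<in> inner_sets T"
    hence A: "A \<subseteq> T" "finite A" "A \<noteq> {}"
      using touching_finite_member touching_nonempty by (auto simp: inner_sets_def)
    thus "real (card (T \<inter> A)) * \<phi> A = pot_mean A" by (simp add: \<phi>_def Int_absorb1)
  qed
  finally have eq: "(\<integral>\<xi>. free_energy T \<xi> \<partial>K) - real (card T) * energy_density =
    - (\<Sum>A\<in>edge_sets T. real (card (T \<inter> A)) * \<phi> A)" by (simp add: 1)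
  have "\<bar>\<Sum>A\<in>edge_sets T. real (card (T \<inter> A)) * \<phi> A\<bar> \<le> (\<Sum>A\<in>edge_sets T. \<bar>real (card (T \<inter> A)) * \<phi> A\<bar>)"
    by (rule sum_abs)
  also have "\<dots> \<le> (\<Sum>A\<in>edge_sets T. b)"
  proof (rule sum_mono)
    fix A assume "A \<in> edge_sets T"
    hence A: "finite A" "A \<noteq> {}" using touching_finite_member touching_nonempty by (auto simp: edge_sets_def)
    hence c: "0 < card A" by (simp add: card_gt_0_iff)
    have "real (card (T \<inter> A)) / real (card A) \<le> 1" using A c by (simp add: card_mono)
    hence "real (card (T \<inter> A)) / real (card A) * \<bar>pot_mean A\<bar> \<le> 1 * b"
      using pot_mean_abs_le[OF A] b_nonneg by (intro mult_mono) auto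
    thus "\<bar>real (card (T \<inter> A)) * \<phi> A\<bar> \<le> b" by (simp add: \<phi>_def abs_mult)
  qed
  also have "\<dots> = edge_bound T" by (simp add: edge_bound_def)
  finally show ?thesis unfolding eq by simp
qed

lemma free_energy_mean_tendsto:
  "(\<lambda>n. (\<integral>\<xi>. free_energy (box n) \<xi> \<partial>K) / vol TYPE('n) n) \<longlonglongrightarrow> energy_density"
proof -
  have "(\<lambda>n. (\<integral>\<xi>. free_energy (box n) \<xi> \<partial>K) / vol TYPE('n) n - energy_density) \<longlonglongrightarrow> 0"
  proof (rule Lim_null_comparison[OF always_eventually edge_bound_box_tendsto], rule allI)
    fix n
    have "\<bar>(\<integral>\<xi>. free_energy (box n) \<xi> \<partial>K) - vol TYPE('n) n * energy_density\<bar> / vol TYPE('n) n \<le>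
        edge_bound (box n) / vol TYPE('n) n"
      using free_energy_mean_close[of "box n"]
      by (intro divide_right_mono less_imp_le[OF vol_pos]) (simp add: vol_def)
    moreover have "(\<integral>\<xi>. free_energy (box n) \<xi> \<partial>K) / vol TYPE('n) n - energy_density =
      ((\<integral>\<xi>. free_energy (box n) \<xi> \<partial>K) - vol TYPE('n) n * energy_density) / vol TYPE('n) n"
      by (simp add: diff_divide_distrib)
    ultimately show "norm ((\<integral>\<xi>. free_energy (box n) \<xi> \<partial>K) / vol TYPE('n) n - energy_density) \<le>
        edge_bound (box n) / vol TYPE('n) n"
      by (simp add: abs_divide less_imp_le)
  qed
  thus ?thesis by (simp add: LIM_zero_iff)
qed

definition pressure_avg :: "nat \<Rightarrow> ('n site \<Rightarrow> 'e \<times> 'd) \<Rightarrow> real" where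
  "pressure_avg n \<xi> = ln (partition_fn \<Phi> (box n) \<sigma>b (snd \<circ> \<xi>)) / vol TYPE('n) n"

lemma pressure_avg_close:
  "\<bar>pressure_avg n \<xi> - ln (free_partition (box n) (snd \<circ> \<xi>)) / vol TYPE('n) n\<bar> \<le> edge_bound (box n) / vol TYPE('n) n"
proof -
  have "\<bar>ln (partition_fn \<Phi> (box n) \<sigma>b (snd \<circ> \<xi>)) - ln (free_partition (box n) (snd \<circ> \<xi>))\<bar> / vol TYPE('n) n
      \<le> edge_bound (box n) / vol TYPE('n) n"
    by (intro divide_right_mono partition_fn_close less_imp_le[OF vol_pos]) simp
  thus ?thesis unfolding pressure_avg_def diff_divide_distrib[symmetric] by (simp add: abs_divide less_imp_le)
qed

lemma pressure_avg_AE_convergent: "AE \<xi> in K. convergent (\<lambda>n. pressure_avg n \<xi>)"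
  using ln_free_partition_AE_convergent[OF K]
proof eventually_elim
  case (elim \<xi>)
  have "(\<lambda>n. pressure_avg n \<xi> - ln (free_partition (box n) (snd \<circ> \<xi>)) / vol TYPE('n) n) \<longlonglongrightarrow> 0"
    by (rule Lim_null_comparison[OF always_eventually edge_bound_box_tendsto]) (simp add: pressure_avg_close)
  hence "convergent (\<lambda>n. pressure_avg n \<xi> - ln (free_partition (box n) (snd \<circ> \<xi>)) / vol TYPE('n) n)"
    by (auto simp: convergent_def)
  from convergent_add[OF this elim] show ?case by simp
qed

lemma pressure_avg_local: "local_on (\<Union>(touching (box n))) (pressure_avg n)"
proof -
  have "local_on (\<Union>(touching (box n))) (\<lambda>\<xi> :: 'n site \<Rightarrow> 'e \<times> 'd. partition_fn \<Phi> (box n) \<sigma>b (snd \<circ> \<xi>))"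
    by (rule local_on_snd[OF partition_fn_local]) simp
  thus ?thesis unfolding local_on_def pressure_avg_def by metis
qed

text \<open>Dominated convergence is applied to \<open>pressure_avg\<close>, whose limit appears in
  the formula; the integrals of the free version differ from it by a vanishing boundary
  term.\<close>

lemma free_pressure_mean_tendsto:
  "(\<lambda>n. (\<integral>\<xi>. ln (free_partition (box n) (snd \<circ> \<xi>)) \<partial>K) / vol TYPE('n) n) \<longlonglongrightarrow> (\<integral>\<xi>. lim (\<lambda>n. pressure_avg n \<xi>) \<partial>K)"
proof -
  interpret prob_space K by (rule K(1))
  \<comment> \<open>Per-site bound of the free log partition function plus the per-site bound of the
    boundary correction.\<close>
  define C where "C = site_const + ln (real CARD('e)) + site_const"
  define s where "s n \<xi> = ln (free_partition (box n) (snd \<circ> \<xi>)) / vol TYPE('n) n" for n and \<xi> :: "'n site \<Rightarrow> 'e \<times> 'd"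
  have m[measurable]: "pressure_avg n \<in> borel_measurable K" for n
    using local_measurable[OF finite_Union_touching pressure_avg_local] sK by (simp cong: measurable_cong_sets)
  have intp: "integrable K (pressure_avg n)" for n
    by (rule local_integral(1)[OF finite_Union_touching pressure_avg_local K(1) sK]) simp
  have "integrable K (\<lambda>\<xi>. ln (free_partition (box n) (snd \<circ> \<xi>)))" for n
    by (rule local_integral(1)[OF finite_box local_on_snd[OF ln_free_partition_local] K(1) sK])
  hence ints: "integrable K (s n)" for n unfolding s_def by simp
  have bound: "\<bar>pressure_avg n \<xi>\<bar> \<le> C" for n \<xi>
  proof -
    have "\<bar>s n \<xi>\<bar> \<le> (site_const + ln (real CARD('e))) * vol TYPE('n) n / vol TYPE('n) n"
      unfolding s_def abs_divide abs_of_pos[OF vol_pos]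
      using ln_free_partition_abs_le[of "box n" "snd \<circ> \<xi>"]
      by (intro divide_right_mono less_imp_le[OF vol_pos]) (simp add: vol_def)
    moreover have "edge_bound (box n) / vol TYPE('n) n \<le> site_const"
      using edge_bound_card[of "box n"] by (simp add: pos_divide_le_eq vol_def card_box)
    ultimately show ?thesis using pressure_avg_close[of n \<xi>, folded s_def] unfolding C_def by simp
  qed
  have lim: "(\<lambda>n. \<integral>\<xi>. pressure_avg n \<xi> \<partial>K) \<longlonglongrightarrow> (\<integral>\<xi>. lim (\<lambda>n. pressure_avg n \<xi>) \<partial>K)"
  proof (rule integral_dominated_convergence[where w="\<lambda>_. C"])
    show "AE \<xi> in K. (\<lambda>n. pressure_avg n \<xi>) \<longlonglongrightarrow> lim (\<lambda>n. pressure_avg n \<xi>)"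
      using pressure_avg_AE_convergent by (simp add: convergent_LIMSEQ_iff)
    show "(\<lambda>\<xi>. lim (\<lambda>n. pressure_avg n \<xi>)) \<in> borel_measurable K" by (rule borel_measurable_lim_metric) (rule m)
  qed (use bound in auto)
  have "(\<lambda>n. (\<integral>\<xi>. s n \<xi> \<partial>K) - (\<integral>\<xi>. pressure_avg n \<xi> \<partial>K)) \<longlonglongrightarrow> 0"
  proof (rule Lim_null_comparison[OF always_eventually edge_bound_box_tendsto], rule allI)
    fix n
    have "(\<integral>\<xi>. s n \<xi> \<partial>K) - (\<integral>\<xi>. pressure_avg n \<xi> \<partial>K) = (\<integral>\<xi>. s n \<xi> - pressure_avg n \<xi> \<partial>K)"
      using ints intp by simp
    also have "\<bar>\<dots>\<bar> \<le> (\<integral>\<xi>. \<bar>s n \<xi> - pressure_avg n \<xi>\<bar> \<partial>K)" by (rule integral_abs_bound)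
    also have "\<dots> \<le> (\<integral>\<xi>. edge_bound (box n) / vol TYPE('n) n \<partial>K)"
      using pressure_avg_close[of n, folded s_def]
      by (intro integral_mono integrable_abs Bochner_Integration.integrable_diff ints intp)
         (auto simp: abs_minus_commute)
    also have "\<dots> = edge_bound (box n) / vol TYPE('n) n" by (simp add: prob_space)
    finally show "norm ((\<integral>\<xi>. s n \<xi> \<partial>K) - (\<integral>\<xi>. pressure_avg n \<xi> \<partial>K)) \<le> edge_bound (box n) / vol TYPE('n) n" by simp
  qed
  from tendsto_add[OF this lim] show ?thesis by (simp add: s_def)
qed

text \<open>If \<open>Kd\<close> charges a \<open>P\<close>-null cylinder, both relative entropies
  tend to infinity. Otherwise all box terms are real, and the difference of the two relative
  entropies per site has a real limit.\<close>

lemma rel_entropy_tendsto: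
  "rel_entropy_box K K\<sigma> \<longlonglongrightarrow> rel_entropy_density Kd P
     + ereal (- ks_entropy K + ks_entropy Kd + energy_density + (\<integral>\<xi>. lim (\<lambda>n. pressure_avg n \<xi>) \<partial>K))"
proof (cases "\<forall>T \<eta>. finite T \<longrightarrow> cyl_prob P T \<eta> = 0 \<longrightarrow> cyl_prob Kd T \<eta> = 0")
  case False
  then obtain T \<eta> where T: "finite T" and z: "cyl_prob P T \<eta> = 0" "cyl_prob Kd T \<eta> \<noteq> 0" by blast
  have "rel_entropy_box Kd P \<longlonglongrightarrow> \<infinity>"
    by (rule rel_entropy_box_not_ac_tendsto[OF disorder_marginal_prob[OF K] disorder_marginal_sets[OF K] P(1) sP T z])
  hence "rel_entropy_density Kd P = \<infinity>" unfolding rel_entropy_density_def by (rule limI)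
  moreover obtain \<zeta> where \<zeta>: "snd \<circ> \<zeta> = \<eta>" "cyl_prob K T \<zeta> \<noteq> 0"
    using disorder_marginal_null[OF K T, of \<eta>] z by blast
  have "cyl_prob K\<sigma> T \<zeta> = 0" using joint_null_iff[OF T, of \<zeta>] \<zeta> z by simp
  hence "rel_entropy_box K K\<sigma> \<longlonglongrightarrow> \<infinity>"
    by (rule rel_entropy_box_not_ac_tendsto[OF K(1) sK K\<sigma> T _ \<zeta>(2)])
  ultimately show ?thesis by simp
next
  case True
  let ?V = "vol TYPE('n)"
  have ac: "cyl_prob Kd T \<eta> = 0" if "finite T" "cyl_prob P T \<eta> = 0" for T \<eta> using True that by blast
  have acj: "cyl_prob K (box n) \<zeta> = 0" if "cyl_prob K\<sigma> (box n) \<zeta> = 0" for n \<zeta>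
  proof -
    have "cyl_prob Kd (box n) (snd \<circ> \<zeta>) = 0" using ac joint_null_iff that by simp
    thus ?thesis using cyl_prob_le_marginal[OF K finite_box, of n \<zeta>] weights_nonneg[OF k, of "box n" \<zeta>] by simp
  qed
  define D where "D n = weights_kl (cyl_prob K) (cyl_prob K\<sigma>) (box n)" for n
  define D' where "D' n = weights_kl (cyl_prob Kd) (cyl_prob P) (box n)" for n
  define S where "S n = - box_entropy K n + box_entropy Kd n
      + (\<integral>\<xi>. free_energy (box n) \<xi> \<partial>K) + (\<integral>\<xi>. ln (free_partition (box n) (snd \<circ> \<xi>)) \<partial>K)" for n
  define L where "L = - ks_entropy K + ks_entropy Kd + energy_density + (\<integral>\<xi>. lim (\<lambda>n. pressure_avg n \<xi>) \<partial>K)"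
  have "(\<lambda>n. - (box_entropy K n / ?V n) + box_entropy Kd n / ?V n + (\<integral>\<xi>. free_energy (box n) \<xi> \<partial>K) / ?V n
      + (\<integral>\<xi>. ln (free_partition (box n) (snd \<circ> \<xi>)) \<partial>K) / ?V n) \<longlonglongrightarrow> L" unfolding L_def
    by (intro tendsto_intros box_entropy_tendsto[OF K] free_energy_mean_tendsto free_pressure_mean_tendsto
        box_entropy_tendsto[OF disorder_marginal_prob[OF K] disorder_marginal_transl_inv[OF K]])
  hence SL: "(\<lambda>n. S n / ?V n) \<longlonglongrightarrow> L" by (simp add: S_def add_divide_distrib diff_divide_distrib)
  have "(\<lambda>n. (D n - D' n) / ?V n - S n / ?V n) \<longlonglongrightarrow> 0"
  proof (rule Lim_null_comparison[OF always_eventually], rule allI)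
    fix n
    have "\<bar>D n - (D' n + S n)\<bar> \<le> 2 * edge_bound (box n)"
      using entropy_identity[of n] ac by (simp add: D_def D'_def S_def algebra_simps)
    hence "\<bar>D n - (D' n + S n)\<bar> / ?V n \<le> 2 * edge_bound (box n) / ?V n"
      by (intro divide_right_mono less_imp_le[OF vol_pos])
    moreover have "(D n - D' n) / ?V n - S n / ?V n = (D n - (D' n + S n)) / ?V n"
      by (simp add: diff_divide_distrib[symmetric])
    ultimately show "norm ((D n - D' n) / ?V n - S n / ?V n) \<le> 2 * (edge_bound (box n) / ?V n)"
      by (simp add: abs_divide less_imp_le)
    show "(\<lambda>n. 2 * (edge_bound (box n) / ?V n)) \<longlonglongrightarrow> 0"
      using tendsto_mult[OF tendsto_const edge_bound_box_tendsto, of 2] by simp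
  qed
  from tendsto_add[OF this SL] have DL: "(\<lambda>n. ereal ((D n - D' n) / ?V n)) \<longlonglongrightarrow> ereal L" by simp
  have "convergent (rel_entropy_box Kd P)"
    by (rule rel_entropy_box_convergent[OF disorder_marginal_prob[OF K] disorder_marginal_transl_inv[OF K] P])
  hence \<rho>: "rel_entropy_box Kd P \<longlonglongrightarrow> rel_entropy_density Kd P"
    unfolding rel_entropy_density_def by (simp add: convergent_LIMSEQ_iff)
  \<comment> \<open>Adding limits in \<open>ereal\<close> is safe because the second limit is real,
    while the first may be infinite.\<close>
  have "(\<lambda>n. rel_entropy_box Kd P n + ereal ((D n - D' n) / ?V n)) \<longlonglongrightarrow> rel_entropy_density Kd P + ereal L"
    by (rule tendsto_add_ereal_general[OF _ \<rho> DL]) simp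
  moreover have "rel_entropy_box Kd P n + ereal ((D n - D' n) / ?V n) = rel_entropy_box K K\<sigma> n" for n
    using rel_entropy_box_ac[of P n Kd] rel_entropy_box_ac[of K\<sigma> n K] ac acj
    by (simp add: D_def D'_def diff_divide_distrib)
  ultimately show ?thesis by (simp add: L_def)
qed

end

lemma site_diam_ge:
  assumes "finite A" "x \<in> A" "y \<in> A"
  shows "real_of_int \<bar>x $ i - y $ i\<bar> \<le> site_diam A"
proof -
  let ?S = "{real_of_int \<bar>x $ i - y $ i\<bar> | x y i. x \<in> A \<and> y \<in> A}"
  have "?S = (\<lambda>(x, y, i). real_of_int \<bar>x $ i - y $ i\<bar>) ` (A \<times> A \<times> UNIV)" by force
  hence "finite ?S" using assms(1) by simp
  moreover have "real_of_int \<bar>x $ i - y $ i\<bar> \<in> ?S" using assms by blast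
  ultimately have "real_of_int \<bar>x $ i - y $ i\<bar> \<le> Max ?S" by (rule Max_ge)
  thus ?thesis using assms by (auto simp: site_diam_def)
qed

text \<open>Translating a site of an interacting set to the origin places the set inside
  \<open>box R\<close>, which has finitely many subsets, each with finitely many patterns.\<close>

lemma range_potential_exists:
  fixes \<Phi> :: "'n::finite site set \<Rightarrow> ('n site \<Rightarrow> 'e::finite \<times> 'd::finite) \<Rightarrow> real"
  assumes "is_local_potential \<Phi>" "finite_range_potential \<Phi>" "transl_inv_potential \<Phi>"
  shows "\<exists>R b. range_potential \<Phi> R b"
proof -
  obtain r where r: "\<And>A \<xi>. finite A \<Longrightarrow> site_diam A > r \<Longrightarrow> \<Phi> A \<xi> = 0"
    using assms(2) unfolding finite_range_potential_def by blast
  \<comment> \<open>The real range is rounded up to a natural radius; a negative \<open>r\<close>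
    gives radius 0.\<close>
  define R where "R = nat \<lceil>r\<rceil>"
  \<comment> \<open>A sum of absolute values in place of a maximum, so that every single term lies
    below it.\<close>
  define b where "b = (\<Sum>A\<in>Pow (box R). \<Sum>\<zeta>\<in>cfgs A. \<bar>\<Phi> A \<zeta>\<bar>)"
  have loc: "local_on A (\<Phi> A)" if "finite A" for A
    using assms(1) that by (auto simp: is_local_potential_def local_on_def)
  have rng: "\<Phi> A \<xi> = 0" if A: "finite A" "x \<in> A" "y \<in> A" "y - x \<notin> box R" for A x y \<xi>
  proof (rule r[OF A(1)])
    obtain i where "\<bar>(y - x) $ i\<bar> > int R" using A(4) boxI[of "y - x" R] by (meson not_le)
    hence "real_of_int (int R) < real_of_int \<bar>y $ i - x $ i\<bar>" by (simp only: of_int_less_iff vector_minus_component)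
    moreover have "r \<le> real R" unfolding R_def by (rule real_nat_ceiling_ge)
    ultimately have "r < real_of_int \<bar>y $ i - x $ i\<bar>" by simp
    also have "\<dots> \<le> site_diam A" by (rule site_diam_ge[OF A(1,3,2)])
    finally show "r < site_diam A" .
  qed
  have shf: "\<Phi> ((\<lambda>a. a + x) ` A) \<xi> = \<Phi> A (shift x \<xi>)" if "finite A" for A x \<xi>
    using assms(3) that by (simp add: transl_inv_potential_def)
  have bnd: "\<bar>\<Phi> A \<xi>\<bar> \<le> b" if A: "finite A" "A \<noteq> {}" for A \<xi>
  proof (cases "\<forall>x\<in>A. \<forall>y\<in>A. y - x \<in> box R")
    case False
    then obtain x y where "x \<in> A" "y \<in> A" "y - x \<notin> box R" by blast
    hence "\<Phi> A \<xi> = 0" using rng A by blast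
    moreover have "0 \<le> b" unfolding b_def by (intro sum_nonneg) simp
    ultimately show ?thesis by simp
  next
    case True
    obtain x where x: "x \<in> A" using A by auto
    define A' where "A' = (\<lambda>a. a + (- x)) ` A"
    have A': "A' \<in> Pow (box R)" using True x by (auto simp: A'_def)
    have fA': "finite A'" using A by (simp add: A'_def)
    have "A = (\<lambda>a. a + x) ` A'" by (simp add: A'_def image_image)
    hence "\<Phi> A \<xi> = \<Phi> A' (shift x \<xi>)" using shf[OF fA'] by simp
    also have "\<dots> = \<Phi> A' (restrict (shift x \<xi>) A')" by (rule local_onD[OF loc[OF fA']]) simp
    finally have "\<bar>\<Phi> A \<xi>\<bar> = \<bar>\<Phi> A' (restrict (shift x \<xi>) A')\<bar>" by simp
    also have "\<dots> \<le> (\<Sum>\<zeta>\<in>cfgs A'. \<bar>\<Phi> A' \<zeta>\<bar>)"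
      by (rule member_le_sum[OF restrict_in_cfgs]) (use fA' in auto)
    also have "\<dots> \<le> b" unfolding b_def
      by (rule member_le_sum[OF A']) (auto intro: sum_nonneg)
    finally show ?thesis .
  qed
  have "range_potential \<Phi> R b" using loc rng bnd shf by unfold_locales auto
  thus ?thesis by blast
qed

theorem theorem6p7:
  fixes \<Phi> :: "'n::finite site set \<Rightarrow> ('n site \<Rightarrow> 'e::finite \<times> 'd::finite) \<Rightarrow> real"
    and P :: "('n site \<Rightarrow> 'd) measure"
    and \<sigma>b :: "'n site \<Rightarrow> 'e"
    and K\<sigma> K :: "('n site \<Rightarrow> 'e \<times> 'd) measure"
  assumes "is_local_potential \<Phi>"
    and "finite_range_potential \<Phi>"
    and "transl_inv_potential \<Phi>"
    and "prob_space P"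
    and "asymptotically_decoupled P"
    and "is_joint_measure \<Phi> P \<sigma>b K\<sigma>"
    and "transl_inv_measure K\<sigma>"
    and "prob_space K"
    and "transl_inv_measure K"
  shows "(AE \<xi> in K. convergent (\<lambda>n. ln (partition_fn \<Phi> (box n) \<sigma>b (snd \<circ> \<xi>))
                                      / real (card (box n :: 'n site set))))
    \<and> (rel_entropy_box K K\<sigma> \<longlonglongrightarrow>
         rel_entropy_density (disorder_marginal K) P
         + ereal (- ks_entropy K + ks_entropy (disorder_marginal K)
             + infsum (\<lambda>A. (\<integral>\<xi>. \<Phi> A \<xi> \<partial>K) / real (card A)) {A. finite A \<and> 0 \<in> A}
             + (\<integral>\<xi>. lim (\<lambda>n. ln (partition_fn \<Phi> (box n) \<sigma>b (snd \<circ> \<xi>))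
                              / real (card (box n :: 'n site set))) \<partial>K)))"
proof -
  obtain R b where "range_potential \<Phi> R b" using range_potential_exists assms(1-3) by blast
  then interpret range_potential \<Phi> R b .
  interpret joint_setup \<Phi> R b P \<sigma>b K\<sigma> K
    by (intro joint_setup.intro joint_setup_axioms.intro) fact+
  show ?thesis
    using pressure_avg_AE_convergent rel_entropy_tendsto
    unfolding energy_density_infsum pressure_avg_def vol_def by simp
qed

end
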